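(* Let $\mathbb Z_2=\{1,a\}$ and let $\mathcal C=\mathcal C_1\oplus\mathcal C_a$ be a modular $\mathbb Z_2$-equivariant fusion category with extended Verlinde algebra $\widetilde{\mathcal V}$. Fix a generic basis of $\widetilde{\mathcal V}$ such that ${}^a\lambda_k*{}^a\lambda_k=d_k^{-1}\lambda_k$ for all $k\in{}^aI_1$. Let $\widetilde{\mathcal V}_{*,1}=\widetilde{\mathcal V}_{1,1}\oplus\widetilde{\mathcal V}_{a,1}$, and for $k\in{}^aI_1$ put $$\alpha_k=\tfrac12({}^a\lambda_k-\lambda_k),\qquad \beta_k=\tfrac12({}^a\lambda_k+\lambda_k).$$ Let $M\colon\widetilde{\mathcal V}_{*,1}\to\widetilde{\mathcal V}_{*,1}$ be the change of basis operator $$M\lambda_k=\alpha_k,\quad M\,{}^a\lambda_k=\beta_k\quad(k\in{}^aI_1),\qquad M\lambda_k=\lambda_k\quad(k\in I_1,\ k\notin{}^aI_1),$$ which makes the convolution product diagonal. Fix $i\in I_a$, and let $L_i\colon\widetilde{\mathcal V}_{1,a}\to\widetilde{\mathcal V}_{1,1}$ be the operator of left multiplication (for the tensor product) by $\lambda_i$ in this basis. Define a linear operator $D_i\colon\widetilde{\mathcal V}_{*,1}\to\widetilde{\mathcal V}_{*,1}$ as follows: for $k\in{}^aI_1$, $$D_i\alpha_k=-\frac{(s\lambda_i,{}^a\lambda_k)}{(s\lambda_0,\lambda_k)}\,\alpha_k,\qquad D_i\beta_k=\frac{(s\lambda_i,{}^a\lambda_k)}{(s\lambda_0,\lambda_k)}\,\beta_k,$$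 and for $k\in I_1$ with $k\notin{}^aI_1$, $$D_i\lambda_k=\frac{(s\lambda_i,{}^a\lambda_k)}{(s\lambda_0,\lambda_k)}\,\lambda_k .$$ Then $$M\,s\,L_i=D_i\,M\,s .$$
   Context: $G$-equivariant fusion category (here $G=\mathbb Z_2$): a semisimple $\mathbb C$-linear abelian rigid monoidal category $\mathcal C=\bigoplus_{h\in G}\mathcal C_h$ (unit object $\mathbf 1$ simple) with $\mathcal C_g\otimes\mathcal C_h\subset\mathcal C_{gh}$; an action of $G$ by tensor functors $R_g$ (written ${}^gV=R_g(V)$) with coherent isomorphisms $R_gR_h\simeq R_{gh}$, $R_1=\mathrm{id}$, $R_g\mathcal C_h\subset\mathcal C_{ghg^{-1}}$; functorial isomorphisms $\delta_V\colon V\to V^{**}$ (satisfying the usual compatibilities as in the absence of $G$) with $R_g(\delta_V)=\delta_{R_g(V)}$; and functorial $G$-crossed braidings $c_{V,W}\colon V\otimes W\to{}^gW\otimes V$ for $V\in\mathcal C_g$, in the sense of Turaev. Extended Verlinde algebra: fix a representative $V_i$ of each isomorphism class of simple objects, $i\in I$, with $V_0=\mathbf 1$; $d_i=\dim V_i$ is the categorical dimension. $I_h$ denotes the classes in $\mathcal C_h$, and ${}^gI_h$ those classes of $I_h$ invariant under $g$. Set $\widetilde{\mathcal V}_{g,h}=\bigoplus_{i\in I_h}\mathrm{Mor}(V_i,{}^gV_i)$ and $\widetilde{\mathcal V}=\bigoplus_{gh=hg}\widetilde{\mathcal V}_{g,h}$. Any $\varphi\colon V\to{}^gV$ defines a class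 $[\varphi]\in\widetilde{\mathcal V}$, linear in $\varphi$, with $[R_g(T)\varphi T^{-1}]=[\varphi]$ for isomorphisms $T$, and $[\varphi]=\sum_i[\varphi_{ii}]$ for $\varphi=(\varphi_{ij})$ on a direct sum of simple objects. Tensor product: for $\varphi\in\widetilde{\mathcal V}_{g,b}$, $\psi\in\widetilde{\mathcal V}_{h,c}$, $[\varphi]\otimes[\psi]=[\varphi\otimes\psi]\in\widetilde{\mathcal V}_{g,bc}$ if $g=h$, and $0$ otherwise. Convolution product: for $\varphi\colon V_i\to{}^gV_i$, $\psi\colon V_j\to{}^hV_j$, $[\varphi]*[\psi]=0$ if ${}^hV_j\not\simeq V_i$; otherwise, choosing an isomorphism $\kappa\colon{}^hV_j\to V_i$, $[\varphi]*[\psi]=d_i^{-1}[R_g(\kappa^{-1})\circ\varphi\circ\kappa\circ\psi]$, where $R_g(\kappa^{-1})\varphi\kappa\psi\colon V_j\to{}^{gh}V_j$. Involution and bilinear form: for $\varphi\colon V\to{}^gV$ the adjoint $\varphi^*\colon{}^gV^*\to V^*$ defines a linear map $*\colon\widetilde{\mathcal V}_{g,h}\to\widetilde{\mathcal V}_{g^{-1},h^{-1}}$. Let $[\ ]_0\colon\widetilde{\mathcal V}\to\mathbb C$ be the linear map which is $0$ on $\mathrm{Mor}(V_i,{}^gV_i)$ for $i\neq0$ and $1$ on the canonical isomorphisms $\mathbf 1\to{}^g\mathbf 1$. Put $(\varphi,\psi)=[\varphi\otimes\psi^*]_0$. $s$-matrix: $\tilde s\colon\widetilde{\mathcal V}_{g,h}\to\widetilde{\mathcal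 V}_{h^{-1},g}$, $\tilde s[\varphi]=\sum_{k\in{}^{h^{-1}}I_g}(\tilde s[\varphi])_k$, where for $\varphi\colon V\to{}^gV$, $V\in\mathcal C_h$, the morphism $(\tilde s[\varphi])_k\colon V_k\to{}^{h^{-1}}V_k$ is $d_k$ times the morphism obtained by encircling the strand $V_k$ by a closed $V$-coloured loop carrying $\varphi$, i.e. $d_k$ times the partial trace over $V$ of $$V\otimes V_k\xrightarrow{\varphi\otimes\mathrm{id}}{}^gV\otimes V_k\xrightarrow{c^{-1}}V_k\otimes V\xrightarrow{c^{-1}}V\otimes{}^{h^{-1}}V_k .$$ $\mathcal C$ is called modular if it has finitely many isomorphism classes of simple objects and $\tilde s$ is invertible. The normalized operator is $s=D^{-1}\tilde s$, where $D=\sqrt{p^+p^-}$, $p^{\pm}=\sum_{i\in I_1}\theta_i^{\pm1}d_i^2$, and $\theta_i$ is the scalar by which the twist acts on $V_i$, $i\in I_1$. Generic basis: for every $g\in G$ and every $i\in I$ invariant under $g$, the space $\mathrm{Mor}(V_i,{}^gV_i)$ is one-dimensional; choose a nonzero element ${}^g\lambda_i$ in it, with $\lambda_i={}^1\lambda_i=\mathrm{id}_{V_i}$ for $g=1$. (For $k\in I_1$ with $k\notin{}^aI_1$ one has $\mathrm{Mor}(V_k,{}^aV_k)=0$ and no basis element is chosen there; the symbol ${}^a\lambda_k$ in the last formula for $D_i$ is reproduced as printed.)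
   Formalization: The printed identity fails as an equation of operators on one space; it is stated as an identity of matrices: M, s, L_i in the basis λ_k, ^aλ_k, and D_i by its diagonal matrix in the basis α_k, β_k, λ_k; for k not in ^aI_1 the symbol ^aλ_k is read as 0. *)

theory Defs
  imports Complex_Main "HOL-Library.Z2" "HOL-Library.Function_Algebras"
begin

section \<open>Linear, abelian and semisimple categories\<close>

text \<open>
  All morphisms live in one complex vector space \<open>'m\<close>, and each \<open>hom X Y\<close> is a subspace of it.
  This is no restriction: every \<open>\<complex>\<close>-linear category embeds in this way into the product of its
  Hom spaces.  All elements of \<open>'o\<close> are objects.  \<open>cmp f g\<close> is \<open>f\<close> after \<open>g\<close>; its
  value matters only on composable morphisms.
\<close>

record ('o, 'm) lincat =
  scl :: "complex \<Rightarrow> 'm \<Rightarrow> 'm"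
  hom :: "'o \<Rightarrow> 'o \<Rightarrow> 'm set"
  idm :: "'o \<Rightarrow> 'm"
  cmp :: "'m \<Rightarrow> 'm \<Rightarrow> 'm"  (infixr "\<cdot>\<index>" 70)

locale linear_category = vector_space "scl C"
  for C :: "('o, 'm::ab_group_add, 'z) lincat_scheme" (structure) +
  assumes hom_subspace: "subspace (hom C X Y)"
    and idm_hom: "idm C X \<in> hom C X X"
    and cmp_hom: "\<lbrakk>f \<in> hom C Y Z; g \<in> hom C X Y\<rbrakk> \<Longrightarrow> f \<cdot> g \<in> hom C X Z"
    and cmp_assoc: "\<lbrakk>f \<in> hom C Y Z; g \<in> hom C X Y; h \<in> hom C W X\<rbrakk>
           \<Longrightarrow> (f \<cdot> g) \<cdot> h = f \<cdot> (g \<cdot> h)"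
    and cmp_idm_left: "f \<in> hom C X Y \<Longrightarrow> idm C Y \<cdot> f = f"
    and cmp_idm_right: "f \<in> hom C X Y \<Longrightarrow> f \<cdot> idm C X = f"
    and cmp_add_left: "\<lbrakk>f \<in> hom C Y Z; f' \<in> hom C Y Z; g \<in> hom C X Y\<rbrakk>
           \<Longrightarrow> (f + f') \<cdot> g = f \<cdot> g + f' \<cdot> g"
    and cmp_add_right: "\<lbrakk>f \<in> hom C Y Z; g \<in> hom C X Y; g' \<in> hom C X Y\<rbrakk>
           \<Longrightarrow> f \<cdot> (g + g') = f \<cdot> g + f \<cdot> g'"
    and cmp_scl_left: "\<lbrakk>f \<in> hom C Y Z; g \<in> hom C X Y\<rbrakk> \<Longrightarrow> scl C c f \<cdot> g = scl C c (f \<cdot> g)"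
    and cmp_scl_right: "\<lbrakk>f \<in> hom C Y Z; g \<in> hom C X Y\<rbrakk> \<Longrightarrow> f \<cdot> scl C c g = scl C c (f \<cdot> g)"

context
  fixes C :: "('o, 'm::ab_group_add, 'z) lincat_scheme" (structure)
begin

definition inverse_mor :: "'o \<Rightarrow> 'o \<Rightarrow> 'm \<Rightarrow> 'm \<Rightarrow> bool" where
  "inverse_mor X Y f g \<longleftrightarrow> f \<in> hom C X Y \<and> g \<in> hom C Y X \<and> g \<cdot> f = idm C X \<and> f \<cdot> g = idm C Y"

definition iso :: "'o \<Rightarrow> 'o \<Rightarrow> 'm \<Rightarrow> bool" where
  "iso X Y f \<longleftrightarrow> (\<exists>g. inverse_mor X Y f g)"

definition minv :: "'o \<Rightarrow> 'o \<Rightarrow> 'm \<Rightarrow> 'm" where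
  "minv X Y f = (THE g. inverse_mor X Y f g)"

definition isomorphic :: "'o \<Rightarrow> 'o \<Rightarrow> bool" where
  "isomorphic X Y \<longleftrightarrow> (\<exists>f. iso X Y f)"

definition mono_mor :: "'o \<Rightarrow> 'o \<Rightarrow> 'm \<Rightarrow> bool" where
  "mono_mor X Y f \<longleftrightarrow> f \<in> hom C X Y \<and>
     (\<forall>W. \<forall>g \<in> hom C W X. \<forall>h \<in> hom C W X. f \<cdot> g = f \<cdot> h \<longrightarrow> g = h)"

definition epi_mor :: "'o \<Rightarrow> 'o \<Rightarrow> 'm \<Rightarrow> bool" where
  "epi_mor X Y f \<longleftrightarrow> f \<in> hom C X Y \<and>
     (\<forall>Z. \<forall>g \<in> hom C Y Z. \<forall>h \<in> hom C Y Z. g \<cdot> f = h \<cdot> f \<longrightarrow> g = h)"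

definition is_kernel :: "'o \<Rightarrow> 'o \<Rightarrow> 'm \<Rightarrow> 'o \<Rightarrow> 'm \<Rightarrow> bool" where
  "is_kernel X Y f K k \<longleftrightarrow> f \<in> hom C X Y \<and> k \<in> hom C K X \<and> f \<cdot> k = 0 \<and>
     (\<forall>W. \<forall>h \<in> hom C W X. f \<cdot> h = 0 \<longrightarrow> (\<exists>!u. u \<in> hom C W K \<and> k \<cdot> u = h))"

definition is_cokernel :: "'o \<Rightarrow> 'o \<Rightarrow> 'm \<Rightarrow> 'o \<Rightarrow> 'm \<Rightarrow> bool" where
  "is_cokernel X Y f Q q \<longleftrightarrow> f \<in> hom C X Y \<and> q \<in> hom C Y Q \<and> q \<cdot> f = 0 \<and>
     (\<forall>W. \<forall>h \<in> hom C Y W. h \<cdot> f = 0 \<longrightarrow> (\<exists>!u. u \<in> hom C Q W \<and> u \<cdot> q = h))"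

text \<open>\<open>V\<close> is the direct sum of the \<open>X j\<close>, \<open>j \<in> J\<close>; for \<open>J = {}\<close> it is a zero object.\<close>

definition direct_sum :: "'j set \<Rightarrow> ('j \<Rightarrow> 'o) \<Rightarrow> 'o \<Rightarrow> ('j \<Rightarrow> 'm) \<Rightarrow> ('j \<Rightarrow> 'm) \<Rightarrow> bool" where
  "direct_sum J X V inc prj \<longleftrightarrow> finite J \<and>
     (\<forall>j\<in>J. inc j \<in> hom C (X j) V \<and> prj j \<in> hom C V (X j)) \<and>
     (\<forall>j\<in>J. \<forall>k\<in>J. prj j \<cdot> inc k = (if j = k then idm C (X j) else 0)) \<and>
     (\<Sum>j\<in>J. inc j \<cdot> prj j) = idm C V"

definition simple :: "'o \<Rightarrow> bool" where
  "simple X \<longleftrightarrow> idm C X \<noteq> 0 \<and> (\<forall>Y f. mono_mor Y X f \<longrightarrow> f = 0 \<or> iso Y X f)"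

end

locale abelian_category = linear_category C
  for C :: "('o, 'm::ab_group_add, 'z) lincat_scheme" (structure) +
  assumes finite_direct_sums: "\<exists>V inc prj. direct_sum C {..<n::nat} Xs V inc prj"
    and kernels: "f \<in> hom C X Y \<Longrightarrow> \<exists>K k. is_kernel C X Y f K k"
    and cokernels: "f \<in> hom C X Y \<Longrightarrow> \<exists>Q q. is_cokernel C X Y f Q q"
    and mono_normal: "mono_mor C X Y f \<Longrightarrow> \<exists>Z g. is_kernel C Y Z g X f"
    and epi_normal: "epi_mor C X Y f \<Longrightarrow> \<exists>W g. is_cokernel C W X g Y f"

locale semisimple_category = abelian_category C
  for C :: "('o, 'm::ab_group_add, 'z) lincat_scheme" (structure) +
  assumes semisimple: "\<exists>(n::nat) Xs inc prj. (\<forall>r<n. simple C (Xs r)) \<and> direct_sum C {..<n} Xs V inc prj"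
    and hom_finite_dim: "\<exists>B. finite B \<and> hom C X Y = span B"


section \<open>Rigid monoidal categories and pivotal structures\<close>

record ('o, 'm) moncat = "('o, 'm) lincat" +
  unt :: "'o"  ("\<one>\<index>")
  tens :: "'o \<Rightarrow> 'o \<Rightarrow> 'o"  (infixr "\<otimes>\<index>" 80)
  tensm :: "'m \<Rightarrow> 'm \<Rightarrow> 'm"  (infixr "\<boxtimes>\<index>" 80)
  asc :: "'o \<Rightarrow> 'o \<Rightarrow> 'o \<Rightarrow> 'm"
  lun :: "'o \<Rightarrow> 'm"
  run :: "'o \<Rightarrow> 'm"

locale monoidal_category = linear_category C
  for C :: "('o, 'm::ab_group_add, 'z) moncat_scheme" (structure) +
  assumes tensm_hom: "\<lbrakk>f \<in> hom C X X'; g \<in> hom C Y Y'\<rbrakk> \<Longrightarrow> f \<boxtimes> g \<in> hom C (X \<otimes> Y) (X' \<otimes> Y')"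
    and tensm_idm: "idm C X \<boxtimes> idm C Y = idm C (X \<otimes> Y)"
    and tensm_cmp: "\<lbrakk>f \<in> hom C X X'; f' \<in> hom C X' X''; g \<in> hom C Y Y'; g' \<in> hom C Y' Y''\<rbrakk>
           \<Longrightarrow> (f' \<cdot> f) \<boxtimes> (g' \<cdot> g) = (f' \<boxtimes> g') \<cdot> (f \<boxtimes> g)"
    and tensm_add_left: "\<lbrakk>f \<in> hom C X X'; f' \<in> hom C X X'; g \<in> hom C Y Y'\<rbrakk>
           \<Longrightarrow> (f + f') \<boxtimes> g = f \<boxtimes> g + f' \<boxtimes> g"
    and tensm_add_right: "\<lbrakk>f \<in> hom C X X'; g \<in> hom C Y Y'; g' \<in> hom C Y Y'\<rbrakk>
           \<Longrightarrow> f \<boxtimes> (g + g') = f \<boxtimes> g + f \<boxtimes> g'"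
    and tensm_scl_left: "\<lbrakk>f \<in> hom C X X'; g \<in> hom C Y Y'\<rbrakk> \<Longrightarrow> scl C c f \<boxtimes> g = scl C c (f \<boxtimes> g)"
    and tensm_scl_right: "\<lbrakk>f \<in> hom C X X'; g \<in> hom C Y Y'\<rbrakk> \<Longrightarrow> f \<boxtimes> scl C c g = scl C c (f \<boxtimes> g)"
    and asc_iso: "iso C ((X \<otimes> Y) \<otimes> Z) (X \<otimes> (Y \<otimes> Z)) (asc C X Y Z)"
    and asc_natural: "\<lbrakk>f \<in> hom C X X'; g \<in> hom C Y Y'; h \<in> hom C Z Z'\<rbrakk>
           \<Longrightarrow> asc C X' Y' Z' \<cdot> ((f \<boxtimes> g) \<boxtimes> h) = (f \<boxtimes> (g \<boxtimes> h)) \<cdot> asc C X Y Z"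
    and lun_iso: "iso C (\<one> \<otimes> X) X (lun C X)"
    and lun_natural: "f \<in> hom C X Y \<Longrightarrow> lun C Y \<cdot> (idm C \<one> \<boxtimes> f) = f \<cdot> lun C X"
    and run_iso: "iso C (X \<otimes> \<one>) X (run C X)"
    and run_natural: "f \<in> hom C X Y \<Longrightarrow> run C Y \<cdot> (f \<boxtimes> idm C \<one>) = f \<cdot> run C X"
    and pentagon: "asc C W X (Y \<otimes> Z) \<cdot> asc C (W \<otimes> X) Y Z
           = (idm C W \<boxtimes> asc C X Y Z) \<cdot> asc C W (X \<otimes> Y) Z \<cdot> (asc C W X Y \<boxtimes> idm C Z)"
    and triangle: "(idm C X \<boxtimes> lun C Y) \<cdot> asc C X \<one> Y = run C X \<boxtimes> idm C Y"

context
  fixes C :: "('o, 'm::ab_group_add, 'z) moncat_scheme" (structure)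
begin

definition asci :: "'o \<Rightarrow> 'o \<Rightarrow> 'o \<Rightarrow> 'm" where
  "asci X Y Z = minv C ((X \<otimes> Y) \<otimes> Z) (X \<otimes> (Y \<otimes> Z)) (asc C X Y Z)"

definition luni :: "'o \<Rightarrow> 'm" where
  "luni X = minv C (\<one> \<otimes> X) X (lun C X)"

definition runi :: "'o \<Rightarrow> 'm" where
  "runi X = minv C (X \<otimes> \<one>) X (run C X)"

text \<open>\<open>W\<close> is a left dual of \<open>V\<close> (equivalently \<open>V\<close> is a right dual of \<open>W\<close>), with evaluation
  \<open>e: W \<otimes> V \<rightarrow> \<one>\<close> and coevaluation \<open>b: \<one> \<rightarrow> V \<otimes> W\<close>.\<close>

definition is_dual :: "'o \<Rightarrow> 'o \<Rightarrow> 'm \<Rightarrow> 'm \<Rightarrow> bool" where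
  "is_dual W V e b \<longleftrightarrow> e \<in> hom C (W \<otimes> V) \<one> \<and> b \<in> hom C \<one> (V \<otimes> W) \<and>
     run C V \<cdot> (idm C V \<boxtimes> e) \<cdot> asc C V W V \<cdot> (b \<boxtimes> idm C V) \<cdot> luni V = idm C V \<and>
     lun C W \<cdot> (e \<boxtimes> idm C W) \<cdot> asci W V W \<cdot> (idm C W \<boxtimes> b) \<cdot> runi W = idm C W"

text \<open>The transpose \<open>W' \<rightarrow> W\<close> of \<open>f: V \<rightarrow> V'\<close>, where \<open>W\<close>, \<open>W'\<close> are left duals of \<open>V\<close>, \<open>V'\<close>,
  with \<open>e': W' \<otimes> V' \<rightarrow> \<one>\<close> and \<open>b: \<one> \<rightarrow> V \<otimes> W\<close>.  For \<open>f = id\<close> this is the canonical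
  isomorphism between two left duals of the same object.\<close>

definition transp :: "'o \<Rightarrow> 'o \<Rightarrow> 'o \<Rightarrow> 'o \<Rightarrow> 'm \<Rightarrow> 'm \<Rightarrow> 'm \<Rightarrow> 'm" where
  "transp V V' W W' e' b f =
     lun C W \<cdot> (e' \<boxtimes> idm C W) \<cdot> asci W' V' W \<cdot> (idm C W' \<boxtimes> (f \<boxtimes> idm C W)) \<cdot>
     (idm C W' \<boxtimes> b) \<cdot> runi W'"

end

record ('o, 'm) pivcat = "('o, 'm) moncat" +
  dual :: "'o \<Rightarrow> 'o"
  ev :: "'o \<Rightarrow> 'm"
  coev :: "'o \<Rightarrow> 'm"
  piv :: "'o \<Rightarrow> 'm"

context
  fixes C :: "('o, 'm::ab_group_add, 'z) pivcat_scheme" (structure)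
begin

definition dualm :: "'o \<Rightarrow> 'o \<Rightarrow> 'm \<Rightarrow> 'm" where
  "dualm X Y f = transp C X Y (dual C X) (dual C Y) (ev C Y) (coev C X) f"

text \<open>The canonical isomorphisms \<open>Y\<^sup>* \<otimes> X\<^sup>* \<rightarrow> (X \<otimes> Y)\<^sup>*\<close> and \<open>\<one> \<rightarrow> \<one>\<^sup>*\<close>.\<close>

definition dual_tens :: "'o \<Rightarrow> 'o \<Rightarrow> 'm" where
  "dual_tens X Y =
     transp C (X \<otimes> Y) (X \<otimes> Y) (dual C (X \<otimes> Y)) (dual C Y \<otimes> dual C X)
       (ev C Y \<cdot> (idm C (dual C Y) \<boxtimes> lun C Y) \<cdot>
        (idm C (dual C Y) \<boxtimes> (ev C X \<boxtimes> idm C Y)) \<cdot>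
        (idm C (dual C Y) \<boxtimes> asci C (dual C X) X Y) \<cdot>
        asc C (dual C Y) (dual C X) (X \<otimes> Y))
       (coev C (X \<otimes> Y)) (idm C (X \<otimes> Y))"

definition dual_unt :: "'m" where
  "dual_unt = transp C \<one> \<one> (dual C \<one>) \<one> (lun C \<one>) (coev C \<one>) (idm C \<one>)"

text \<open>Evaluation and coevaluation for \<open>X\<^sup>*\<close> as a right dual, obtained from \<open>X \<rightarrow> X\<^sup>*\<^sup>*\<close>.\<close>

definition rev_ev :: "'o \<Rightarrow> 'm" where
  "rev_ev X = ev C (dual C X) \<cdot> (piv C X \<boxtimes> idm C (dual C X))"

definition rev_coev :: "'o \<Rightarrow> 'm" where
  "rev_coev X = (idm C (dual C X) \<boxtimes> minv C X (dual C (dual C X)) (piv C X)) \<cdot> coev C (dual C X)"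

definition dim_ob :: "'o \<Rightarrow> complex" where
  "dim_ob X = (THE t. rev_ev X \<cdot> coev C X = scl C t (idm C \<one>))"

text \<open>Partial trace over the left factor \<open>V\<close> of \<open>f: V \<otimes> X \<rightarrow> V \<otimes> Y\<close>.\<close>

definition ptr_left :: "'o \<Rightarrow> 'o \<Rightarrow> 'o \<Rightarrow> 'm \<Rightarrow> 'm" where
  "ptr_left V X Y f =
     lun C Y \<cdot> (ev C V \<boxtimes> idm C Y) \<cdot> asci C (dual C V) V Y \<cdot> (idm C (dual C V) \<boxtimes> f) \<cdot>
     asc C (dual C V) V X \<cdot> (rev_coev V \<boxtimes> idm C X) \<cdot> luni C X"

text \<open>Partial trace over the right factor \<open>V\<close> of \<open>f: X \<otimes> V \<rightarrow> Y \<otimes> V\<close>.\<close>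

definition ptr_right :: "'o \<Rightarrow> 'o \<Rightarrow> 'o \<Rightarrow> 'm \<Rightarrow> 'm" where
  "ptr_right V X Y f =
     run C Y \<cdot> (idm C Y \<boxtimes> rev_ev V) \<cdot> asc C Y V (dual C V) \<cdot> (f \<boxtimes> idm C (dual C V)) \<cdot>
     asci C X V (dual C V) \<cdot> (idm C X \<boxtimes> coev C V) \<cdot> runi C X"

end

text \<open>The last three assumptions are \<open>\<delta>\<^bsub>X\<otimes>Y\<^esub> = \<delta>\<^bsub>X\<^esub> \<otimes> \<delta>\<^bsub>Y\<^esub>\<close>, \<open>\<delta>\<^bsub>\<one>\<^esub> = id\<close> and
  \<open>\<delta>\<^bsub>X\<^sup>*\<^esub> = (\<delta>\<^bsub>X\<^esub>\<^sup>*)\<^sup>-\<^sup>1\<close>, with the canonical isomorphisms written out.\<close>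

locale pivotal_category = monoidal_category C
  for C :: "('o, 'm::ab_group_add, 'z) pivcat_scheme" (structure) +
  assumes left_dual: "is_dual C (dual C X) X (ev C X) (coev C X)"
    and right_dual: "\<exists>W e b. is_dual C X W e b"
    and piv_iso: "iso C X (dual C (dual C X)) (piv C X)"
    and piv_natural: "f \<in> hom C X Y
           \<Longrightarrow> piv C Y \<cdot> f = dualm C (dual C Y) (dual C X) (dualm C X Y f) \<cdot> piv C X"
    and piv_tens: "dualm C (dual C Y \<otimes> dual C X) (dual C (X \<otimes> Y)) (dual_tens C X Y) \<cdot> piv C (X \<otimes> Y)
           = dual_tens C (dual C Y) (dual C X) \<cdot> (piv C X \<boxtimes> piv C Y)"
    and piv_unt: "dualm C \<one> (dual C \<one>) (dual_unt C) \<cdot> piv C \<one> = dual_unt C"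
    and piv_dual: "dualm C X (dual C (dual C X)) (piv C X) \<cdot> piv C (dual C X) = idm C (dual C X)"


section \<open>Equivariant fusion categories\<close>

text \<open>
  The finite group \<open>G\<close> is the type \<open>'g\<close>, written additively although not assumed commutative:
  \<open>0\<close>, \<open>g + h\<close>, \<open>- g\<close> stand for \<open>1\<close>, \<open>gh\<close>, \<open>g\<^sup>-\<^sup>1\<close>.
  \<open>homog h\<close> is the class of objects of the full subcategory \<open>C\<^sub>h\<close> (zero objects lie in all
  of them).  \<open>act g\<close>, \<open>actm g\<close> are \<open>R\<^sub>g\<close> on objects and morphisms; its structure maps are
  \<^item> \<open>act_tens g X Y: R\<^sub>g X \<otimes> R\<^sub>g Y \<rightarrow> R\<^sub>g (X \<otimes> Y)\<close>,
  \<^item> \<open>act_unt g: \<one> \<rightarrow> R\<^sub>g \<one>\<close>,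
  \<^item> \<open>act_cmp g h X: R\<^sub>g (R\<^sub>h X) \<rightarrow> R\<^bsub>gh\<^esub> X\<close>.

  \<open>br g V W: V \<otimes> W \<rightarrow> R\<^sub>g W \<otimes> V\<close> is the crossed braiding, for \<open>V\<close> in \<open>C\<^sub>g\<close>.
\<close>

record ('o, 'm, 'g) eqcat = "('o, 'm) pivcat" +
  homog :: "'g \<Rightarrow> 'o set"
  act :: "'g \<Rightarrow> 'o \<Rightarrow> 'o"
  actm :: "'g \<Rightarrow> 'm \<Rightarrow> 'm"
  act_tens :: "'g \<Rightarrow> 'o \<Rightarrow> 'o \<Rightarrow> 'm"
  act_unt :: "'g \<Rightarrow> 'm"
  act_cmp :: "'g \<Rightarrow> 'g \<Rightarrow> 'o \<Rightarrow> 'm"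
  br :: "'g \<Rightarrow> 'o \<Rightarrow> 'o \<Rightarrow> 'm"

locale graded_category = pivotal_category C + semisimple_category C
  for C :: "('o, 'm::ab_group_add, 'g::{group_add, finite}, 'z) eqcat_scheme" (structure) +
  assumes homog_iso: "\<lbrakk>X \<in> homog C g; isomorphic C X Y\<rbrakk> \<Longrightarrow> Y \<in> homog C g"
    and homog_hom: "\<lbrakk>X \<in> homog C g; Y \<in> homog C h; g \<noteq> h\<rbrakk> \<Longrightarrow> hom C X Y = {0}"
    and homog_sum: "\<exists>Xs inc prj. (\<forall>g. Xs g \<in> homog C g) \<and> direct_sum C UNIV Xs V inc prj"
    and homog_tens: "\<lbrakk>X \<in> homog C g; Y \<in> homog C h\<rbrakk> \<Longrightarrow> X \<otimes> Y \<in> homog C (g + h)"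
    and unt_simple: "simple C \<one>"

definition dual_act ::
    "('o, 'm::ab_group_add, 'g, 'z) eqcat_scheme \<Rightarrow> 'g \<Rightarrow> 'o \<Rightarrow> 'm" where
  \<comment> \<open>the canonical isomorphism from \<open>R\<^sub>g (X\<^sup>*)\<close> to \<open>(R\<^sub>g X)\<^sup>*\<close>\<close>
  "dual_act C g X =
     transp C (act C g X) (act C g X) (dual C (act C g X)) (act C g (dual C X))
       (cmp C (minv C (unt C) (act C g (unt C)) (act_unt C g))
         (cmp C (actm C g (ev C X)) (act_tens C g (dual C X) X)))
       (coev C (act C g X)) (idm C (act C g X))"

locale action_category = graded_category C
  for C :: "('o, 'm::ab_group_add, 'g::{group_add, finite}, 'z) eqcat_scheme" (structure) +
  assumes actm_hom: "f \<in> hom C X Y \<Longrightarrow> actm C g f \<in> hom C (act C g X) (act C g Y)"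
    and actm_idm: "actm C g (idm C X) = idm C (act C g X)"
    and actm_cmp: "\<lbrakk>f \<in> hom C Y Z; f' \<in> hom C X Y\<rbrakk>
           \<Longrightarrow> actm C g (f \<cdot> f') = actm C g f \<cdot> actm C g f'"
    and actm_add: "\<lbrakk>f \<in> hom C X Y; f' \<in> hom C X Y\<rbrakk>
           \<Longrightarrow> actm C g (f + f') = actm C g f + actm C g f'"
    and actm_scl: "f \<in> hom C X Y \<Longrightarrow> actm C g (scl C c f) = scl C c (actm C g f)"
    and act_tens_iso: "iso C (act C g X \<otimes> act C g Y) (act C g (X \<otimes> Y)) (act_tens C g X Y)"
    and act_tens_natural: "\<lbrakk>f \<in> hom C X X'; f' \<in> hom C Y Y'\<rbrakk>
           \<Longrightarrow> act_tens C g X' Y' \<cdot> (actm C g f \<boxtimes> actm C g f')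
             = actm C g (f \<boxtimes> f') \<cdot> act_tens C g X Y"
    and act_tens_asc: "actm C g (asc C X Y Z) \<cdot> act_tens C g (X \<otimes> Y) Z \<cdot>
             (act_tens C g X Y \<boxtimes> idm C (act C g Z))
           = act_tens C g X (Y \<otimes> Z) \<cdot> (idm C (act C g X) \<boxtimes> act_tens C g Y Z) \<cdot>
             asc C (act C g X) (act C g Y) (act C g Z)"
    and act_unt_iso: "iso C \<one> (act C g \<one>) (act_unt C g)"
    and act_lun: "actm C g (lun C X) \<cdot> act_tens C g \<one> X \<cdot> (act_unt C g \<boxtimes> idm C (act C g X))
           = lun C (act C g X)"
    and act_run: "actm C g (run C X) \<cdot> act_tens C g X \<one> \<cdot> (idm C (act C g X) \<boxtimes> act_unt C g)
           = run C (act C g X)"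
    and act_cmp_iso: "iso C (act C g (act C h X)) (act C (g + h) X) (act_cmp C g h X)"
    and act_cmp_natural: "f \<in> hom C X Y \<Longrightarrow> act_cmp C g h Y \<cdot> actm C g (actm C h f)
           = actm C (g + h) f \<cdot> act_cmp C g h X"
    and act_cmp_tens: "act_cmp C g h (X \<otimes> Y) \<cdot> actm C g (act_tens C h X Y) \<cdot>
             act_tens C g (act C h X) (act C h Y)
           = act_tens C (g + h) X Y \<cdot> (act_cmp C g h X \<boxtimes> act_cmp C g h Y)"
    and act_cmp_unt: "act_cmp C g h \<one> \<cdot> actm C g (act_unt C h) \<cdot> act_unt C g = act_unt C (g + h)"
    and act_cmp_assoc: "act_cmp C (g + h) k X \<cdot> act_cmp C g h (act C k X)
           = act_cmp C g (h + k) X \<cdot> actm C g (act_cmp C h k X)"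
    and act_zero: "act C 0 X = X"
    and actm_zero: "f \<in> hom C X Y \<Longrightarrow> actm C 0 f = f"
    and act_tens_zero: "act_tens C 0 X Y = idm C (X \<otimes> Y)"
    and act_unt_zero: "act_unt C 0 = idm C \<one>"
    and act_cmp_zero_left: "act_cmp C 0 g X = idm C (act C g X)"
    and act_cmp_zero_right: "act_cmp C g 0 X = idm C (act C g X)"
    and act_homog: "X \<in> homog C h \<Longrightarrow> act C g X \<in> homog C (g + h - g)"
    and act_piv: "dual_act C g (dual C X) \<cdot> actm C g (piv C X)
           = dualm C (act C g (dual C X)) (dual C (act C g X)) (dual_act C g X) \<cdot> piv C (act C g X)"

text \<open>The assumptions \<open>br_tens_right\<close>, \<open>br_tens_left\<close>, \<open>br_act\<close> are Turaev's axioms for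
  \<open>c\<^bsub>V,X\<otimes>Y\<^esub>\<close>, \<open>c\<^bsub>U\<otimes>V,X\<^esub>\<close> and \<open>R\<^sub>k (c\<^bsub>V,W\<^esub>)\<close>.\<close>

locale equivariant_fusion_category = action_category C
  for C :: "('o, 'm::ab_group_add, 'g::{group_add, finite}, 'z) eqcat_scheme" (structure) +
  assumes br_iso: "V \<in> homog C g \<Longrightarrow> iso C (V \<otimes> W) (act C g W \<otimes> V) (br C g V W)"
    and br_natural: "\<lbrakk>V \<in> homog C g; V' \<in> homog C g; f \<in> hom C V V'; f' \<in> hom C W W'\<rbrakk>
           \<Longrightarrow> br C g V' W' \<cdot> (f \<boxtimes> f') = (actm C g f' \<boxtimes> f) \<cdot> br C g V W"
    and br_tens_right: "V \<in> homog C g \<Longrightarrow> br C g V (X \<otimes> Y)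
           = (act_tens C g X Y \<boxtimes> idm C V) \<cdot> asci C (act C g X) (act C g Y) V \<cdot>
             (idm C (act C g X) \<boxtimes> br C g V Y) \<cdot> asc C (act C g X) V Y \<cdot>
             (br C g V X \<boxtimes> idm C Y) \<cdot> asci C V X Y"
    and br_tens_left: "\<lbrakk>U \<in> homog C g; V \<in> homog C h\<rbrakk> \<Longrightarrow> br C (g + h) (U \<otimes> V) X
           = (act_cmp C g h X \<boxtimes> idm C (U \<otimes> V)) \<cdot> asc C (act C g (act C h X)) U V \<cdot>
             (br C g U (act C h X) \<boxtimes> idm C V) \<cdot> asci C U (act C h X) V \<cdot>
             (idm C U \<boxtimes> br C h V X) \<cdot> asc C U V X"
    and br_act: "V \<in> homog C g \<Longrightarrow> actm C k (br C g V W) \<cdot> act_tens C k V W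
           = act_tens C k (act C g W) V \<cdot>
             ((minv C (act C k (act C g W)) (act C (k + g) W) (act_cmp C k g W) \<cdot>
               act_cmp C (k + g - k) k W) \<boxtimes> idm C (act C k V)) \<cdot>
             br C (k + g - k) (act C k V) (act C k W)"


section \<open>The extended Verlinde algebra\<close>

text \<open>
  \<open>I\<close> is a set of representatives of the simple objects, so that an index \<open>i\<close> and the object
  \<open>V\<^sub>i\<close> are the same thing.  An element \<open>x\<close> of the extended Verlinde algebra is the family of its
  components \<open>x g i\<close> in \<open>Mor(V\<^sub>i, R\<^sub>g V\<^sub>i)\<close>.  Operations given on generators are extended
  linearly by sums over \<open>I\<close>, which is finite in all uses (it is part of modularity).
\<close>

type_synonym ('o, 'm, 'g) verl = "'g \<Rightarrow> 'o \<Rightarrow> 'm"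

context
  fixes C :: "('o, 'm::ab_group_add, 'g::{group_add, finite}, 'z) eqcat_scheme" (structure)
begin

definition simple_reps :: "'o set \<Rightarrow> bool" where
  "simple_reps I \<longleftrightarrow> \<one> \<in> I \<and> (\<forall>i\<in>I. simple C i) \<and> (\<forall>X. simple C X \<longrightarrow> (\<exists>!i. i \<in> I \<and> isomorphic C X i))"

definition Ideg :: "'o set \<Rightarrow> 'g \<Rightarrow> 'o set" where
  "Ideg I h = I \<inter> homog C h"

definition Iinv :: "'o set \<Rightarrow> 'g \<Rightarrow> 'g \<Rightarrow> 'o set" where
  \<comment> \<open>the classes in \<open>I\<^sub>h\<close> invariant under \<open>g\<close>\<close>
  "Iinv I g h = {i \<in> Ideg I h. isomorphic C (act C g i) i}"

definition vscl :: "complex \<Rightarrow> ('o, 'm, 'g) verl \<Rightarrow> ('o, 'm, 'g) verl" where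
  "vscl c x = (\<lambda>g i. scl C c (x g i))"

definition sing :: "'g \<Rightarrow> 'o \<Rightarrow> 'm \<Rightarrow> ('o, 'm, 'g) verl" where
  "sing g i f = (\<lambda>m j. if m = g \<and> j = i then f else 0)"

definition Verl :: "'o set \<Rightarrow> ('o, 'm, 'g) verl set" where
  "Verl I = {x. finite {(g, i). x g i \<noteq> 0} \<and>
     (\<forall>g i. x g i \<in> hom C i (act C g i)) \<and>
     (\<forall>g i. x g i \<noteq> 0 \<longrightarrow> (\<exists>h. i \<in> Ideg I h \<and> g + h = h + g))}"

definition Verl_gh :: "'o set \<Rightarrow> 'g \<Rightarrow> 'g \<Rightarrow> ('o, 'm, 'g) verl set" where
  "Verl_gh I g h = {x \<in> Verl I. \<forall>m i. x m i \<noteq> 0 \<longrightarrow> m = g \<and> i \<in> Ideg I h}"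

definition Verl_star :: "'o set \<Rightarrow> 'g \<Rightarrow> ('o, 'm, 'g) verl set" where
  \<comment> \<open>the direct sum over all \<open>g\<close> of the \<open>Verl_gh I g h\<close>\<close>
  "Verl_star I h = {x \<in> Verl I. \<forall>m i. x m i \<noteq> 0 \<longrightarrow> i \<in> Ideg I h}"

text \<open>\<open>cls I g V \<phi>\<close> is the class of \<open>\<phi>: V \<rightarrow> R\<^sub>g V\<close>: the sum of the diagonal entries of \<open>\<phi>\<close>
  with respect to some decomposition of \<open>V\<close> into chosen simple objects (the result does not
  depend on the decomposition).\<close>

definition cls :: "'o set \<Rightarrow> 'g \<Rightarrow> 'o \<Rightarrow> 'm \<Rightarrow> ('o, 'm, 'g) verl" where
  "cls I g V \<phi> =
     (case SOME (n, X, inc, prj). (\<forall>r<n. X r \<in> I) \<and> direct_sum C {..<n::nat} X V inc prj of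
        (n, X, inc, prj) \<Rightarrow> \<Sum>r<n. sing g (X r) (actm C g (prj r) \<cdot> \<phi> \<cdot> inc r))"

definition vtens :: "'o set \<Rightarrow> ('o, 'm, 'g) verl \<Rightarrow> ('o, 'm, 'g) verl \<Rightarrow> ('o, 'm, 'g) verl" where
  "vtens I x y = (\<Sum>g\<in>UNIV. \<Sum>i\<in>I. \<Sum>j\<in>I. cls I g (i \<otimes> j) (act_tens C g i j \<cdot> (x g i \<boxtimes> y g j)))"

definition conv_gen :: "'g \<Rightarrow> 'o \<Rightarrow> 'm \<Rightarrow> 'g \<Rightarrow> 'o \<Rightarrow> 'm \<Rightarrow> ('o, 'm, 'g) verl" where
  "conv_gen g i \<phi> h j \<psi> =
     (if isomorphic C (act C h j) i
      then let \<kappa> = SOME \<kappa>. iso C (act C h j) i \<kappa>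
           in vscl (inverse (dim_ob C i))
                (sing (g + h) j
                  (act_cmp C g h j \<cdot> actm C g (minv C (act C h j) i \<kappa>) \<cdot> \<phi> \<cdot> \<kappa> \<cdot> \<psi>))
      else 0)"

definition conv :: "'o set \<Rightarrow> ('o, 'm, 'g) verl \<Rightarrow> ('o, 'm, 'g) verl \<Rightarrow> ('o, 'm, 'g) verl" where
  "conv I x y = (\<Sum>g\<in>UNIV. \<Sum>h\<in>UNIV. \<Sum>i\<in>I. \<Sum>j\<in>I. conv_gen g i (x g i) h j (y h j))"

text \<open>For \<open>\<phi>: V \<rightarrow> R\<^sub>g V\<close> the adjoint \<open>\<phi>\<^sup>*: (R\<^sub>g V)\<^sup>* \<rightarrow> V\<^sup>*\<close> is a morphism from \<open>W = (R\<^sub>g V)\<^sup>*\<close>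
  to \<open>R\<^bsub>g\<^sup>-\<^sup>1\<^esub> W\<close> through the canonical isomorphisms
  \<open>V\<^sup>* \<rightarrow> R\<^bsub>g\<^sup>-\<^sup>1\<^esub> (R\<^sub>g (V\<^sup>*)) \<rightarrow> R\<^bsub>g\<^sup>-\<^sup>1\<^esub> ((R\<^sub>g V)\<^sup>*)\<close>.\<close>

definition adj :: "'g \<Rightarrow> 'o \<Rightarrow> 'm \<Rightarrow> 'm" where
  "adj g V \<phi> =
     actm C (- g) (dual_act C g V) \<cdot>
     minv C (act C (- g) (act C g (dual C V))) (dual C V) (act_cmp C (- g) g (dual C V)) \<cdot>
     dualm C V (act C g V) \<phi>"

definition vstar :: "'o set \<Rightarrow> ('o, 'm, 'g) verl \<Rightarrow> ('o, 'm, 'g) verl" where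
  "vstar I x = (\<Sum>g\<in>UNIV. \<Sum>i\<in>I. cls I (- g) (dual C (act C g i)) (adj g i (x g i)))"

definition br0 :: "('o, 'm, 'g) verl \<Rightarrow> complex" where
  "br0 x = (\<Sum>g\<in>UNIV. THE t. x g \<one> = scl C t (act_unt C g))"

definition vform :: "'o set \<Rightarrow> ('o, 'm, 'g) verl \<Rightarrow> ('o, 'm, 'g) verl \<Rightarrow> complex" where
  "vform I x y = br0 (vtens I x (vstar I y))"

text \<open>\<open>encircle g h V K \<phi>: K \<rightarrow> R\<^bsub>h\<^sup>-\<^sup>1\<^esub> K\<close> encircles the strand \<open>K\<close> (in \<open>C\<^sub>g\<close>) by a
  \<open>V\<close>-coloured loop (\<open>V\<close> in \<open>C\<^sub>h\<close>) carrying \<open>\<phi>: V \<rightarrow> R\<^sub>g V\<close>.  The second inverse braiding is that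
  of \<open>V \<otimes> R\<^bsub>h\<^sup>-\<^sup>1\<^esub> K \<rightarrow> R\<^sub>h (R\<^bsub>h\<^sup>-\<^sup>1\<^esub> K) \<otimes> V = K \<otimes> V\<close>.\<close>

definition encircle :: "'g \<Rightarrow> 'g \<Rightarrow> 'o \<Rightarrow> 'o \<Rightarrow> 'm \<Rightarrow> 'm" where
  "encircle g h V K \<phi> =
     ptr_left C V K (act C (- h) K)
       (minv C (V \<otimes> act C (- h) K) (K \<otimes> V)
          ((act_cmp C h (- h) K \<boxtimes> idm C V) \<cdot> br C h V (act C (- h) K)) \<cdot>
        minv C (K \<otimes> V) (act C g V \<otimes> K) (br C g K V) \<cdot>
        (\<phi> \<boxtimes> idm C K))"

definition stilde_gen :: "'o set \<Rightarrow> 'g \<Rightarrow> 'g \<Rightarrow> 'o \<Rightarrow> 'm \<Rightarrow> ('o, 'm, 'g) verl" where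
  "stilde_gen I g h V \<phi> =
     (\<Sum>k\<in>Iinv I (- h) g. sing (- h) k (scl C (dim_ob C k) (encircle g h V k \<phi>)))"

definition stilde :: "'o set \<Rightarrow> ('o, 'm, 'g) verl \<Rightarrow> ('o, 'm, 'g) verl" where
  "stilde I x = (\<Sum>g\<in>UNIV. \<Sum>h\<in>UNIV. \<Sum>i\<in>Ideg I h. stilde_gen I g h i (x g i))"

text \<open>The twist \<open>V \<rightarrow> R\<^sub>g V\<close> of \<open>V\<close> in \<open>C\<^sub>g\<close> is the curl formed by the braiding of \<open>V\<close> with itself.\<close>

definition twist :: "'g \<Rightarrow> 'o \<Rightarrow> 'm" where
  "twist g V = ptr_right C V V (act C g V) (br C g V V)"

definition theta :: "'o \<Rightarrow> complex" where
  "theta i = (THE t. twist 0 i = scl C t (idm C i))"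

definition p_plus :: "'o set \<Rightarrow> complex" where
  "p_plus I = (\<Sum>i\<in>Ideg I 0. theta i * (dim_ob C i)\<^sup>2)"

definition p_minus :: "'o set \<Rightarrow> complex" where
  "p_minus I = (\<Sum>i\<in>Ideg I 0. inverse (theta i) * (dim_ob C i)\<^sup>2)"

text \<open>\<open>s_op I D\<close> is \<open>D\<^sup>-\<^sup>1\<close> times the unnormalized operator, \<open>D\<close> being a square root of \<open>p\<^sup>+ p\<^sup>-\<close>.\<close>

definition s_op :: "'o set \<Rightarrow> complex \<Rightarrow> ('o, 'm, 'g) verl \<Rightarrow> ('o, 'm, 'g) verl" where
  "s_op I D x = vscl (inverse D) (stilde I x)"

definition modular_category :: "'o set \<Rightarrow> bool" where
  "modular_category I \<longleftrightarrow> equivariant_fusion_category C \<and> simple_reps I \<and> finite I \<and>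
     bij_betw (stilde I) (Verl I) (Verl I)"

text \<open>If \<open>i\<close> is not invariant under \<open>g\<close>, then \<open>Mor(V\<^sub>i, R\<^sub>g V\<^sub>i) = 0\<close> and the first condition
  forces \<open>lam g i = 0\<close>; only the other \<open>lam g i\<close> are basis elements.\<close>

definition generic_basis :: "'o set \<Rightarrow> ('g \<Rightarrow> 'o \<Rightarrow> 'm) \<Rightarrow> bool" where
  "generic_basis I lam \<longleftrightarrow>
     (\<forall>g. \<forall>i\<in>I. lam g i \<in> hom C i (act C g i)) \<and>
     (\<forall>g. \<forall>i\<in>I. isomorphic C (act C g i) i \<longrightarrow> lam g i \<noteq> 0) \<and>
     (\<forall>i\<in>I. lam 0 i = idm C i)"

definition lin_op :: "('o, 'm, 'g) verl set \<Rightarrow> ('o, 'm, 'g) verl set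
    \<Rightarrow> (('o, 'm, 'g) verl \<Rightarrow> ('o, 'm, 'g) verl) \<Rightarrow> bool" where
  "lin_op S T f \<longleftrightarrow> f ` S \<subseteq> T \<and> (\<forall>x\<in>S. \<forall>y\<in>S. f (x + y) = f x + f y) \<and>
     (\<forall>x\<in>S. \<forall>c. f (vscl c x) = vscl c (f x))"

text \<open>\<open>matrix_of e f J T\<close> is the matrix of the operator \<open>T\<close> with respect to the basis \<open>e\<close> of the
  source and the basis \<open>f\<close>, indexed by \<open>J\<close>, of the target.\<close>

definition coord :: "('j \<Rightarrow> ('o, 'm, 'g) verl) \<Rightarrow> 'j set \<Rightarrow> ('o, 'm, 'g) verl \<Rightarrow> 'j \<Rightarrow> complex" where
  "coord f J x = (THE c. (\<forall>j. j \<notin> J \<longrightarrow> c j = 0) \<and> x = (\<Sum>j\<in>J. vscl (c j) (f j)))"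

definition matrix_of :: "('k \<Rightarrow> ('o, 'm, 'g) verl) \<Rightarrow> ('j \<Rightarrow> ('o, 'm, 'g) verl) \<Rightarrow> 'j set
    \<Rightarrow> (('o, 'm, 'g) verl \<Rightarrow> ('o, 'm, 'g) verl) \<Rightarrow> 'j \<Rightarrow> 'k \<Rightarrow> complex" where
  "matrix_of e f J T = (\<lambda>j k. coord f J (T (e k)) j)"

end


section \<open>The case of the group of order two\<close>

instance bit :: finite
proof
  have "(UNIV :: bit set) = {0, 1}" by (auto intro: bit.exhaust)
  then show "finite (UNIV :: bit set)" by (metis finite.emptyI finite.insertI)
qed

text \<open>\<open>bit\<close> is the additive group of integers mod 2: its elements \<open>0\<close> and \<open>1\<close> are the
  unit and the generator \<open>a\<close> of the group \<open>{1, a}\<close>.\<close>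

context
  fixes C :: "('o, 'm::ab_group_add, bit, 'z) eqcat_scheme" (structure)
    and lam :: "bit \<Rightarrow> 'o \<Rightarrow> 'm"
begin

definition basis_el :: "bit \<times> 'o \<Rightarrow> ('o, 'm, bit) verl" where
  "basis_el = (\<lambda>(g, k). sing g k (lam g k))"

definition alpha :: "'o \<Rightarrow> ('o, 'm, bit) verl" where
  "alpha k = vscl C (1/2) (basis_el (1, k) - basis_el (0, k))"

definition beta :: "'o \<Rightarrow> ('o, 'm, bit) verl" where
  "beta k = vscl C (1/2) (basis_el (1, k) + basis_el (0, k))"

text \<open>The generic basis \<open>basis_el\<close> of \<open>Verl_star I 0\<close> and the basis \<open>adapted_el I\<close>, into which
  the change of basis operator takes it, are both indexed by \<open>idx I\<close>.  A diagonal operator such as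
  \<open>D\<^sub>i\<close> has a diagonal matrix in the second one.\<close>

definition idx :: "'o set \<Rightarrow> (bit \<times> 'o) set" where
  "idx I = {0} \<times> Ideg C I 0 \<union> {1} \<times> Iinv C I 1 0"

definition adapted_el :: "'o set \<Rightarrow> bit \<times> 'o \<Rightarrow> ('o, 'm, bit) verl" where
  "adapted_el I = (\<lambda>(g, k). if k \<in> Iinv C I 1 0 then (if g = 0 then alpha k else beta k)
                            else basis_el (g, k))"

end

end

(* The whole computation takes place in the trivial sector g = 1, with loops carrying identities.
   A loop coloured by V in C_h around a strand k in C_1 is a morphism enc(V): k -> R_{h^-1} k, and

     enc(U (x) V) = R_{h2^-1}(enc(U)) enc(V)        (U in C_h1, V in C_h2):

   the U-coloured loop lies inside the V-coloured one, so after tracing over U only enc(U) (x) V is left in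
   the middle, and it slides through the braiding with V.  Let i, j have degree a.  If k is not invariant
   under a, then enc(j): k -> R_a k vanishes.  If it is, enc(i) = e_i . ^a lambda_k by Schur's lemma, and the
   normalization of ^a lambda_k says that R_a(^a lambda_k) ^a lambda_k is the identity, hence
   enc(i (x) j) = e_i e_j.  So tensoring with lambda_i multiplies the k-th coordinate under s by e_i and
   moves it from ^a lambda_k to lambda_k; M turns the latter into the sign in D_i.

   The form satisfies (phi, psi) = t if R(psi) phi = t id, because the morphisms from the unit object to
   V_k (x) (R_g V_k)^* are spanned by one coevaluation, whose image under phi (x) psi^* can be computed.
   Hence (s lambda_i, ^a lambda_k) / (s lambda_0, lambda_k) = e_i; this uses d_k <> 0 and enc(1) = id, both of
   which follow from the surjectivity of s without any further computation.

   Coherence is handled by replacing a morphism e: W (x) V -> 1 by the natural family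
   W (x) (V (x) Z) -> Z, and b: 1 -> V (x) W by Z -> V (x) (W (x) Z).  All tensor products are then nested
   to the right and string diagrams need no associators. *)

theory Submission
  imports Defs "HOL-Computational_Algebra.Fundamental_Theorem_Algebra"
begin

section \<open>Morphisms with source and target\<close>

text \<open>Classes are computed from a decomposition picked by \<open>SOME\<close>, so every
  statement about s and the form has to hold for whichever decomposition is picked. For s this comes
  from cyclicity: in id_V = sum inc_r prj_r each term slides once around the loop and becomes prj_r
  inc_r = id, so a loop coloured by V is the sum of the loops coloured by its summands. For the form
  only the unit component of a class counts, and the decompositions picked for the dual of R_g k and
  for its products with i are merged into one; as the morphisms from the unit are spanned by a
  single vector b, that component is fixed by the action on b.

  The conclusion compares matrices. As operators, M s L_i sends \<lambda>_j to multiples of the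
  \<alpha>_k, and D_i M s sends it to the same multiples of the \<beta>_k. The equation therefore
  refers to coordinates: the diagonal entries -c_k, c_k of D_i in the adapted basis multiply the
  coordinates u_k/2, u_k/2 of u_k \<beta>_k in the generic basis, and the result is the coordinate
  vector of c_k u_k \<alpha>_k.\<close>

text \<open>With source and target recorded, composability is an equation between objects that the simplifier decides.\<close>

datatype ('o, 'm) arr = Arr (src: 'o) (tgt: 'o) (mor: 'm)

context linear_category
begin

definition val :: "('o, 'm) arr \<Rightarrow> bool" where
  "val f \<longleftrightarrow> mor f \<in> hom C (src f) (tgt f)"

definition ida :: "'o \<Rightarrow> ('o, 'm) arr" where
  "ida X = Arr X X (idm C X)"

definition comp :: "('o, 'm) arr \<Rightarrow> ('o, 'm) arr \<Rightarrow> ('o, 'm) arr"  (infixr "\<odot>" 70) where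
  "f \<odot> g = Arr (src g) (tgt f) (mor f \<cdot> mor g)"

definition isoa :: "('o, 'm) arr \<Rightarrow> bool" where
  "isoa f \<longleftrightarrow> iso C (src f) (tgt f) (mor f)"

definition inva :: "('o, 'm) arr \<Rightarrow> ('o, 'm) arr" where
  "inva f = Arr (tgt f) (src f) (minv C (src f) (tgt f) (mor f))"

lemma val_Arr [simp]: "val (Arr X Y f) \<longleftrightarrow> f \<in> hom C X Y"
  by (simp add: val_def)

lemma src_ida [simp]: "src (ida X) = X" and tgt_ida [simp]: "tgt (ida X) = X"
  and val_ida [simp]: "val (ida X)" and mor_ida [simp]: "mor (ida X) = idm C X"
  by (simp_all add: ida_def idm_hom)

lemma src_comp [simp]: "src (f \<odot> g) = src g" and tgt_comp [simp]: "tgt (f \<odot> g) = tgt f"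
  and mor_comp: "mor (f \<odot> g) = mor f \<cdot> mor g"
  by (simp_all add: comp_def)

lemma val_comp [simp]: "\<lbrakk>val f; val g; src f = tgt g\<rbrakk> \<Longrightarrow> val (f \<odot> g)"
  unfolding val_def comp_def by (simp add: cmp_hom)

text \<open>Oriented towards right-nested composites, the normal form in which equations of arrows
  are compared from here on.\<close>

lemma comp_assoc [simp]:
  "\<lbrakk>val f; val g; val h; src f = tgt g; src g = tgt h\<rbrakk> \<Longrightarrow> (f \<odot> g) \<odot> h = f \<odot> (g \<odot> h)"
  unfolding val_def comp_def by (simp add: cmp_assoc)

lemma comp_ida_left [simp]: "\<lbrakk>val f; tgt f = X\<rbrakk> \<Longrightarrow> ida X \<odot> f = f"
  by (cases f) (simp add: val_def comp_def ida_def cmp_idm_left)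

lemma comp_ida_right [simp]: "\<lbrakk>val f; src f = X\<rbrakk> \<Longrightarrow> f \<odot> ida X = f"
  by (cases f) (simp add: val_def comp_def ida_def cmp_idm_right)

lemma inverse_mor_unique:
  assumes "inverse_mor C X Y f g" "inverse_mor C X Y f g'"
  shows "g = g'"
proof -
  have f: "f \<in> hom C X Y" and g: "g \<in> hom C Y X" and g': "g' \<in> hom C Y X"
    and gf: "g \<cdot> f = idm C X" and fg': "f \<cdot> g' = idm C Y"
    using assms unfolding inverse_mor_def by auto
  have "g = g \<cdot> (f \<cdot> g')" unfolding fg' by (rule cmp_idm_right[OF g, symmetric])
  also have "\<dots> = (g \<cdot> f) \<cdot> g'" by (rule cmp_assoc[OF g f g', symmetric])
  also have "\<dots> = g'" unfolding gf by (rule cmp_idm_left[OF g'])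
  finally show ?thesis .
qed

lemma minv_inverse: "iso C X Y f \<Longrightarrow> inverse_mor C X Y f (minv C X Y f)"
  unfolding iso_def minv_def by (metis inverse_mor_unique theI)

lemma minv_eq: "inverse_mor C X Y f g \<Longrightarrow> minv C X Y f = g"
  using minv_inverse inverse_mor_unique iso_def by metis

lemma src_inva [simp]: "src (inva f) = tgt f" and tgt_inva [simp]: "tgt (inva f) = src f"
  by (simp_all add: inva_def)

lemma isoa_val [simp]: "isoa f \<Longrightarrow> val f"
  by (auto simp: isoa_def val_def iso_def inverse_mor_def)

lemma val_inva [simp]: "isoa f \<Longrightarrow> val (inva f)"
  using minv_inverse unfolding isoa_def val_def inva_def inverse_mor_def by simp

lemma comp_inva [simp]: "isoa f \<Longrightarrow> f \<odot> inva f = ida (tgt f)"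
  and inva_comp [simp]: "isoa f \<Longrightarrow> inva f \<odot> f = ida (src f)"
  using minv_inverse unfolding isoa_def inva_def inverse_mor_def comp_def ida_def by simp_all

lemma comp_inva_assoc [simp]: "\<lbrakk>isoa f; val g; tgt g = tgt f\<rbrakk> \<Longrightarrow> f \<odot> inva f \<odot> g = g"
  and inva_comp_assoc [simp]: "\<lbrakk>isoa f; val g; tgt g = src f\<rbrakk> \<Longrightarrow> inva f \<odot> f \<odot> g = g"
proof -
  assume *: "isoa f" "val g" "tgt g = tgt f"
  then have "f \<odot> inva f \<odot> g = (f \<odot> inva f) \<odot> g" by (subst comp_assoc) auto
  with * show "f \<odot> inva f \<odot> g = g" by simp
next
  assume *: "isoa f" "val g" "tgt g = src f"
  then have "inva f \<odot> f \<odot> g = (inva f \<odot> f) \<odot> g" by (subst comp_assoc) auto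
  with * show "inva f \<odot> f \<odot> g = g" by simp
qed

lemma
  assumes "val f" "val g" "src g = tgt f" "tgt g = src f" "g \<odot> f = ida (src f)" "f \<odot> g = ida (tgt f)"
  shows isoaI_iso: "isoa f" and isoaI_inva: "inva f = g"
proof -
  have i: "inverse_mor C (src f) (tgt f) (mor f) (mor g)"
    using assms unfolding inverse_mor_def val_def comp_def ida_def by auto
  then show "isoa f" unfolding isoa_def iso_def by blast
  show "inva f = g" using minv_eq[OF i] assms unfolding inva_def by (cases g) auto
qed

lemma isoa_inva [simp]: "isoa f \<Longrightarrow> isoa (inva f)"
  and inva_inva [simp]: "isoa f \<Longrightarrow> inva (inva f) = f"
  by (rule isoaI_iso[where g = f] isoaI_inva[where g = f]; simp)+

lemma isoa_comp [simp]: "\<lbrakk>isoa f; isoa g; src f = tgt g\<rbrakk> \<Longrightarrow> isoa (f \<odot> g)"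
  and inva_of_comp: "\<lbrakk>isoa f; isoa g; src f = tgt g\<rbrakk> \<Longrightarrow> inva (f \<odot> g) = inva g \<odot> inva f"
  by (rule isoaI_iso[where g = "inva g \<odot> inva f"] isoaI_inva[where g = "inva g \<odot> inva f"]; simp)+

lemma isoa_ida [simp]: "isoa (ida X)" and inva_ida [simp]: "inva (ida X) = ida X"
  by (rule isoaI_iso[where g = "ida X"] isoaI_inva[where g = "ida X"]; simp)+

lemma isoa_cancel_left:
  assumes "f \<odot> g = f \<odot> h" "isoa f" "val g" "val h" "src f = tgt g" "src f = tgt h"
  shows "g = h"
proof -
  have "g = inva f \<odot> f \<odot> g" using assms(2-) by simp
  also have "\<dots> = inva f \<odot> f \<odot> h" by (simp only: assms(1))
  also have "\<dots> = h" using assms(2-) by simp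
  finally show ?thesis .
qed

lemma isoa_cancel_right:
  assumes "g \<odot> f = h \<odot> f" "isoa f" "val g" "val h" "src g = tgt f" "src h = tgt f"
  shows "g = h"
proof -
  have "g = (g \<odot> f) \<odot> inva f" using assms(2-) by simp
  also have "\<dots> = (h \<odot> f) \<odot> inva f" by (simp only: assms(1))
  also have "\<dots> = h" using assms(2-) by simp
  finally show ?thesis .
qed

text \<open>In a right-nested composite f (g r) the factors f and g of a known equation no longer
  form a subterm. This and \<open>comp_eq_comp_assoc\<close> give the version of the equation with a
  tail r; most \<open>_assoc\<close> rules come from here.\<close>

lemma comp_eq_assoc:
  assumes "f \<odot> g = h" "val f" "val g" "val r" "src f = tgt g" "src g = tgt r"
  shows "f \<odot> g \<odot> r = h \<odot> r"
  using assms comp_assoc by metis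

lemma comp_eq_comp_assoc:
  assumes "f \<odot> g = f' \<odot> g'" "val f" "val g" "val f'" "val g'" "val r"
    "src f = tgt g" "src g = tgt r" "src f' = tgt g'" "src g' = tgt r"
  shows "f \<odot> g \<odot> r = f' \<odot> g' \<odot> r"
  using assms comp_assoc by metis

end

section \<open>Whiskering and coherence in a monoidal category\<close>

context monoidal_category
begin

text \<open>The tensor product of two arrows is written as a composite of two whiskerings;
  bifunctoriality then amounts to \<open>lw_comp\<close>, \<open>rw_comp\<close> and the interchange
  law \<open>slide\<close>.\<close>

definition lw :: "'o \<Rightarrow> ('o, 'm) arr \<Rightarrow> ('o, 'm) arr"  (infixr "\<lhd>" 75) where
  "X \<lhd> f = Arr (X \<otimes> src f) (X \<otimes> tgt f) (idm C X \<boxtimes> mor f)"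

definition rw :: "('o, 'm) arr \<Rightarrow> 'o \<Rightarrow> ('o, 'm) arr"  (infixl "\<rhd>" 75) where
  "f \<rhd> X = Arr (src f \<otimes> X) (tgt f \<otimes> X) (mor f \<boxtimes> idm C X)"

definition Asc :: "'o \<Rightarrow> 'o \<Rightarrow> 'o \<Rightarrow> ('o, 'm) arr" where
  "Asc X Y Z = Arr ((X \<otimes> Y) \<otimes> Z) (X \<otimes> (Y \<otimes> Z)) (asc C X Y Z)"

definition Lun :: "'o \<Rightarrow> ('o, 'm) arr" where "Lun X = Arr (\<one> \<otimes> X) X (lun C X)"

definition Run :: "'o \<Rightarrow> ('o, 'm) arr" where "Run X = Arr (X \<otimes> \<one>) X (run C X)"

lemma src_lw [simp]: "src (X \<lhd> f) = X \<otimes> src f" and tgt_lw [simp]: "tgt (X \<lhd> f) = X \<otimes> tgt f"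
  and src_rw [simp]: "src (f \<rhd> X) = src f \<otimes> X" and tgt_rw [simp]: "tgt (f \<rhd> X) = tgt f \<otimes> X"
  and val_lw [simp]: "val f \<Longrightarrow> val (X \<lhd> f)" and val_rw [simp]: "val f \<Longrightarrow> val (f \<rhd> X)"
  by (simp_all add: lw_def rw_def val_def tensm_hom idm_hom)

lemma src_Asc [simp]: "src (Asc X Y Z) = (X \<otimes> Y) \<otimes> Z"
  and tgt_Asc [simp]: "tgt (Asc X Y Z) = X \<otimes> (Y \<otimes> Z)"
  and isoa_Asc [simp]: "isoa (Asc X Y Z)"
  by (simp_all add: Asc_def isoa_def asc_iso)

lemma src_Lun [simp]: "src (Lun X) = \<one> \<otimes> X" and tgt_Lun [simp]: "tgt (Lun X) = X"
  and isoa_Lun [simp]: "isoa (Lun X)"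
  by (simp_all add: Lun_def isoa_def lun_iso)

lemma src_Run [simp]: "src (Run X) = X \<otimes> \<one>" and tgt_Run [simp]: "tgt (Run X) = X"
  and isoa_Run [simp]: "isoa (Run X)"
  by (simp_all add: Run_def isoa_def run_iso)

lemma lw_ida [simp]: "X \<lhd> ida Y = ida (X \<otimes> Y)" and rw_ida [simp]: "ida X \<rhd> Y = ida (X \<otimes> Y)"
  by (simp_all add: lw_def rw_def ida_def tensm_idm)

lemma lw_comp [simp]: "\<lbrakk>val f; val g; src f = tgt g\<rbrakk> \<Longrightarrow> X \<lhd> (f \<odot> g) = X \<lhd> f \<odot> X \<lhd> g"
  unfolding val_def comp_def lw_def
  using tensm_cmp[OF idm_hom idm_hom, of "mor g" "src g" "tgt g" "mor f" "tgt f" X]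
  by (simp add: cmp_idm_left[OF idm_hom])

lemma rw_comp [simp]: "\<lbrakk>val f; val g; src f = tgt g\<rbrakk> \<Longrightarrow> (f \<odot> g) \<rhd> X = f \<rhd> X \<odot> g \<rhd> X"
  unfolding val_def comp_def rw_def
  using tensm_cmp[OF _ _ idm_hom idm_hom, of "mor g" "src g" "tgt g" "mor f" "tgt f" X]
  by (simp add: cmp_idm_left[OF idm_hom])

lemma slide:
  assumes "val f" "val g" "src f = X" "tgt f = X'" "src g = Y" "tgt g = Y'"
  shows "(X' \<lhd> g) \<odot> (f \<rhd> Y) = (f \<rhd> Y') \<odot> (X \<lhd> g)"
  using assms tensm_cmp[of "mor f" X X' "idm C X'" X' "idm C Y" Y Y "mor g" Y']
    tensm_cmp[of "idm C X" X X "mor f" X' "mor g" Y Y' "idm C Y'" Y']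
  unfolding val_def comp_def rw_def lw_def by (simp add: idm_hom cmp_idm_left cmp_idm_right)

lemma slide_assoc:
  assumes "val f" "val g" "src f = X" "tgt f = X'" "src g = Y" "tgt g = Y'" "val r" "tgt r = X \<otimes> Y"
  shows "(X' \<lhd> g) \<odot> (f \<rhd> Y) \<odot> r = (f \<rhd> Y') \<odot> (X \<lhd> g) \<odot> r"
  using assms by (intro comp_eq_comp_assoc[OF slide[of f g X X' Y Y']]) auto

lemma isoa_lw [simp]: "isoa f \<Longrightarrow> isoa (X \<lhd> f)" and inva_lw: "isoa f \<Longrightarrow> inva (X \<lhd> f) = X \<lhd> inva f"
  by (rule isoaI_iso[where g = "X \<lhd> inva f"] isoaI_inva[where g = "X \<lhd> inva f"];
      simp flip: lw_comp)+

lemma isoa_rw [simp]: "isoa f \<Longrightarrow> isoa (f \<rhd> X)" and inva_rw: "isoa f \<Longrightarrow> inva (f \<rhd> X) = inva f \<rhd> X"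
  by (rule isoaI_iso[where g = "inva f \<rhd> X"] isoaI_inva[where g = "inva f \<rhd> X"];
      simp flip: rw_comp)+

lemma Asc_nat1: "\<lbrakk>val f; tgt f = X\<rbrakk>
    \<Longrightarrow> Asc X Y Z \<odot> ((f \<rhd> Y) \<rhd> Z) = (f \<rhd> (Y \<otimes> Z)) \<odot> Asc (src f) Y Z"
  using asc_natural[of "mor f" "src f" "tgt f" "idm C Y" Y Y "idm C Z" Z Z]
  by (simp add: val_def comp_def rw_def lw_def Asc_def idm_hom tensm_idm)

lemma Asc_nat2: "\<lbrakk>val f; tgt f = Y\<rbrakk>
    \<Longrightarrow> Asc X Y Z \<odot> ((X \<lhd> f) \<rhd> Z) = (X \<lhd> (f \<rhd> Z)) \<odot> Asc X (src f) Z"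
  using asc_natural[of "idm C X" X X "mor f" "src f" "tgt f" "idm C Z" Z Z]
  by (simp add: val_def comp_def rw_def lw_def Asc_def idm_hom tensm_idm)

lemma Asc_nat3: "\<lbrakk>val f; tgt f = Z\<rbrakk>
    \<Longrightarrow> Asc X Y Z \<odot> ((X \<otimes> Y) \<lhd> f) = (X \<lhd> (Y \<lhd> f)) \<odot> Asc X Y (src f)"
  using asc_natural[of "idm C X" X X "idm C Y" Y Y "mor f" "src f" "tgt f"]
  by (simp add: val_def comp_def rw_def lw_def Asc_def idm_hom tensm_idm)

lemma Lun_nat: "\<lbrakk>val f; tgt f = X\<rbrakk> \<Longrightarrow> Lun X \<odot> (\<one> \<lhd> f) = f \<odot> Lun (src f)"
  using lun_natural[of "mor f" "src f" "tgt f"] by (simp add: val_def comp_def lw_def Lun_def)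

lemma Run_nat: "\<lbrakk>val f; tgt f = X\<rbrakk> \<Longrightarrow> Run X \<odot> (f \<rhd> \<one>) = f \<odot> Run (src f)"
  using run_natural[of "mor f" "src f" "tgt f"] by (simp add: val_def comp_def rw_def Run_def)

lemma Pentagon: "Asc W X (Y \<otimes> Z) \<odot> Asc (W \<otimes> X) Y Z
    = (W \<lhd> Asc X Y Z) \<odot> Asc W (X \<otimes> Y) Z \<odot> (Asc W X Y \<rhd> Z)"
  using pentagon[of W X Y Z] by (simp add: comp_def lw_def rw_def Asc_def)

lemma Triangle: "(X \<lhd> Lun Y) \<odot> Asc X \<one> Y = Run X \<rhd> Y"
  using triangle[of X Y] by (simp add: comp_def lw_def rw_def Asc_def Lun_def Run_def)

text \<open>A commuting square with two invertible opposite sides also commutes with these sides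
  inverted. Inverse associators, unit constraints and braidings get their naturality this
  way.\<close>

lemma inva_nat:
  assumes "a' \<odot> f = f' \<odot> a" "isoa a" "isoa a'" "val f" "val f'" "src a' = tgt f" "src f' = tgt a"
  shows "inva a' \<odot> f' = f \<odot> inva a"
proof -
  from assms have e: "src f = src a" "tgt f' = tgt a'"
    by (metis src_comp, metis tgt_comp)
  have "inva a' \<odot> f' = inva a' \<odot> (f' \<odot> a) \<odot> inva a" using assms(2-) e by simp
  also have "\<dots> = inva a' \<odot> (a' \<odot> f) \<odot> inva a" by (simp only: assms(1))
  also have "\<dots> = f \<odot> inva a" using assms(2-) e by simp
  finally show ?thesis .
qed

lemma Asci_nat1: "\<lbrakk>val f; src f = X\<rbrakk>
    \<Longrightarrow> inva (Asc (tgt f) Y Z) \<odot> (f \<rhd> (Y \<otimes> Z)) = ((f \<rhd> Y) \<rhd> Z) \<odot> inva (Asc X Y Z)"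
  by (rule inva_nat) (auto simp: Asc_nat1)

lemma Asci_nat2: "\<lbrakk>val f; src f = Y\<rbrakk>
    \<Longrightarrow> inva (Asc X (tgt f) Z) \<odot> (X \<lhd> (f \<rhd> Z)) = ((X \<lhd> f) \<rhd> Z) \<odot> inva (Asc X Y Z)"
  by (rule inva_nat) (auto simp: Asc_nat2)

lemma Asci_nat3: "\<lbrakk>val f; src f = Z\<rbrakk>
    \<Longrightarrow> inva (Asc X Y (tgt f)) \<odot> (X \<lhd> (Y \<lhd> f)) = ((X \<otimes> Y) \<lhd> f) \<odot> inva (Asc X Y Z)"
  by (rule inva_nat) (auto simp: Asc_nat3)

lemma Luni_nat: "\<lbrakk>val f; src f = X\<rbrakk> \<Longrightarrow> inva (Lun (tgt f)) \<odot> f = (\<one> \<lhd> f) \<odot> inva (Lun X)"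
  by (rule inva_nat) (auto simp: Lun_nat)

lemma Asc_nat1_assoc: "\<lbrakk>val f; tgt f = X; val r; tgt r = (src f \<otimes> Y) \<otimes> Z\<rbrakk>
    \<Longrightarrow> Asc X Y Z \<odot> ((f \<rhd> Y) \<rhd> Z) \<odot> r = (f \<rhd> (Y \<otimes> Z)) \<odot> Asc (src f) Y Z \<odot> r"
  by (rule comp_eq_comp_assoc[OF Asc_nat1]) auto

lemma Asc_nat2_assoc: "\<lbrakk>val f; tgt f = Y; val r; tgt r = (X \<otimes> src f) \<otimes> Z\<rbrakk>
    \<Longrightarrow> Asc X Y Z \<odot> ((X \<lhd> f) \<rhd> Z) \<odot> r = (X \<lhd> (f \<rhd> Z)) \<odot> Asc X (src f) Z \<odot> r"
  by (rule comp_eq_comp_assoc[OF Asc_nat2]) auto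

text \<open>\<open>Run\<close> identifies tensoring with the unit with the identity functor, which
  makes it faithful. This is how an equation of families, taken at the unit, returns to single
  morphisms.\<close>

lemma rw_unit_inj:
  assumes "f \<rhd> \<one> = g \<rhd> \<one>" "val f" "val g" "src f = src g" "tgt f = tgt g"
  shows "f = g"
proof -
  have "f \<odot> Run (src f) = Run (tgt f) \<odot> (f \<rhd> \<one>)" by (rule Run_nat[OF assms(2) refl, symmetric])
  also have "\<dots> = Run (tgt g) \<odot> (g \<rhd> \<one>)" by (simp only: assms(1,5))
  also have "\<dots> = g \<odot> Run (src g)" by (rule Run_nat[OF assms(3) refl])
  finally have "f \<odot> Run (src f) = g \<odot> Run (src g)" .
  then have "f \<odot> Run (src g) = g \<odot> Run (src g)" by (simp add: assms)
  then show ?thesis by (rule isoa_cancel_right) (simp_all add: assms)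
qed

lemma lw_unit_inj:
  assumes "\<one> \<lhd> f = \<one> \<lhd> g" "val f" "val g" "src f = src g" "tgt f = tgt g"
  shows "f = g"
proof -
  have "f \<odot> Lun (src f) = Lun (tgt f) \<odot> (\<one> \<lhd> f)" by (rule Lun_nat[OF assms(2) refl, symmetric])
  also have "\<dots> = Lun (tgt g) \<odot> (\<one> \<lhd> g)" by (simp only: assms(1,5))
  also have "\<dots> = g \<odot> Lun (src g)" by (rule Lun_nat[OF assms(3) refl])
  finally have "f \<odot> Lun (src f) = g \<odot> Lun (src g)" .
  then have "f \<odot> Lun (src g) = g \<odot> Lun (src g)" by (simp add: assms)
  then show ?thesis by (rule isoa_cancel_right) (simp_all add: assms)
qed

end

section \<open>Evaluations and coevaluations as natural families\<close>

context monoidal_category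
begin

text \<open>Kelly's consequence of pentagon and triangle. It is checked after tensoring with the
  unit on the left and composing with the isomorphism \<open>?P\<close>; both operations are
  injective on morphisms.\<close>

lemma Lun_tens: "Lun (X \<otimes> Y) \<odot> Asc \<one> X Y = Lun X \<rhd> Y"
proof -
  let ?P = "Asc \<one> (\<one> \<otimes> X) Y \<odot> (Asc \<one> \<one> X \<rhd> Y)"
  have "(\<one> \<lhd> (Lun (X \<otimes> Y) \<odot> Asc \<one> X Y)) \<odot> ?P
      = (\<one> \<lhd> Lun (X \<otimes> Y)) \<odot> (\<one> \<lhd> Asc \<one> X Y) \<odot> ?P" by simp
  also have "\<dots> = ((\<one> \<lhd> Lun (X \<otimes> Y)) \<odot> Asc \<one> \<one> (X \<otimes> Y)) \<odot> Asc (\<one> \<otimes> \<one>) X Y"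
    by (simp add: Pentagon)
  also have "\<dots> = Asc \<one> X Y \<odot> ((Run \<one> \<rhd> X) \<rhd> Y)"
    by (simp add: Triangle Asc_nat1)
  also have "\<dots> = (Asc \<one> X Y \<odot> ((\<one> \<lhd> Lun X) \<rhd> Y)) \<odot> (Asc \<one> \<one> X \<rhd> Y)"
    by (simp flip: Triangle)
  also have "\<dots> = (\<one> \<lhd> (Lun X \<rhd> Y)) \<odot> ?P"
    by (simp add: Asc_nat2)
  finally have "\<one> \<lhd> (Lun (X \<otimes> Y) \<odot> Asc \<one> X Y) = \<one> \<lhd> (Lun X \<rhd> Y)"
    by (rule isoa_cancel_right) simp_all
  then show ?thesis by (rule lw_unit_inj) simp_all
qed

text \<open>\<open>Evf W V e Z: W \<otimes> (V \<otimes> Z) \<rightarrow> Z\<close> and \<open>Cof V W b Z: Z \<rightarrow> V \<otimes> (W \<otimes> Z)\<close>: whiskering on the right is a change of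
  \<open>Z\<close>, and the interchange law is naturality in \<open>Z\<close>.\<close>

definition Evf :: "'o \<Rightarrow> 'o \<Rightarrow> ('o, 'm) arr \<Rightarrow> 'o \<Rightarrow> ('o, 'm) arr" where
  "Evf W V e Z = Lun Z \<odot> (e \<rhd> Z) \<odot> inva (Asc W V Z)"

definition Cof :: "'o \<Rightarrow> 'o \<Rightarrow> ('o, 'm) arr \<Rightarrow> 'o \<Rightarrow> ('o, 'm) arr" where
  "Cof V W b Z = Asc V W Z \<odot> (b \<rhd> Z) \<odot> inva (Lun Z)"

lemma src_Evf [simp]: "src (Evf W V e Z) = W \<otimes> (V \<otimes> Z)"
  and tgt_Evf [simp]: "tgt (Evf W V e Z) = Z"
  and val_Evf [simp]: "\<lbrakk>val e; src e = W \<otimes> V; tgt e = \<one>\<rbrakk> \<Longrightarrow> val (Evf W V e Z)"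
  by (simp_all add: Evf_def)

lemma src_Cof [simp]: "src (Cof V W b Z) = Z"
  and tgt_Cof [simp]: "tgt (Cof V W b Z) = V \<otimes> (W \<otimes> Z)"
  and val_Cof [simp]: "\<lbrakk>val b; src b = \<one>; tgt b = V \<otimes> W\<rbrakk> \<Longrightarrow> val (Cof V W b Z)"
  by (simp_all add: Cof_def)

lemma Evf_nat:
  assumes "val e" "src e = W \<otimes> V" "tgt e = \<one>" "val f" "src f = Y" "tgt f = Z"
  shows "Evf W V e Z \<odot> (W \<lhd> (V \<lhd> f)) = f \<odot> Evf W V e Y"
proof -
  have "Evf W V e Z \<odot> (W \<lhd> (V \<lhd> f)) = Lun Z \<odot> (e \<rhd> Z) \<odot> ((W \<otimes> V) \<lhd> f) \<odot> inva (Asc W V Y)"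
    using assms Asci_nat3[of f Y W V] by (simp add: Evf_def)
  also have "\<dots> = (Lun Z \<odot> (\<one> \<lhd> f)) \<odot> (e \<rhd> Y) \<odot> inva (Asc W V Y)"
    using assms slide_assoc[of e f "W \<otimes> V" \<one> Y Z "inva (Asc W V Y)"] by simp
  also have "\<dots> = f \<odot> Evf W V e Y"
    using assms Lun_nat[of f Z] by (simp add: Evf_def)
  finally show ?thesis .
qed

lemma Cof_nat:
  assumes "val b" "src b = \<one>" "tgt b = V \<otimes> W" "val f" "src f = Y" "tgt f = Z"
  shows "(V \<lhd> (W \<lhd> f)) \<odot> Cof V W b Y = Cof V W b Z \<odot> f"
proof -
  have "Cof V W b Z \<odot> f = Asc V W Z \<odot> (b \<rhd> Z) \<odot> (\<one> \<lhd> f) \<odot> inva (Lun Y)"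
    using assms Luni_nat[of f Y] by (simp add: Cof_def)
  also have "\<dots> = (Asc V W Z \<odot> ((V \<otimes> W) \<lhd> f)) \<odot> (b \<rhd> Y) \<odot> inva (Lun Y)"
    using assms slide_assoc[of b f \<one> "V \<otimes> W" Y Z "inva (Lun Y)"] by simp
  also have "\<dots> = (V \<lhd> (W \<lhd> f)) \<odot> Cof V W b Y"
    using assms Asc_nat3[of f Z V W] by (simp add: Cof_def)
  finally show ?thesis by simp
qed

text \<open>The pentagon solved for the composite that arises when a family is whiskered on the
  right; \<open>Pentagon2\<close> serves the same purpose for nested evaluations.\<close>

lemma Pentagon1: "Asc (W \<otimes> X) Y Z \<odot> (inva (Asc W X Y) \<rhd> Z)
    = inva (Asc W X (Y \<otimes> Z)) \<odot> (W \<lhd> Asc X Y Z) \<odot> Asc W (X \<otimes> Y) Z"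
proof (rule isoa_cancel_left[where f = "Asc W X (Y \<otimes> Z)"])
  have "Asc W X (Y \<otimes> Z) \<odot> Asc (W \<otimes> X) Y Z \<odot> (inva (Asc W X Y) \<rhd> Z)
    = (Asc W X (Y \<otimes> Z) \<odot> Asc (W \<otimes> X) Y Z) \<odot> (inva (Asc W X Y) \<rhd> Z)" by simp
  also have "\<dots> = (W \<lhd> Asc X Y Z) \<odot> Asc W (X \<otimes> Y) Z \<odot> ((Asc W X Y \<odot> inva (Asc W X Y)) \<rhd> Z)"
    unfolding Pentagon by (simp add: inva_rw del: comp_inva)
  finally show "Asc W X (Y \<otimes> Z) \<odot> Asc (W \<otimes> X) Y Z \<odot> (inva (Asc W X Y) \<rhd> Z)
    = Asc W X (Y \<otimes> Z) \<odot> inva (Asc W X (Y \<otimes> Z)) \<odot> (W \<lhd> Asc X Y Z) \<odot> Asc W (X \<otimes> Y) Z"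
    by simp
qed simp_all

text \<open>The associators on the right merely rebracket the argument; \<open>Lun_tens\<close> and
  \<open>Pentagon1\<close> collect them.\<close>

lemma Evf_rw:
  assumes "val e" "src e = W \<otimes> V" "tgt e = \<one>"
  shows "Evf W V e X \<rhd> Z = Evf W V e (X \<otimes> Z) \<odot> (W \<lhd> Asc V X Z) \<odot> Asc W (V \<otimes> X) Z"
proof -
  have "Evf W V e X \<rhd> Z = (Lun X \<rhd> Z) \<odot> ((e \<rhd> X) \<rhd> Z) \<odot> (inva (Asc W V X) \<rhd> Z)"
    using assms by (simp add: Evf_def)
  also have "\<dots> = Lun (X \<otimes> Z) \<odot> (Asc \<one> X Z \<odot> ((e \<rhd> X) \<rhd> Z)) \<odot> (inva (Asc W V X) \<rhd> Z)"
    using assms by (simp flip: Lun_tens)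
  also have "\<dots> = Lun (X \<otimes> Z) \<odot> (e \<rhd> (X \<otimes> Z)) \<odot> Asc (W \<otimes> V) X Z \<odot> (inva (Asc W V X) \<rhd> Z)"
    using assms by (simp add: Asc_nat1)
  also have "\<dots> = Evf W V e (X \<otimes> Z) \<odot> (W \<lhd> Asc V X Z) \<odot> Asc W (V \<otimes> X) Z"
    using assms by (simp add: Pentagon1 Evf_def)
  finally show ?thesis .
qed

lemma Cof_rw:
  assumes "val b" "src b = \<one>" "tgt b = V \<otimes> W"
  shows "(V \<lhd> Asc W X Z) \<odot> Asc V (W \<otimes> X) Z \<odot> (Cof V W b X \<rhd> Z) = Cof V W b (X \<otimes> Z)"
proof -
  have l: "Asc \<one> X Z \<odot> (inva (Lun X) \<rhd> Z) = inva (Lun (X \<otimes> Z))"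
  proof (rule isoa_cancel_left[where f = "Lun (X \<otimes> Z)"])
    have "Lun (X \<otimes> Z) \<odot> Asc \<one> X Z \<odot> (inva (Lun X) \<rhd> Z) = (Lun X \<rhd> Z) \<odot> (inva (Lun X) \<rhd> Z)"
      unfolding Lun_tens[symmetric] by simp
    also have "\<dots> = ida (X \<otimes> Z)" by (simp flip: inva_rw)
    finally show "Lun (X \<otimes> Z) \<odot> Asc \<one> X Z \<odot> (inva (Lun X) \<rhd> Z) = Lun (X \<otimes> Z) \<odot> inva (Lun (X \<otimes> Z))"
      by simp
  qed simp_all
  have "(V \<lhd> Asc W X Z) \<odot> Asc V (W \<otimes> X) Z \<odot> (Cof V W b X \<rhd> Z)
    = ((V \<lhd> Asc W X Z) \<odot> Asc V (W \<otimes> X) Z \<odot> (Asc V W X \<rhd> Z)) \<odot> ((b \<rhd> X) \<rhd> Z) \<odot> (inva (Lun X) \<rhd> Z)"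
    using assms by (simp add: Cof_def)
  also have "\<dots> = Asc V W (X \<otimes> Z) \<odot> (Asc (V \<otimes> W) X Z \<odot> ((b \<rhd> X) \<rhd> Z)) \<odot> (inva (Lun X) \<rhd> Z)"
    unfolding Pentagon[symmetric] using assms by simp
  also have "\<dots> = Asc V W (X \<otimes> Z) \<odot> (b \<rhd> (X \<otimes> Z)) \<odot> Asc \<one> X Z \<odot> (inva (Lun X) \<rhd> Z)"
    using assms by (simp add: Asc_nat1)
  finally show ?thesis unfolding l by (simp add: Cof_def)
qed

lemma Triangle1: "Asc X \<one> Y \<odot> (inva (Run X) \<rhd> Y) = X \<lhd> inva (Lun Y)"
proof (rule isoa_cancel_left[where f = "X \<lhd> Lun Y"])
  have "(X \<lhd> Lun Y) \<odot> Asc X \<one> Y \<odot> (inva (Run X) \<rhd> Y) = (Run X \<rhd> Y) \<odot> (inva (Run X) \<rhd> Y)"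
    unfolding Triangle[symmetric] by simp
  also have "\<dots> = ida (X \<otimes> Y)" by (simp flip: inva_rw)
  finally show "(X \<lhd> Lun Y) \<odot> Asc X \<one> Y \<odot> (inva (Run X) \<rhd> Y) = (X \<lhd> Lun Y) \<odot> (X \<lhd> inva (Lun Y))"
    by (simp flip: inva_lw)
qed simp_all

text \<open>The arrow V -> U bent from e and c becomes, after tensoring with Z, a composite of two
  family members without associators. For U = V this turns the first zigzag identity into its family
  form; general U serves \<open>Coev_transpose\<close>.\<close>

lemma zigzag_rw1:
  assumes "val e" "src e = W \<otimes> V" "tgt e = \<one>" "val c" "src c = \<one>" "tgt c = U \<otimes> W"
  shows "(Run U \<odot> (U \<lhd> e) \<odot> Asc U W V \<odot> (c \<rhd> V) \<odot> inva (Lun V)) \<rhd> Z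
    = (U \<lhd> Evf W V e Z) \<odot> Cof U W c (V \<otimes> Z)"
proof -
  have "(Run U \<odot> (U \<lhd> e) \<odot> Asc U W V \<odot> (c \<rhd> V) \<odot> inva (Lun V)) \<rhd> Z
     = (Run U \<rhd> Z) \<odot> ((U \<lhd> e) \<rhd> Z) \<odot> (Cof U W c V \<rhd> Z)"
    using assms by (simp add: Cof_def)
  also have "\<dots> = (U \<lhd> Lun Z) \<odot> (Asc U \<one> Z \<odot> ((U \<lhd> e) \<rhd> Z)) \<odot> (Cof U W c V \<rhd> Z)"
    using assms by (simp flip: Triangle)
  also have "\<dots> = (U \<lhd> Lun Z) \<odot> (U \<lhd> (e \<rhd> Z)) \<odot> Asc U (W \<otimes> V) Z \<odot> (Cof U W c V \<rhd> Z)"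
    using assms by (simp add: Asc_nat2)
  \<comment> \<open>The inserted identity of U (x) ((W (x) V) (x) Z) supplies the associator that
    \<open>Cof_rw\<close> expects.\<close>
  also have "\<dots> = (U \<lhd> Lun Z) \<odot> (U \<lhd> (e \<rhd> Z)) \<odot> (inva (U \<lhd> Asc W V Z) \<odot> (U \<lhd> Asc W V Z)) \<odot> Asc U (W \<otimes> V) Z \<odot> (Cof U W c V \<rhd> Z)"
    using assms by simp
  also have "\<dots> = (U \<lhd> Lun Z) \<odot> (U \<lhd> (e \<rhd> Z)) \<odot> inva (U \<lhd> Asc W V Z) \<odot> ((U \<lhd> Asc W V Z) \<odot> Asc U (W \<otimes> V) Z \<odot> (Cof U W c V \<rhd> Z))"
    using assms by (simp del: comp_inva inva_comp comp_inva_assoc inva_comp_assoc)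
  finally show ?thesis using assms unfolding Cof_rw[OF assms(4-)] by (simp add: Evf_def inva_lw)
qed

text \<open>The mirror image of \<open>zigzag_rw1\<close>. As c is arbitrary, it also covers
  transposes, where c is the coevaluation of V followed by f.\<close>

lemma zigzag_rw2:
  assumes "val e" "src e = W' \<otimes> V'" "tgt e = \<one>" "val c" "src c = \<one>" "tgt c = V' \<otimes> W"
  shows "(Lun W \<odot> (e \<rhd> W) \<odot> inva (Asc W' V' W) \<odot> (W' \<lhd> c) \<odot> inva (Run W')) \<rhd> Z
    = Evf W' V' e (W \<otimes> Z) \<odot> (W' \<lhd> Cof V' W c Z)"
proof -
  have "(Lun W \<odot> (e \<rhd> W) \<odot> inva (Asc W' V' W) \<odot> (W' \<lhd> c) \<odot> inva (Run W')) \<rhd> Z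
     = (Evf W' V' e W \<rhd> Z) \<odot> ((W' \<lhd> c) \<rhd> Z) \<odot> (inva (Run W') \<rhd> Z)"
    using assms by (simp add: Evf_def)
  also have "\<dots> = Evf W' V' e (W \<otimes> Z) \<odot> (W' \<lhd> Asc V' W Z) \<odot> (Asc W' (V' \<otimes> W) Z
       \<odot> ((W' \<lhd> c) \<rhd> Z)) \<odot> (inva (Run W') \<rhd> Z)"
    using assms by (simp add: Evf_rw)
  also have "\<dots> = Evf W' V' e (W \<otimes> Z) \<odot> (W' \<lhd> Asc V' W Z) \<odot> (W' \<lhd> (c \<rhd> Z)) \<odot> Asc W' \<one> Z
        \<odot> (inva (Run W') \<rhd> Z)"
    using assms by (simp add: Asc_nat2)
  finally show ?thesis using assms by (simp add: Triangle1 Cof_def)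
qed

end

section \<open>Dual objects\<close>

text \<open>A duality given by its families alone. Both zigzags then read without associators, and
  dualities pasted from two others (\<open>pair_E\<close>, \<open>pair_B\<close>) stand on equal
  terms with those coming from \<open>ev\<close> and \<open>coev\<close>.\<close>

locale dual_family = monoidal_category C
  for C :: "('o, 'm::ab_group_add, 'z) moncat_scheme" (structure) +
  fixes V W :: 'o and E B :: "'o \<Rightarrow> ('o, 'm) arr"
  assumes val_E [simp]: "val (E Z)" and src_E [simp]: "src (E Z) = W \<otimes> (V \<otimes> Z)"
    and tgt_E [simp]: "tgt (E Z) = Z"
    and val_B [simp]: "val (B Z)" and src_B [simp]: "src (B Z) = Z"
    and tgt_B [simp]: "tgt (B Z) = V \<otimes> (W \<otimes> Z)"
    and E_nat: "\<lbrakk>val f; tgt f = Y\<rbrakk> \<Longrightarrow> E Y \<odot> (W \<lhd> (V \<lhd> f)) = f \<odot> E (src f)"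
    and B_nat: "\<lbrakk>val f; src f = X\<rbrakk> \<Longrightarrow> (V \<lhd> (W \<lhd> f)) \<odot> B X = B (tgt f) \<odot> f"
    and zz1: "(V \<lhd> E Z) \<odot> B (V \<otimes> Z) = ida (V \<otimes> Z)"
    and zz2: "E (W \<otimes> Z) \<odot> (W \<lhd> B Z) = ida (W \<otimes> Z)"
begin

lemma E_nat_assoc: "\<lbrakk>val f; tgt f = Y; val r; tgt r = W \<otimes> (V \<otimes> src f)\<rbrakk>
    \<Longrightarrow> E Y \<odot> (W \<lhd> (V \<lhd> f)) \<odot> r = f \<odot> E (src f) \<odot> r"
  by (rule comp_eq_comp_assoc[OF E_nat]) auto

lemma zz1_assoc: "\<lbrakk>val r; tgt r = V \<otimes> Z\<rbrakk> \<Longrightarrow> (V \<lhd> E Z) \<odot> B (V \<otimes> Z) \<odot> r = r"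
  by (subst comp_eq_assoc[OF zz1]) auto

lemma zz2_assoc: "\<lbrakk>val r; tgt r = W \<otimes> Z\<rbrakk> \<Longrightarrow> E (W \<otimes> Z) \<odot> (W \<lhd> B Z) \<odot> r = r"
  by (subst comp_eq_assoc[OF zz2]) auto

end

locale dual_family_pair = monoidal_category C + d1: dual_family C V W E B + d2: dual_family C V' W' E' B'
  for C :: "('o, 'm::ab_group_add, 'z) moncat_scheme" (structure)
    and V W E B V' W' E' B'
begin

text \<open>By \<open>fam\<close>, t is the transpose of f. Naturality of \<open>E'\<close> takes
  \<open>E\<close> inside, interchange takes it past f, and there it cancels with \<open>B\<close>
  by a zigzag.\<close>

lemma transpose_E:
  assumes f: "val f" "src f = V" "tgt f = V'" and t: "val t" "src t = W'" "tgt t = W"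
    and fam: "\<And>Z. t \<rhd> Z = E' (W \<otimes> Z) \<odot> (W' \<lhd> (f \<rhd> (W \<otimes> Z))) \<odot> (W' \<lhd> B Z)"
  shows "E Z \<odot> (t \<rhd> (V \<otimes> Z)) = E' Z \<odot> (W' \<lhd> (f \<rhd> Z))"
proof -
  note [simp] = f t
  have "E Z \<odot> (t \<rhd> (V \<otimes> Z)) = E' Z \<odot> (W' \<lhd> (V' \<lhd> E Z)) \<odot> (W' \<lhd> (f \<rhd> (W \<otimes> (V \<otimes> Z))))
      \<odot> (W' \<lhd> B (V \<otimes> Z))"
    by (subst d2.E_nat_assoc) (simp_all add: fam)
  also have "\<dots> = E' Z \<odot> (W' \<lhd> ((V' \<lhd> E Z) \<odot> (f \<rhd> (W \<otimes> (V \<otimes> Z))))) \<odot> (W' \<lhd> B (V \<otimes> Z))"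
    by simp
  also have "\<dots> = E' Z \<odot> (W' \<lhd> (f \<rhd> Z)) \<odot> (W' \<lhd> ((V \<lhd> E Z) \<odot> B (V \<otimes> Z)))"
    by (simp add: slide[of f "E Z" V V'])
  also have "\<dots> = E' Z \<odot> (W' \<lhd> (f \<rhd> Z))"
    by (simp only: d1.zz1) simp
  finally show ?thesis .
qed

text \<open>The companion of \<open>transpose_E\<close> for coevaluations; here \<open>E'\<close>
  cancels with \<open>B'\<close>.\<close>

lemma transpose_B:
  assumes f: "val f" "src f = V" "tgt f = V'" and t: "val t" "src t = W'" "tgt t = W"
    and fam: "\<And>Z. t \<rhd> Z = E' (W \<otimes> Z) \<odot> (W' \<lhd> (f \<rhd> (W \<otimes> Z))) \<odot> (W' \<lhd> B Z)"
  shows "(V' \<lhd> (t \<rhd> Z)) \<odot> B' Z = (f \<rhd> (W \<otimes> Z)) \<odot> B Z"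
proof -
  note [simp] = f t
  have "(V' \<lhd> (t \<rhd> Z)) \<odot> B' Z
    = (V' \<lhd> E' (W \<otimes> Z)) \<odot> (V' \<lhd> (W' \<lhd> ((f \<rhd> (W \<otimes> Z)) \<odot> B Z))) \<odot> B' Z"
    by (simp add: fam)
  also have "\<dots> = (f \<rhd> (W \<otimes> Z)) \<odot> B Z"
    by (subst d2.B_nat) (simp_all add: d2.zz1_assoc del: lw_comp)
  finally show ?thesis .
qed

text \<open>The evaluations are nested, W with V inside and W' with V' outside, which is why the
  dual of V (x) V' is W' (x) W.\<close>

definition pair_E :: "'o \<Rightarrow> ('o, 'm) arr" where
  "pair_E Z = E' Z \<odot> (W' \<lhd> E (V' \<otimes> Z)) \<odot> (W' \<lhd> (W \<lhd> Asc V V' Z)) \<odot> Asc W' W ((V \<otimes> V') \<otimes> Z)"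

definition pair_B :: "'o \<Rightarrow> ('o, 'm) arr" where
  "pair_B Z = inva (Asc V V' ((W' \<otimes> W) \<otimes> Z)) \<odot> (V \<lhd> (V' \<lhd> inva (Asc W' W Z))) \<odot>
     (V \<lhd> B' (W \<otimes> Z)) \<odot> B Z"

lemma val_pair_E [simp]: "val (pair_E Z)" and src_pair_E [simp]: "src (pair_E Z) = (W' \<otimes> W) \<otimes> ((V \<otimes> V') \<otimes> Z)"
  and tgt_pair_E [simp]: "tgt (pair_E Z) = Z"
  and val_pair_B [simp]: "val (pair_B Z)" and src_pair_B [simp]: "src (pair_B Z) = Z"
  and tgt_pair_B [simp]: "tgt (pair_B Z) = (V \<otimes> V') \<otimes> ((W' \<otimes> W) \<otimes> Z)"
  by (simp_all add: pair_E_def pair_B_def)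

text \<open>The two zigzags are used one inside the other: naturality of \<open>B'\<close> brings
  the primed pair together, and once it has cancelled the unprimed pair can cancel.\<close>

lemma pair_zz1: "((V \<otimes> V') \<lhd> pair_E Z) \<odot> pair_B ((V \<otimes> V') \<otimes> Z) = ida ((V \<otimes> V') \<otimes> Z)"
proof -
  let ?a = "Asc V V' Z"
  have "((V \<otimes> V') \<lhd> pair_E Z) \<odot> pair_B ((V \<otimes> V') \<otimes> Z)
    = inva ?a \<odot> (V \<lhd> (V' \<lhd> pair_E Z)) \<odot> (V \<lhd> (V' \<lhd> inva (Asc W' W ((V \<otimes> V') \<otimes> Z)))) \<odot>
       (V \<lhd> B' (W \<otimes> ((V \<otimes> V') \<otimes> Z))) \<odot> B ((V \<otimes> V') \<otimes> Z)"
    unfolding pair_B_def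
    by (subst comp_eq_comp_assoc[OF Asci_nat3[symmetric]]) (simp_all add: pair_E_def)
  also have "\<dots> = inva ?a \<odot> (V \<lhd> (V' \<lhd> (pair_E Z \<odot> inva (Asc W' W ((V \<otimes> V') \<otimes> Z))))) \<odot>
       (V \<lhd> B' (W \<otimes> ((V \<otimes> V') \<otimes> Z))) \<odot> B ((V \<otimes> V') \<otimes> Z)"
    by (simp add: pair_E_def flip: inva_lw)
  also have "\<dots> = inva ?a \<odot> (V \<lhd> ((V' \<lhd> E' Z) \<odot> ((V' \<lhd> (W' \<lhd> (E (V' \<otimes> Z) \<odot> (W \<lhd> ?a)))) \<odot>
       B' (W \<otimes> ((V \<otimes> V') \<otimes> Z))))) \<odot> B ((V \<otimes> V') \<otimes> Z)"
    by (simp add: pair_E_def flip: inva_lw)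
  also have "\<dots> = inva ?a \<odot> (V \<lhd> (((V' \<lhd> E' Z) \<odot> B' (V' \<otimes> Z)) \<odot> E (V' \<otimes> Z) \<odot> (W \<lhd> ?a)))
       \<odot> B ((V \<otimes> V') \<otimes> Z)"
    by (subst d2.B_nat) simp_all
  also have "\<dots> = inva ?a \<odot> (V \<lhd> E (V' \<otimes> Z)) \<odot> (V \<lhd> (W \<lhd> ?a)) \<odot> B ((V \<otimes> V') \<otimes> Z)"
    unfolding d2.zz1 by simp
  also have "\<dots> = ida ((V \<otimes> V') \<otimes> Z)"
    by (simp add: d1.B_nat d1.zz1_assoc)
  finally show ?thesis .
qed

lemma pair_zz2: "pair_E ((W' \<otimes> W) \<otimes> Z) \<odot> ((W' \<otimes> W) \<lhd> pair_B Z) = ida ((W' \<otimes> W) \<otimes> Z)"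
proof -
  let ?a = "Asc W' W Z"
  have "pair_E ((W' \<otimes> W) \<otimes> Z) \<odot> ((W' \<otimes> W) \<lhd> pair_B Z)
    = E' ((W' \<otimes> W) \<otimes> Z) \<odot> (W' \<lhd> E (V' \<otimes> ((W' \<otimes> W) \<otimes> Z))) \<odot>
       (W' \<lhd> (W \<lhd> (Asc V V' ((W' \<otimes> W) \<otimes> Z) \<odot> pair_B Z))) \<odot> ?a"
    by (simp add: pair_E_def Asc_nat3)
  also have "\<dots> = E' ((W' \<otimes> W) \<otimes> Z) \<odot> (W' \<lhd> (E (V' \<otimes> ((W' \<otimes> W) \<otimes> Z)) \<odot>
       (W \<lhd> (V \<lhd> ((V' \<lhd> inva ?a) \<odot> B' (W \<otimes> Z)))) \<odot> (W \<lhd> B Z))) \<odot> ?a"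
    by (simp add: pair_B_def flip: inva_lw)
  also have "\<dots> = E' ((W' \<otimes> W) \<otimes> Z) \<odot> (W' \<lhd> (((V' \<lhd> inva ?a) \<odot> B' (W \<otimes> Z)) \<odot>
       E (W \<otimes> Z) \<odot> (W \<lhd> B Z))) \<odot> ?a"
    by (subst d1.E_nat_assoc) simp_all
  also have "\<dots> = E' ((W' \<otimes> W) \<otimes> Z) \<odot> (W' \<lhd> (V' \<lhd> inva ?a)) \<odot> (W' \<lhd> B' (W \<otimes> Z)) \<odot> ?a"
    unfolding d1.zz2 by simp
  also have "\<dots> = ida ((W' \<otimes> W) \<otimes> Z)"
    by (simp add: d2.E_nat_assoc d2.zz2_assoc)
  finally show ?thesis .
qed

lemma dual_family_pair: "dual_family C (V \<otimes> V') (W' \<otimes> W) pair_E pair_B"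
proof unfold_locales
  fix f Y assume f: "val f" "tgt f = Y"
  let ?X = "src f"
  have "pair_E Y \<odot> ((W' \<otimes> W) \<lhd> ((V \<otimes> V') \<lhd> f))
    = E' Y \<odot> (W' \<lhd> E (V' \<otimes> Y)) \<odot> (W' \<lhd> (W \<lhd> Asc V V' Y)) \<odot> (W' \<lhd> (W \<lhd> ((V \<otimes> V') \<lhd> f))) \<odot> Asc W' W ((V \<otimes> V') \<otimes> ?X)"
    using f by (simp add: pair_E_def Asc_nat3)
  also have "\<dots> = E' Y \<odot> (W' \<lhd> (E (V' \<otimes> Y) \<odot> (W \<lhd> (V \<lhd> (V' \<lhd> f))))) \<odot> (W' \<lhd> (W \<lhd> Asc V V' ?X)) \<odot>
      Asc W' W ((V \<otimes> V') \<otimes> ?X)"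
    using f comp_eq_assoc[of "W' \<lhd> (W \<lhd> Asc V V' Y)" "W' \<lhd> (W \<lhd> ((V \<otimes> V') \<lhd> f))" _ "Asc W' W ((V \<otimes> V') \<otimes> ?X)"]
      Asc_nat3[of f Y V V']
    by (simp flip: lw_comp) simp
  also have "\<dots> = E' Y \<odot> (W' \<lhd> (V' \<lhd> f)) \<odot> (W' \<lhd> E (V' \<otimes> ?X)) \<odot> (W' \<lhd> (W \<lhd> Asc V V' ?X)) \<odot>
      Asc W' W ((V \<otimes> V') \<otimes> ?X)"
    using f by (subst d1.E_nat) simp_all
  also have "\<dots> = f \<odot> pair_E ?X"
    using f by (subst d2.E_nat_assoc) (simp_all add: pair_E_def)
  finally show "pair_E Y \<odot> ((W' \<otimes> W) \<lhd> ((V \<otimes> V') \<lhd> f)) = f \<odot> pair_E ?X" .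
next
  fix f X assume f: "val f" "src f = X"
  let ?Y = "tgt f"
  have "((V \<otimes> V') \<lhd> ((W' \<otimes> W) \<lhd> f)) \<odot> pair_B X
    = inva (Asc V V' ((W' \<otimes> W) \<otimes> ?Y)) \<odot> (V \<lhd> (V' \<lhd> (((W' \<otimes> W) \<lhd> f) \<odot> inva (Asc W' W X)))) \<odot>
     (V \<lhd> B' (W \<otimes> X)) \<odot> B X"
    unfolding pair_B_def using f
    by (subst comp_eq_comp_assoc[OF Asci_nat3[symmetric]]) simp_all
  also have "\<dots> = inva (Asc V V' ((W' \<otimes> W) \<otimes> ?Y)) \<odot> (V \<lhd> (V' \<lhd> inva (Asc W' W ?Y))) \<odot>
     (V \<lhd> ((V' \<lhd> (W' \<lhd> (W \<lhd> f))) \<odot> B' (W \<otimes> X))) \<odot> B X"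
    using f by (subst Asci_nat3[where f = f, symmetric]) simp_all
  also have "\<dots> = inva (Asc V V' ((W' \<otimes> W) \<otimes> ?Y)) \<odot> (V \<lhd> (V' \<lhd> inva (Asc W' W ?Y))) \<odot>
     (V \<lhd> B' (W \<otimes> ?Y)) \<odot> (V \<lhd> (W \<lhd> f)) \<odot> B X"
    using f by (subst d2.B_nat) simp_all
  also have "\<dots> = pair_B ?Y \<odot> f"
    using f by (subst d1.B_nat) (simp_all add: pair_B_def)
  finally show "((V \<otimes> V') \<lhd> ((W' \<otimes> W) \<lhd> f)) \<odot> pair_B X = pair_B ?Y \<odot> f" .
next
  show "\<And>Z. ((V \<otimes> V') \<lhd> pair_E Z) \<odot> pair_B ((V \<otimes> V') \<otimes> Z) = ida ((V \<otimes> V') \<otimes> Z)"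
    by (rule pair_zz1)
  show "\<And>Z. pair_E ((W' \<otimes> W) \<otimes> Z) \<odot> ((W' \<otimes> W) \<lhd> pair_B Z) = ida ((W' \<otimes> W) \<otimes> Z)"
    by (rule pair_zz2)
qed simp_all

end

context monoidal_category
begin

lemma dual_familyI:
  assumes e: "val e" "src e = W \<otimes> V" "tgt e = \<one>" and b: "val b" "src b = \<one>" "tgt b = V \<otimes> W"
    and z1: "Run V \<odot> (V \<lhd> e) \<odot> Asc V W V \<odot> (b \<rhd> V) \<odot> inva (Lun V) = ida V"
    and z2: "Lun W \<odot> (e \<rhd> W) \<odot> inva (Asc W V W) \<odot> (W \<lhd> b) \<odot> inva (Run W) = ida W"
  shows "dual_family C V W (Evf W V e) (Cof V W b)"
proof unfold_locales
  show "(V \<lhd> Evf W V e Z) \<odot> Cof V W b (V \<otimes> Z) = ida (V \<otimes> Z)" for Z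
    using zigzag_rw1[OF e b, of Z] unfolding z1 by simp
  show "Evf W V e (W \<otimes> Z) \<odot> (W \<lhd> Cof V W b Z) = ida (W \<otimes> Z)" for Z
    using zigzag_rw2[OF e b, of Z] unfolding z2 by simp
qed (simp_all add: e b Evf_nat Cof_nat)

lemma is_dual_family:
  assumes "is_dual C W V (mor e) (mor b)" "src e = W \<otimes> V" "tgt e = \<one>" "src b = \<one>" "tgt b = V \<otimes> W"
  shows "dual_family C V W (Evf W V e) (Cof V W b)"
proof (rule dual_familyI)
  show "Run V \<odot> (V \<lhd> e) \<odot> Asc V W V \<odot> (b \<rhd> V) \<odot> inva (Lun V) = ida V"
    "Lun W \<odot> (e \<rhd> W) \<odot> inva (Asc W V W) \<odot> (W \<lhd> b) \<odot> inva (Run W) = ida W"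
    using assms unfolding is_dual_def asci_def luni_def runi_def
    by (simp_all add: comp_def lw_def rw_def Run_def Lun_def Asc_def inva_def ida_def)
qed (use assms in \<open>auto simp: is_dual_def val_def\<close>)

definition Transp :: "'o \<Rightarrow> 'o \<Rightarrow> 'o \<Rightarrow> 'o \<Rightarrow> ('o, 'm) arr \<Rightarrow> ('o, 'm) arr \<Rightarrow> ('o, 'm) arr \<Rightarrow> ('o, 'm) arr" where
  "Transp V V' W W' e' b f = Arr W' W (transp C V V' W W' (mor e') (mor b) (mor f))"

lemma Transp_alt:
  assumes e: "val e" "src e = W' \<otimes> V'" "tgt e = \<one>" and b: "val b" "src b = \<one>" "tgt b = V \<otimes> W"
    and f: "val f" "src f = V" "tgt f = V'"
  shows "Transp V V' W W' e b f =
    Lun W \<odot> (e \<rhd> W) \<odot> inva (Asc W' V' W) \<odot> (W' \<lhd> ((f \<rhd> W) \<odot> b)) \<odot> inva (Run W')"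
proof -
  have "Transp V V' W W' e b f =
    Lun W \<odot> (e \<rhd> W) \<odot> inva (Asc W' V' W) \<odot> (W' \<lhd> (f \<rhd> W)) \<odot> (W' \<lhd> b) \<odot> inva (Run W')"
    using assms unfolding Transp_def transp_def asci_def runi_def
    by (simp add: comp_def lw_def rw_def Run_def Lun_def Asc_def inva_def)
  then show ?thesis using assms by simp
qed

text \<open>Supplies exactly the hypothesis \<open>fam\<close> of \<open>transpose_E\<close> and
  \<open>transpose_B\<close>. Canonical isomorphisms between two duals of one object are the case f
  = id.\<close>

lemma Transp_fam:
  assumes e: "val e" "src e = W' \<otimes> V'" "tgt e = \<one>" and b: "val b" "src b = \<one>" "tgt b = V \<otimes> W"
    and f: "val f" "src f = V" "tgt f = V'"
  shows val_Transp: "val (Transp V V' W W' e b f)"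
    and "Transp V V' W W' e b f \<rhd> Z = Evf W' V' e (W \<otimes> Z) \<odot> (W' \<lhd> (f \<rhd> (W \<otimes> Z))) \<odot> (W' \<lhd> Cof V W b Z)"
proof -
  have "Transp V V' W W' e b f \<rhd> Z = Evf W' V' e (W \<otimes> Z) \<odot> (W' \<lhd> Cof V' W ((f \<rhd> W) \<odot> b) Z)"
    unfolding Transp_alt[OF assms] by (rule zigzag_rw2) (use assms in simp_all)
  also have "Cof V' W ((f \<rhd> W) \<odot> b) Z = (f \<rhd> (W \<otimes> Z)) \<odot> Cof V W b Z"
    using assms comp_eq_comp_assoc[OF Asc_nat1[of f V' W Z], of "(b \<rhd> Z) \<odot> inva (Lun Z)"]
    by (simp add: Cof_def)
  finally show "Transp V V' W W' e b f \<rhd> Z = Evf W' V' e (W \<otimes> Z) \<odot> (W' \<lhd> (f \<rhd> (W \<otimes> Z))) \<odot> (W' \<lhd> Cof V W b Z)"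
    using assms by simp
qed (use assms in \<open>simp_all add: Transp_alt\<close>)

end

section \<open>Partial traces\<close>

context monoidal_category
begin

lemma Pentagon2: "(Asc W X Y \<rhd> Z) \<odot> inva (Asc (W \<otimes> X) Y Z)
    = inva (Asc W (X \<otimes> Y) Z) \<odot> (W \<lhd> inva (Asc X Y Z)) \<odot> Asc W X (Y \<otimes> Z)"
proof (rule isoa_cancel_right[where f = "Asc (W \<otimes> X) Y Z"])
  have "(inva (Asc W (X \<otimes> Y) Z) \<odot> (W \<lhd> inva (Asc X Y Z)) \<odot> Asc W X (Y \<otimes> Z)) \<odot> Asc (W \<otimes> X) Y Z
    = inva (Asc W (X \<otimes> Y) Z) \<odot> (W \<lhd> inva (Asc X Y Z)) \<odot> (Asc W X (Y \<otimes> Z) \<odot> Asc (W \<otimes> X) Y Z)"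
    by simp
  also have "\<dots> = Asc W X Y \<rhd> Z"
    unfolding Pentagon by (simp flip: inva_lw)
  finally show "((Asc W X Y \<rhd> Z) \<odot> inva (Asc (W \<otimes> X) Y Z)) \<odot> Asc (W \<otimes> X) Y Z =
    (inva (Asc W (X \<otimes> Y) Z) \<odot> (W \<lhd> inva (Asc X Y Z)) \<odot> Asc W X (Y \<otimes> Z)) \<odot> Asc (W \<otimes> X) Y Z"
    by simp
qed simp_all

text \<open>The evaluation on the left is the one from which \<open>dual_tens\<close> is built.
  Since its family is the nested one, the pasted duality describes the canonical isomorphism
  \<open>dual_tens\<close>.\<close>

lemma Evf_pair:
  assumes e: "val e" "src e = A' \<otimes> A" "tgt e = \<one>" and f: "val f" "src f = B' \<otimes> B" "tgt f = \<one>"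
  shows "Evf (B' \<otimes> A') (A \<otimes> B) (f \<odot> (B' \<lhd> Evf A' A e B) \<odot> Asc B' A' (A \<otimes> B)) Z
    = Evf B' B f Z \<odot> (B' \<lhd> Evf A' A e (B \<otimes> Z)) \<odot> (B' \<lhd> (A' \<lhd> Asc A B Z)) \<odot> Asc B' A' ((A \<otimes> B) \<otimes> Z)"
proof -
  let ?g = "Evf A' A e B"
  have "Evf (B' \<otimes> A') (A \<otimes> B) (f \<odot> (B' \<lhd> ?g) \<odot> Asc B' A' (A \<otimes> B)) Z
    = Lun Z \<odot> (f \<rhd> Z) \<odot> ((B' \<lhd> ?g) \<rhd> Z) \<odot> ((Asc B' A' (A \<otimes> B) \<rhd> Z) \<odot> inva (Asc (B' \<otimes> A') (A \<otimes> B) Z))"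
    using assms by (simp add: Evf_def[of "B' \<otimes> A'"])
  also have "\<dots> = Lun Z \<odot> (f \<rhd> Z) \<odot> (((B' \<lhd> ?g) \<rhd> Z) \<odot> inva (Asc B' (A' \<otimes> (A \<otimes> B)) Z)) \<odot>
      (B' \<lhd> inva (Asc A' (A \<otimes> B) Z)) \<odot> Asc B' A' ((A \<otimes> B) \<otimes> Z)"
    unfolding Pentagon2 using assms by simp
  also have "((B' \<lhd> ?g) \<rhd> Z) \<odot> inva (Asc B' (A' \<otimes> (A \<otimes> B)) Z) = inva (Asc B' B Z) \<odot> (B' \<lhd> (?g \<rhd> Z))"
    using Asci_nat2[of ?g "A' \<otimes> (A \<otimes> B)" B' Z] assms by simp
  also have "Lun Z \<odot> (f \<rhd> Z) \<odot> (inva (Asc B' B Z) \<odot> (B' \<lhd> (?g \<rhd> Z))) \<odot>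
      (B' \<lhd> inva (Asc A' (A \<otimes> B) Z)) \<odot> Asc B' A' ((A \<otimes> B) \<otimes> Z)
    = Evf B' B f Z \<odot> (B' \<lhd> Evf A' A e (B \<otimes> Z)) \<odot> (B' \<lhd> (A' \<lhd> Asc A B Z)) \<odot> Asc B' A' ((A \<otimes> B) \<otimes> Z)"
    using assms by (simp add: Evf_rw Evf_def[of B' B] flip: inva_lw)
  finally show ?thesis .
qed

lemma Cof_rw_arg:
  assumes "val b" "src b = \<one>" "tgt b = V \<otimes> W" "val f" "src f = W"
  shows "Cof V (tgt f) ((V \<lhd> f) \<odot> b) Z = (V \<lhd> (f \<rhd> Z)) \<odot> Cof V W b Z"
  using assms Asc_nat2_assoc[of f "tgt f" "(b \<rhd> Z) \<odot> inva (Lun Z)" V Z] by (simp add: Cof_def)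

end

section \<open>Transposes and traces in a pivotal category\<close>

context pivotal_category
begin

definition Ev :: "'o \<Rightarrow> ('o, 'm) arr" where "Ev X = Arr (dual C X \<otimes> X) \<one> (ev C X)"

definition Coev :: "'o \<Rightarrow> ('o, 'm) arr" where "Coev X = Arr \<one> (X \<otimes> dual C X) (coev C X)"

definition Piv :: "'o \<Rightarrow> ('o, 'm) arr" where "Piv X = Arr X (dual C (dual C X)) (piv C X)"

definition evf :: "'o \<Rightarrow> 'o \<Rightarrow> ('o, 'm) arr" where "evf X = Evf (dual C X) X (Ev X)"

definition cof :: "'o \<Rightarrow> 'o \<Rightarrow> ('o, 'm) arr" where "cof X = Cof X (dual C X) (Coev X)"

definition Dualm :: "('o, 'm) arr \<Rightarrow> ('o, 'm) arr" where
  "Dualm f = Arr (dual C (tgt f)) (dual C (src f)) (dualm C (src f) (tgt f) (mor f))"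

text \<open>The family of the right coevaluation \<open>rev_coev\<close>: the coevaluation of the
  dual of X, followed by the inverse pivot on the double dual.\<close>

definition rcf :: "'o \<Rightarrow> 'o \<Rightarrow> ('o, 'm) arr" where
  "rcf X Z = (dual C X \<lhd> (inva (Piv X) \<rhd> Z)) \<odot> cof (dual C X) Z"

definition Ptr :: "'o \<Rightarrow> 'o \<Rightarrow> 'o \<Rightarrow> ('o, 'm) arr \<Rightarrow> ('o, 'm) arr" where
  "Ptr V X Y f = evf V Y \<odot> (dual C V \<lhd> f) \<odot> rcf V X"

lemma src_Ev [simp]: "src (Ev X) = dual C X \<otimes> X" and tgt_Ev [simp]: "tgt (Ev X) = \<one>"
  and val_Ev [simp]: "val (Ev X)"
  and src_Coev [simp]: "src (Coev X) = \<one>" and tgt_Coev [simp]: "tgt (Coev X) = X \<otimes> dual C X"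
  and val_Coev [simp]: "val (Coev X)"
  and src_Piv [simp]: "src (Piv X) = X" and tgt_Piv [simp]: "tgt (Piv X) = dual C (dual C X)"
  and isoa_Piv [simp]: "isoa (Piv X)"
  using left_dual[of X] piv_iso[of X]
  by (simp_all add: Ev_def Coev_def Piv_def is_dual_def isoa_def)

sublocale ev: dual_family C X "dual C X" "evf X" "cof X" for X
  unfolding evf_def cof_def by (rule is_dual_family) (simp_all add: left_dual Ev_def Coev_def)

lemma Dualm_Transp: "Dualm f = Transp (src f) (tgt f) (dual C (src f)) (dual C (tgt f)) (Ev (tgt f)) (Coev (src f)) f"
  by (simp add: Dualm_def dualm_def Transp_def Ev_def Coev_def)

lemma src_Dualm [simp]: "src (Dualm f) = dual C (tgt f)" and tgt_Dualm [simp]: "tgt (Dualm f) = dual C (src f)"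
  by (simp_all add: Dualm_def)

lemma val_Dualm [simp]: "val f \<Longrightarrow> val (Dualm f)"
  unfolding Dualm_Transp by (rule val_Transp) simp_all

lemma Dualm_fam:
  assumes "val f"
  shows "Dualm f \<rhd> Z = evf (tgt f) (dual C (src f) \<otimes> Z) \<odot>
    (dual C (tgt f) \<lhd> (f \<rhd> (dual C (src f) \<otimes> Z))) \<odot> (dual C (tgt f) \<lhd> cof (src f) Z)"
  unfolding Dualm_Transp evf_def cof_def by (rule Transp_fam(2)) (simp_all add: assms)

lemma Dualm_evf:
  assumes "val f" "src f = X"
  shows "evf X Z \<odot> (Dualm f \<rhd> (X \<otimes> Z)) = evf (tgt f) Z \<odot> (dual C (tgt f) \<lhd> (f \<rhd> Z))"
proof -
  interpret dual_family_pair C X "dual C X" "evf X" "cof X" "tgt f" "dual C (tgt f)" "evf (tgt f)" "cof (tgt f)" ..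
  show ?thesis by (rule transpose_E) (use assms Dualm_fam in auto)
qed

lemma Dualm_cof:
  assumes "val f" "tgt f = Y"
  shows "(Y \<lhd> (Dualm f \<rhd> Z)) \<odot> cof Y Z = (f \<rhd> (dual C (src f) \<otimes> Z)) \<odot> cof (src f) Z"
proof -
  interpret dual_family_pair C "src f" "dual C (src f)" "evf (src f)" "cof (src f)" Y "dual C Y" "evf Y" "cof Y" ..
  show ?thesis by (rule transpose_B) (use assms Dualm_fam in auto)
qed

lemma src_rcf [simp]: "src (rcf X Z) = Z" and tgt_rcf [simp]: "tgt (rcf X Z) = dual C X \<otimes> (X \<otimes> Z)"
  and val_rcf [simp]: "val (rcf X Z)"
  by (simp_all add: rcf_def)

lemma Piv_nat: "\<lbrakk>val f; tgt f = Y\<rbrakk> \<Longrightarrow> Piv Y \<odot> f = Dualm (Dualm f) \<odot> Piv (src f)"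
  using piv_natural[of "mor f" "src f" "tgt f"]
  by (simp add: val_def Piv_def Dualm_def comp_def)

lemma rcf_nat: "\<lbrakk>val f; src f = Y\<rbrakk>
    \<Longrightarrow> (dual C X \<lhd> (X \<lhd> f)) \<odot> rcf X Y = rcf X (tgt f) \<odot> f"
proof -
  assume f: "val f" "src f = Y"
  have "(dual C X \<lhd> (X \<lhd> f)) \<odot> rcf X Y
    = (dual C X \<lhd> ((X \<lhd> f) \<odot> (inva (Piv X) \<rhd> Y))) \<odot> cof (dual C X) Y"
    using f by (simp add: rcf_def)
  also have "\<dots> = (dual C X \<lhd> (inva (Piv X) \<rhd> tgt f)) \<odot> (dual C X \<lhd> (dual C (dual C X) \<lhd> f)) \<odot> cof (dual C X) Y"
    using f slide[of "inva (Piv X)" f _ X Y] by simp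
  also have "\<dots> = rcf X (tgt f) \<odot> f"
    using f by (subst ev.B_nat) (simp_all add: rcf_def)
  finally show ?thesis .
qed

text \<open>Across \<open>cof\<close> of the dual, the transpose of f turns into its double
  transpose, which naturality of the pivot identifies with f. Together with \<open>Dualm_evf\<close>
  this lets f travel around a loop.\<close>

lemma rcf_Dualm:
  assumes f: "val f" "src f = X"
  shows "(dual C X \<lhd> (f \<rhd> Z)) \<odot> rcf X Z = (Dualm f \<rhd> (tgt f \<otimes> Z)) \<odot> rcf (tgt f) Z"
proof -
  let ?Y = "tgt f"
  have i: "f \<odot> inva (Piv X) = inva (Piv ?Y) \<odot> Dualm (Dualm f)"
    using f Piv_nat[of f ?Y] by (subst inva_nat[where a = "Piv X" and f = f]) simp_all
  have "(dual C X \<lhd> (f \<rhd> Z)) \<odot> rcf X Z = (dual C X \<lhd> ((f \<odot> inva (Piv X)) \<rhd> Z)) \<odot> cof (dual C X) Z"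
    using f by (simp add: rcf_def)
  also have "\<dots> = (dual C X \<lhd> (inva (Piv ?Y) \<rhd> Z)) \<odot> (dual C X \<lhd> (Dualm (Dualm f) \<rhd> Z)) \<odot> cof (dual C X) Z"
    unfolding i using f by simp
  also have "\<dots> = (dual C X \<lhd> (inva (Piv ?Y) \<rhd> Z)) \<odot> (Dualm f \<rhd> (dual C (dual C ?Y) \<otimes> Z)) \<odot> cof (dual C ?Y) Z"
    using f by (subst Dualm_cof) simp_all
  also have "\<dots> = (Dualm f \<rhd> (?Y \<otimes> Z)) \<odot> rcf ?Y Z"
    using f slide_assoc[of "Dualm f" "inva (Piv ?Y) \<rhd> Z" "dual C ?Y" "dual C X" _ "?Y \<otimes> Z" "cof (dual C ?Y) Z"]
    by (simp add: rcf_def)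
  finally show ?thesis .
qed

lemma src_Ptr [simp]: "src (Ptr V X Y f) = X" and tgt_Ptr [simp]: "tgt (Ptr V X Y f) = Y"
  and val_Ptr [simp]: "\<lbrakk>val f; src f = V \<otimes> X; tgt f = V \<otimes> Y\<rbrakk> \<Longrightarrow> val (Ptr V X Y f)"
  by (simp_all add: Ptr_def)

text \<open>The bridge to \<open>ptr_left\<close>: its explicit associators are compared with the
  family form here, and later work on traces stays on the family side.\<close>

lemma mor_Ptr:
  assumes "val f" "src f = V \<otimes> X" "tgt f = V \<otimes> Y"
  shows "mor (Ptr V X Y f) = ptr_left C V X Y (mor f)"
proof -
  have r: "rcf V X = Asc (dual C V) V X \<odot> (Arr \<one> (dual C V \<otimes> V) (rev_coev C V) \<rhd> X) \<odot> inva (Lun X)"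
  proof -
    have "Cof (dual C V) V ((dual C V \<lhd> inva (Piv V)) \<odot> Coev (dual C V)) X = rcf V X"
      using Cof_rw_arg[of "Coev (dual C V)" "dual C V" _ "inva (Piv V)" X] by (simp add: rcf_def cof_def)
    then show ?thesis
      by (simp add: Cof_def Coev_def Piv_def rev_coev_def comp_def lw_def inva_def)
  qed
  have m: "rev_coev C V \<in> hom C \<one> (dual C V \<otimes> V)"
  proof -
    have "val ((dual C V \<lhd> inva (Piv V)) \<odot> Coev (dual C V))" by simp
    then show ?thesis by (simp add: Coev_def Piv_def rev_coev_def comp_def lw_def inva_def)
  qed
  have "Ptr V X Y f = Lun Y \<odot> (Ev V \<rhd> Y) \<odot> inva (Asc (dual C V) V Y) \<odot> (dual C V \<lhd> f) \<odot>
    Asc (dual C V) V X \<odot> (Arr \<one> (dual C V \<otimes> V) (rev_coev C V) \<rhd> X) \<odot> inva (Lun X)"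
    using assms m by (simp add: Ptr_def r evf_def Evf_def)
  then show ?thesis
    by (simp add: ptr_left_def comp_def lw_def rw_def Lun_def Asc_def inva_def Ev_def asci_def luni_def)
qed

text \<open>f leaves through the coevaluation as its transpose, passes g by interchange and returns
  through the evaluation on the other side of g.\<close>

lemma Ptr_cyclic:
  assumes f: "val f" "src f = V" "tgt f = V'" and g: "val g" "src g = V' \<otimes> X" "tgt g = V \<otimes> Y"
  shows "Ptr V X Y (g \<odot> (f \<rhd> X)) = Ptr V' X Y ((f \<rhd> Y) \<odot> g)"
proof -
  have "Ptr V X Y (g \<odot> (f \<rhd> X)) = evf V Y \<odot> (dual C V \<lhd> g) \<odot> (dual C V \<lhd> (f \<rhd> X)) \<odot> rcf V X"
    using assms by (simp add: Ptr_def)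
  also have "\<dots> = evf V Y \<odot> ((dual C V \<lhd> g) \<odot> (Dualm f \<rhd> (V' \<otimes> X))) \<odot> rcf V' X"
    using assms by (subst rcf_Dualm) simp_all
  also have "\<dots> = (evf V Y \<odot> (Dualm f \<rhd> (V \<otimes> Y))) \<odot> (dual C V' \<lhd> g) \<odot> rcf V' X"
    using assms slide[of "Dualm f" g "dual C V'" "dual C V" "V' \<otimes> X" "V \<otimes> Y"] by simp
  also have "\<dots> = Ptr V' X Y ((f \<rhd> Y) \<odot> g)"
    using assms by (subst Dualm_evf) (simp_all add: Ptr_def)
  finally show ?thesis .
qed

text \<open>Morphisms that do not touch the loop leave the trace by naturality of the two
  families.\<close>

lemma Ptr_lw:
  assumes "val f" "src f = V \<otimes> X" "tgt f = V \<otimes> Y" "val h" "src h = Y" "tgt h = Y'"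
    "val k" "tgt k = X" "src k = X'"
  shows "Ptr V X' Y' ((V \<lhd> h) \<odot> f \<odot> (V \<lhd> k)) = h \<odot> Ptr V X Y f \<odot> k"
  using assms by (simp add: Ptr_def rcf_nat ev.E_nat_assoc)

text \<open>A strand Z to the right of the loop is a spectator: evaluation and coevaluation families
  are compatible with enlarging their argument by Z.\<close>

lemma Ptr_rw:
  assumes "val f" "src f = V \<otimes> X" "tgt f = V \<otimes> Y"
  shows "Ptr V X Y f \<rhd> Z = Ptr V (X \<otimes> Z) (Y \<otimes> Z) (Asc V Y Z \<odot> (f \<rhd> Z) \<odot> inva (Asc V X Z))"
proof -
  let ?D = "dual C V"
  have r: "(?D \<lhd> Asc V X Z) \<odot> Asc ?D (V \<otimes> X) Z \<odot> (rcf V X \<rhd> Z) = rcf V (X \<otimes> Z)"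
  proof -
    let ?p = "inva (Piv V)"
    have "(?D \<lhd> Asc V X Z) \<odot> Asc ?D (V \<otimes> X) Z \<odot> (rcf V X \<rhd> Z)
       = (?D \<lhd> (Asc V X Z \<odot> ((?p \<rhd> X) \<rhd> Z))) \<odot> Asc ?D (dual C ?D \<otimes> X) Z \<odot> (cof ?D X \<rhd> Z)"
      by (simp add: rcf_def Asc_nat2_assoc)
    also have "\<dots> = (?D \<lhd> (?p \<rhd> (X \<otimes> Z))) \<odot> ((?D \<lhd> Asc (dual C ?D) X Z) \<odot> Asc ?D (dual C ?D \<otimes> X) Z \<odot> (cof ?D X \<rhd> Z))"
      by (subst Asc_nat1) simp_all
    finally show ?thesis unfolding cof_def by (subst (asm) Cof_rw) (simp_all add: rcf_def cof_def)
  qed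
  have "Ptr V X Y f \<rhd> Z = (evf V Y \<rhd> Z) \<odot> ((?D \<lhd> f) \<rhd> Z) \<odot> (rcf V X \<rhd> Z)"
    using assms by (simp add: Ptr_def)
  also have "\<dots> = evf V (Y \<otimes> Z) \<odot> (?D \<lhd> Asc V Y Z) \<odot> (?D \<lhd> (f \<rhd> Z)) \<odot>
      (?D \<lhd> (inva (Asc V X Z) \<odot> Asc V X Z)) \<odot> Asc ?D (V \<otimes> X) Z \<odot> (rcf V X \<rhd> Z)"
    using assms by (simp add: evf_def Evf_rw Asc_nat2_assoc)
  also have "\<dots> = evf V (Y \<otimes> Z) \<odot> (?D \<lhd> Asc V Y Z) \<odot> (?D \<lhd> (f \<rhd> Z)) \<odot>
      (?D \<lhd> inva (Asc V X Z)) \<odot> ((?D \<lhd> Asc V X Z) \<odot> Asc ?D (V \<otimes> X) Z \<odot> (rcf V X \<rhd> Z))"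
    using assms by (simp del: inva_comp inva_comp_assoc)
  also have "\<dots> = Ptr V (X \<otimes> Z) (Y \<otimes> Z) (Asc V Y Z \<odot> (f \<rhd> Z) \<odot> inva (Asc V X Z))"
    unfolding r using assms by (simp add: Ptr_def)
  finally show ?thesis .
qed

definition pevf :: "'o \<Rightarrow> 'o \<Rightarrow> 'o \<Rightarrow> ('o, 'm) arr" where
  "pevf A B Z = evf B Z \<odot> (dual C B \<lhd> evf A (B \<otimes> Z)) \<odot> (dual C B \<lhd> (dual C A \<lhd> Asc A B Z)) \<odot>
     Asc (dual C B) (dual C A) ((A \<otimes> B) \<otimes> Z)"

definition pcof :: "'o \<Rightarrow> 'o \<Rightarrow> 'o \<Rightarrow> ('o, 'm) arr" where
  "pcof A B Z = inva (Asc A B ((dual C B \<otimes> dual C A) \<otimes> Z)) \<odot> (A \<lhd> (B \<lhd> inva (Asc (dual C B) (dual C A) Z))) \<odot>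
     (A \<lhd> cof B (dual C A \<otimes> Z)) \<odot> cof A Z"

sublocale pr: dual_family C "A \<otimes> B" "dual C B \<otimes> dual C A" "pevf A B" "pcof A B" for A B
proof -
  interpret dual_family_pair C A "dual C A" "evf A" "cof A" B "dual C B" "evf B" "cof B" ..
  have "pevf A B = pair_E" "pcof A B = pair_B"
    by (auto simp: fun_eq_iff pevf_def pcof_def pair_E_def pair_B_def)
  with dual_family_pair show "dual_family C (A \<otimes> B) (dual C B \<otimes> dual C A) (pevf A B) (pcof A B)" by simp
qed

definition Dtens :: "'o \<Rightarrow> 'o \<Rightarrow> ('o, 'm) arr" where
  "Dtens A B = Arr (dual C B \<otimes> dual C A) (dual C (A \<otimes> B)) (dual_tens C A B)"

lemma Dtens_Transp: "Dtens A B = Transp (A \<otimes> B) (A \<otimes> B) (dual C (A \<otimes> B)) (dual C B \<otimes> dual C A)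
  (Ev B \<odot> (dual C B \<lhd> evf A B) \<odot> Asc (dual C B) (dual C A) (A \<otimes> B)) (Coev (A \<otimes> B)) (ida (A \<otimes> B))"
proof -
  have "Ev B \<odot> (dual C B \<lhd> evf A B) \<odot> Asc (dual C B) (dual C A) (A \<otimes> B)
    = Ev B \<odot> (dual C B \<lhd> Lun B) \<odot> (dual C B \<lhd> (Ev A \<rhd> B)) \<odot> (dual C B \<lhd> inva (Asc (dual C A) A B)) \<odot>
        Asc (dual C B) (dual C A) (A \<otimes> B)"
    by (simp add: evf_def Evf_def)
  then have "mor (Ev B \<odot> (dual C B \<lhd> evf A B) \<odot> Asc (dual C B) (dual C A) (A \<otimes> B)) =
    ev C B \<cdot> (idm C (dual C B) \<boxtimes> lun C B) \<cdot>
        (idm C (dual C B) \<boxtimes> (ev C A \<boxtimes> idm C B)) \<cdot>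
        (idm C (dual C B) \<boxtimes> asci C (dual C A) A B) \<cdot>
        asc C (dual C B) (dual C A) (A \<otimes> B)"
    by (simp add: comp_def lw_def rw_def Lun_def Asc_def inva_def Ev_def asci_def)
  then show ?thesis by (simp add: Dtens_def dual_tens_def Transp_def Coev_def)
qed

lemma src_Dtens [simp]: "src (Dtens A B) = dual C B \<otimes> dual C A"
  and tgt_Dtens [simp]: "tgt (Dtens A B) = dual C (A \<otimes> B)"
  and val_Dtens [simp]: "val (Dtens A B)"
proof -
  show "val (Dtens A B)" unfolding Dtens_Transp by (rule val_Transp) simp_all
qed (simp_all add: Dtens_def)

lemma Dtens_fam: "Dtens A B \<rhd> Z = pevf A B (dual C (A \<otimes> B) \<otimes> Z) \<odot>
  ((dual C B \<otimes> dual C A) \<lhd> (ida (A \<otimes> B) \<rhd> (dual C (A \<otimes> B) \<otimes> Z))) \<odot> ((dual C B \<otimes> dual C A) \<lhd> cof (A \<otimes> B) Z)"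
proof -
  have p: "pevf A B Y = Evf (dual C B \<otimes> dual C A) (A \<otimes> B)
      (Ev B \<odot> (dual C B \<lhd> evf A B) \<odot> Asc (dual C B) (dual C A) (A \<otimes> B)) Y" for Y
    unfolding pevf_def evf_def by (rule Evf_pair[symmetric]) simp_all
  show ?thesis unfolding p cof_def unfolding Dtens_Transp by (rule Transp_fam(2)) simp_all
qed

text \<open>\<open>Dtens\<close> is the transpose of the identity between two dualities of A (x) B,
  the nested and the chosen one, and so intertwines their evaluations.\<close>

lemma Dtens_evf: "evf (A \<otimes> B) Z \<odot> (Dtens A B \<rhd> ((A \<otimes> B) \<otimes> Z)) = pevf A B Z"
proof -
  interpret dual_family_pair C "A \<otimes> B" "dual C (A \<otimes> B)" "evf (A \<otimes> B)" "cof (A \<otimes> B)"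
    "A \<otimes> B" "dual C B \<otimes> dual C A" "pevf A B" "pcof A B" ..
  show ?thesis using transpose_E[OF _ _ _ _ _ _ Dtens_fam] by simp
qed

lemma Dtens_cof: "((A \<otimes> B) \<lhd> (Dtens A B \<rhd> Z)) \<odot> pcof A B Z = cof (A \<otimes> B) Z"
proof -
  interpret dual_family_pair C "A \<otimes> B" "dual C (A \<otimes> B)" "evf (A \<otimes> B)" "cof (A \<otimes> B)"
    "A \<otimes> B" "dual C B \<otimes> dual C A" "pevf A B" "pcof A B" ..
  show ?thesis using transpose_B[OF _ _ _ _ _ _ Dtens_fam] by simp
qed

text \<open>The arrow composed with \<open>Dtens\<close> is the transpose of the identity in the
  opposite direction, in family form; a zigzag of the nested duality makes the two cancel.\<close>

lemma Dtens_left_inverse: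
  "(evf (A \<otimes> B) ((dual C B \<otimes> dual C A) \<otimes> Z) \<odot> (dual C (A \<otimes> B) \<lhd> pcof A B Z)) \<odot> (Dtens A B \<rhd> Z)
    = ida ((dual C B \<otimes> dual C A) \<otimes> Z)"
proof -
  have "(evf (A \<otimes> B) ((dual C B \<otimes> dual C A) \<otimes> Z) \<odot> (dual C (A \<otimes> B) \<lhd> pcof A B Z)) \<odot> (Dtens A B \<rhd> Z)
    = (evf (A \<otimes> B) ((dual C B \<otimes> dual C A) \<otimes> Z) \<odot> (Dtens A B \<rhd> ((A \<otimes> B) \<otimes> ((dual C B \<otimes> dual C A) \<otimes> Z)))) \<odot>
       ((dual C B \<otimes> dual C A) \<lhd> pcof A B Z)"
    by (simp add: slide[of "Dtens A B" "pcof A B Z" "dual C B \<otimes> dual C A" _ Z])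
  also have "\<dots> = ida ((dual C B \<otimes> dual C A) \<otimes> Z)"
    unfolding Dtens_evf by (rule pr.zz2)
  finally show ?thesis .
qed

lemma Piv_tens: "Dualm (Dtens A B) \<odot> Piv (A \<otimes> B)
  = Dtens (dual C B) (dual C A) \<odot> (Piv A \<rhd> dual C (dual C B)) \<odot> (A \<lhd> Piv B)"
proof -
  have "(piv C A \<boxtimes> idm C (dual C (dual C B))) \<cdot> (idm C A \<boxtimes> piv C B) = piv C A \<boxtimes> piv C B"
    using tensm_cmp[of "idm C A" A A "piv C A" "dual C (dual C A)" "piv C B" B "dual C (dual C B)"
        "idm C (dual C (dual C B))" "dual C (dual C B)"] isoa_val[OF isoa_Piv, unfolded val_def Piv_def]
    by (simp add: idm_hom cmp_idm_left cmp_idm_right)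
  then show ?thesis using piv_tens[where X = A and Y = B]
    by (simp add: Piv_def Dtens_def Dualm_def comp_def lw_def rw_def)
qed

text \<open>\<open>piv_tens\<close> only gives the equation after composition with \<open>Dtens (dual C V) (dual C U)\<close>, which can be cancelled
  by \<open>Dtens_left_inverse\<close>.\<close>

lemma rcf_tens:
  "rcf (U \<otimes> V) X = (Dtens U V \<rhd> ((U \<otimes> V) \<otimes> X)) \<odot>
    ((dual C V \<otimes> dual C U) \<lhd> (((U \<lhd> inva (Piv V)) \<odot> (inva (Piv U) \<rhd> dual C (dual C V))) \<rhd> X)) \<odot>
    pcof (dual C V) (dual C U) X"
proof -
  define W P UU VV where "W = dual C (U \<otimes> V)" and "P = dual C V \<otimes> dual C U"
    and "UU = dual C (dual C U)" and "VV = dual C (dual C V)"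
  define T where "T = Dtens U V"
  define T2 where "T2 = Dtens (dual C V) (dual C U)"
  define pp where "pp = (Piv U \<rhd> VV) \<odot> (U \<lhd> Piv V)"
  define B where "B = pcof (dual C V) (dual C U) X"
  define l where "l = evf P ((UU \<otimes> VV) \<otimes> X) \<odot> (dual C P \<lhd> B)"
  have T [simp]: "val T" "src T = P" "tgt T = W" "val T2" "src T2 = UU \<otimes> VV" "tgt T2 = dual C P"
    and pp [simp]: "isoa pp" "src pp = U \<otimes> V" "tgt pp = UU \<otimes> VV" "tgt (Piv U) = UU" "tgt (Piv V) = VV"
    by (simp_all add: T_def T2_def W_def P_def UU_def VV_def pp_def)
  have [simp]: "val B" "src B = X" "tgt B = P \<otimes> ((UU \<otimes> VV) \<otimes> X)"
    by (simp_all add: B_def P_def UU_def VV_def)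
  have [simp]: "val l" "src l = dual C P \<otimes> X" "tgt l = (UU \<otimes> VV) \<otimes> X"
    by (simp_all add: l_def)
  have ppi: "inva pp = (U \<lhd> inva (Piv V)) \<odot> (inva (Piv U) \<rhd> VV)"
    by (simp add: pp_def VV_def inva_of_comp inva_lw inva_rw)
  have l: "l \<odot> (T2 \<rhd> X) = ida ((UU \<otimes> VV) \<otimes> X)"
    unfolding l_def T2_def P_def B_def UU_def VV_def by (rule Dtens_left_inverse)
  \<comment> \<open>\<open>q\<close> leads from the double dual of U (x) V to the product of the
    double duals by way of the pivots; \<open>piv_tens\<close> says that \<open>Dualm T\<close> is
    \<open>T2\<close> after \<open>q\<close>.\<close>
  define q where "q = pp \<odot> inva (Piv (U \<otimes> V))"
  have q [simp]: "val q" "src q = dual C W" "tgt q = UU \<otimes> VV" "inva pp \<odot> q = inva (Piv (U \<otimes> V))"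
    by (simp_all add: q_def W_def)
  have [simp]: "src (Piv (U \<otimes> V)) = U \<otimes> V" "tgt (Piv (U \<otimes> V)) = dual C W"
    by (simp_all add: W_def)
  have Tq: "Dualm T = T2 \<odot> q"
  proof -
    have "Dualm T = (Dualm T \<odot> Piv (U \<otimes> V)) \<odot> inva (Piv (U \<otimes> V))"
      by (simp add: W_def)
    also have "Dualm T \<odot> Piv (U \<otimes> V) = T2 \<odot> pp"
      using Piv_tens[of U V] by (simp add: T_def T2_def pp_def VV_def)
    finally show ?thesis by (simp add: q_def)
  qed
  have "(W \<lhd> (Dualm T \<rhd> X)) \<odot> cof W X = (T \<rhd> (dual C P \<otimes> X)) \<odot> cof P X"
    by (subst Dualm_cof) simp_all
  also have "cof P X = (P \<lhd> (T2 \<rhd> X)) \<odot> B"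
    unfolding T2_def B_def P_def by (rule Dtens_cof[symmetric])
  \<comment> \<open>Composing with \<open>l\<close> cancels \<open>T2\<close> on both sides, once
    \<open>T\<close> has been moved past it.\<close>
  finally have "(W \<lhd> l) \<odot> (W \<lhd> (T2 \<rhd> X)) \<odot> (W \<lhd> (q \<rhd> X)) \<odot> cof W X
      = (W \<lhd> l) \<odot> (T \<rhd> (dual C P \<otimes> X)) \<odot> (P \<lhd> (T2 \<rhd> X)) \<odot> B"
    by (simp add: Tq)
  also have "\<dots> = (W \<lhd> l) \<odot> (W \<lhd> (T2 \<rhd> X)) \<odot> (T \<rhd> ((UU \<otimes> VV) \<otimes> X)) \<odot> B"
    by (simp add: slide_assoc[of T "T2 \<rhd> X" P W "(UU \<otimes> VV) \<otimes> X" "dual C P \<otimes> X"])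
  finally have "(W \<lhd> (l \<odot> (T2 \<rhd> X))) \<odot> (W \<lhd> (q \<rhd> X)) \<odot> cof W X
      = (W \<lhd> (l \<odot> (T2 \<rhd> X))) \<odot> (T \<rhd> ((UU \<otimes> VV) \<otimes> X)) \<odot> B" by simp
  then have key: "(W \<lhd> (q \<rhd> X)) \<odot> cof W X = (T \<rhd> ((UU \<otimes> VV) \<otimes> X)) \<odot> B"
    unfolding l by simp
  have "rcf (U \<otimes> V) X = (W \<lhd> ((inva pp \<odot> q) \<rhd> X)) \<odot> cof W X"
    unfolding q(4) by (simp add: rcf_def W_def)
  also have "\<dots> = (W \<lhd> (inva pp \<rhd> X)) \<odot> ((W \<lhd> (q \<rhd> X)) \<odot> cof W X)"
    by (simp del: q(4))
  also have "\<dots> = (T \<rhd> ((U \<otimes> V) \<otimes> X)) \<odot> (P \<lhd> (inva pp \<rhd> X)) \<odot> B"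
    unfolding key by (simp add: slide_assoc[of T "inva pp \<rhd> X" P W "(UU \<otimes> VV) \<otimes> X" "(U \<otimes> V) \<otimes> X"])
  finally show ?thesis unfolding ppi T_def P_def B_def VV_def .
qed

text \<open>The comparison \<open>T\<close> produced by \<open>rcf_tens\<close> slides past f and is
  absorbed by the evaluation, which becomes the nested one. The inner pair of the nested duality
  then traces over U, the outer pair over V.\<close>

lemma Ptr_tens:
  assumes f: "val f" "src f = (U \<otimes> V) \<otimes> X" "tgt f = (U \<otimes> V) \<otimes> Y"
  shows "Ptr (U \<otimes> V) X Y f
    = Ptr V X Y (Ptr U (V \<otimes> X) (V \<otimes> Y) (Asc U V Y \<odot> f \<odot> inva (Asc U V X)))"
proof -
  define W P UU VV where "W = dual C (U \<otimes> V)" and "P = dual C V \<otimes> dual C U"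
    and "UU = dual C (dual C U)" and "VV = dual C (dual C V)"
  define T where "T = Dtens U V"
  define pu pv where "pu = inva (Piv U)" and "pv = inva (Piv V)"
  define ii where "ii = (U \<lhd> pv) \<odot> (pu \<rhd> VV)"
  have [simp]: "val T" "src T = P" "tgt T = W" "val pu" "src pu = UU" "tgt pu = U"
     "val pv" "src pv = VV" "tgt pv = V"
    by (simp_all add: T_def W_def P_def UU_def VV_def pu_def pv_def)
  have [simp]: "val ii" "src ii = UU \<otimes> VV" "tgt ii = U \<otimes> V" by (simp_all add: ii_def)
  define B where "B = pcof (dual C V) (dual C U) X"
  have [simp]: "val B" "src B = X" "tgt B = P \<otimes> ((UU \<otimes> VV) \<otimes> X)"
    by (simp_all add: B_def P_def UU_def VV_def)
  define E where "E = evf (U \<otimes> V) Y"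
  have [simp]: "val E" "src E = W \<otimes> ((U \<otimes> V) \<otimes> Y)"
    by (simp_all add: E_def W_def)
  have [simp]: "val (cof (dual C U) Z)" "src (cof (dual C U) Z) = Z" "tgt (cof (dual C U) Z) = dual C U \<otimes> (UU \<otimes> Z)"
    "val (cof (dual C V) Z)" "src (cof (dual C V) Z) = Z" "tgt (cof (dual C V) Z) = dual C V \<otimes> (VV \<otimes> Z)"  for Z
    by (simp_all add: UU_def VV_def)
  have iia: "(ii \<rhd> X) \<odot> inva (Asc UU VV X) = inva (Asc U V X) \<odot> (U \<lhd> (pv \<rhd> X)) \<odot> (pu \<rhd> (VV \<otimes> X))"
  proof -
    have "(ii \<rhd> X) \<odot> inva (Asc UU VV X) = ((U \<lhd> pv) \<rhd> X) \<odot> (inva (Asc U VV X) \<odot> (pu \<rhd> (VV \<otimes> X)))"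
      using Asci_nat1[of pu UU VV X] by (simp add: ii_def)
    also have "\<dots> = (((U \<lhd> pv) \<rhd> X) \<odot> inva (Asc U VV X)) \<odot> (pu \<rhd> (VV \<otimes> X))" by simp
    also have "((U \<lhd> pv) \<rhd> X) \<odot> inva (Asc U VV X) = inva (Asc U V X) \<odot> (U \<lhd> (pv \<rhd> X))"
      using Asci_nat2[of pv VV U X] by simp
    finally show ?thesis by simp
  qed
  have "Ptr (U \<otimes> V) X Y f = E \<odot> (W \<lhd> f) \<odot> (T \<rhd> ((U \<otimes> V) \<otimes> X)) \<odot> (P \<lhd> (ii \<rhd> X)) \<odot>
      B"
    by (simp add: Ptr_def rcf_tens E_def B_def W_def T_def P_def ii_def pu_def pv_def VV_def)
  also have "\<dots> = (E \<odot> (T \<rhd> ((U \<otimes> V) \<otimes> Y))) \<odot> (P \<lhd> f) \<odot> (P \<lhd> (ii \<rhd> X)) \<odot>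
      B"
    using f by (simp add: slide_assoc[of T f P W "(U \<otimes> V) \<otimes> X" "(U \<otimes> V) \<otimes> Y"])
  also have "\<dots> = evf V Y \<odot> (dual C V \<lhd> evf U (V \<otimes> Y)) \<odot> (dual C V \<lhd> (dual C U \<lhd> Asc U V Y)) \<odot>
      (Asc (dual C V) (dual C U) ((U \<otimes> V) \<otimes> Y) \<odot> (P \<lhd> (f \<odot> (ii \<rhd> X)))) \<odot>
      B"
    unfolding E_def T_def Dtens_evf using f by (simp add: pevf_def P_def)
  also have "\<dots> = evf V Y \<odot> (dual C V \<lhd> evf U (V \<otimes> Y)) \<odot> (dual C V \<lhd> (dual C U \<lhd> Asc U V Y)) \<odot>
      ((dual C V \<lhd> (dual C U \<lhd> (f \<odot> (ii \<rhd> X)))) \<odot> Asc (dual C V) (dual C U) ((UU \<otimes> VV) \<otimes> X)) \<odot>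
      B"
    unfolding P_def using f by (subst Asc_nat3) simp_all
  also have "\<dots> = evf V Y \<odot> (dual C V \<lhd> (evf U (V \<otimes> Y) \<odot> (dual C U \<lhd> (Asc U V Y \<odot> f \<odot>
       ((ii \<rhd> X) \<odot> inva (Asc UU VV X)))) \<odot> cof (dual C U) (VV \<otimes> X))) \<odot> cof (dual C V) X"
    using f by (simp add: B_def pcof_def flip: UU_def VV_def)
  also have "\<dots> = evf V Y \<odot> (dual C V \<lhd> (evf U (V \<otimes> Y) \<odot> (dual C U \<lhd> (Asc U V Y \<odot> f \<odot> inva (Asc U V X))) \<odot>
       ((dual C U \<lhd> (U \<lhd> (pv \<rhd> X))) \<odot> rcf U (VV \<otimes> X)))) \<odot> cof (dual C V) X"
    unfolding iia using f by (simp add: rcf_def flip: UU_def pu_def)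
  also have "\<dots> = evf V Y \<odot> (dual C V \<lhd> Ptr U (V \<otimes> X) (V \<otimes> Y) (Asc U V Y \<odot> f \<odot> inva (Asc U V X))) \<odot>
       (dual C V \<lhd> (pv \<rhd> X)) \<odot> cof (dual C V) X"
    using f by (subst rcf_nat) (simp_all add: Ptr_def VV_def)
  also have "(dual C V \<lhd> (pv \<rhd> X)) \<odot> cof (dual C V) X = rcf V X"
    by (simp add: rcf_def pv_def)
  finally show ?thesis by (simp add: Ptr_def[of V])
qed

end

section \<open>Encircling a strand\<close>

context action_category
begin

definition Act :: "'g \<Rightarrow> ('o, 'm) arr \<Rightarrow> ('o, 'm) arr" where
  "Act g f = Arr (act C g (src f)) (act C g (tgt f)) (actm C g (mor f))"

definition ActT :: "'g \<Rightarrow> 'o \<Rightarrow> 'o \<Rightarrow> ('o, 'm) arr" where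
  "ActT g X Y = Arr (act C g X \<otimes> act C g Y) (act C g (X \<otimes> Y)) (act_tens C g X Y)"

definition ActU :: "'g \<Rightarrow> ('o, 'm) arr" where
  "ActU g = Arr \<one> (act C g \<one>) (act_unt C g)"

definition ActC :: "'g \<Rightarrow> 'g \<Rightarrow> 'o \<Rightarrow> ('o, 'm) arr" where
  "ActC g h X = Arr (act C g (act C h X)) (act C (g + h) X) (act_cmp C g h X)"

declare act_zero [simp]

lemma src_Act [simp]: "src (Act g f) = act C g (src f)" and tgt_Act [simp]: "tgt (Act g f) = act C g (tgt f)"
  and val_Act [simp]: "val f \<Longrightarrow> val (Act g f)"
  by (simp_all add: Act_def val_def actm_hom)

lemma src_ActT [simp]: "src (ActT g X Y) = act C g X \<otimes> act C g Y"
  and tgt_ActT [simp]: "tgt (ActT g X Y) = act C g (X \<otimes> Y)"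
  and isoa_ActT [simp]: "isoa (ActT g X Y)"
  and src_ActU [simp]: "src (ActU g) = \<one>" and tgt_ActU [simp]: "tgt (ActU g) = act C g \<one>"
  and isoa_ActU [simp]: "isoa (ActU g)"
  and src_ActC [simp]: "src (ActC g h X) = act C g (act C h X)"
  and tgt_ActC [simp]: "tgt (ActC g h X) = act C (g + h) X"
  and isoa_ActC [simp]: "isoa (ActC g h X)"
  by (simp_all add: ActT_def ActU_def ActC_def isoa_def act_tens_iso act_unt_iso act_cmp_iso)

lemma Act_ida [simp]: "Act g (ida X) = ida (act C g X)"
  by (simp add: Act_def ida_def actm_idm)

lemma Act_comp [simp]: "\<lbrakk>val f; val f'; src f = tgt f'\<rbrakk> \<Longrightarrow> Act g (f \<odot> f') = Act g f \<odot> Act g f'"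
  using actm_cmp[of "mor f" "src f" "tgt f" "mor f'" "src f'" g] by (simp add: Act_def val_def comp_def)

lemma isoa_Act [simp]: "isoa f \<Longrightarrow> isoa (Act g f)" and inva_Act: "isoa f \<Longrightarrow> inva (Act g f) = Act g (inva f)"
  by (rule isoaI_iso[where g = "Act g (inva f)"] isoaI_inva[where g = "Act g (inva f)"]; simp flip: Act_comp)+

lemma Act_zero: "val f \<Longrightarrow> Act 0 f = f"
  by (cases f) (simp add: Act_def val_def actm_zero)

lemma ActT_nat1: "\<lbrakk>val f; tgt f = X\<rbrakk> \<Longrightarrow> ActT g X Y \<odot> (Act g f \<rhd> act C g Y) = Act g (f \<rhd> Y) \<odot> ActT g (src f) Y"
  using act_tens_natural[of "mor f" "src f" "tgt f" "idm C Y" Y Y g]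
  by (simp add: Act_def val_def comp_def rw_def ActT_def actm_idm idm_hom)

lemma ActT_nat2: "\<lbrakk>val f; tgt f = Y\<rbrakk> \<Longrightarrow> ActT g X Y \<odot> (act C g X \<lhd> Act g f) = Act g (X \<lhd> f) \<odot> ActT g X (src f)"
  using act_tens_natural[of "idm C X" X X "mor f" "src f" "tgt f" g]
  by (simp add: Act_def val_def comp_def lw_def ActT_def actm_idm idm_hom)

lemma ActC_nat: "\<lbrakk>val f; tgt f = X\<rbrakk> \<Longrightarrow> ActC g h X \<odot> Act g (Act h f) = Act (g + h) f \<odot> ActC g h (src f)"
  using act_cmp_natural[of "mor f" "src f" "tgt f" g h]
  by (simp add: Act_def val_def comp_def ActC_def)

lemma ActC_assoc: "ActC (g + h) k X \<odot> ActC g h (act C k X) = ActC g (h + k) X \<odot> Act g (ActC h k X)"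
  using act_cmp_assoc[of g h k X] by (simp add: Act_def comp_def ActC_def add.assoc)

lemma ActC_zero_left: "ActC 0 g X = ida (act C g X)"
  by (simp add: ActC_def ida_def act_cmp_zero_left)

end

section \<open>Crossed braidings and loops around a strand of trivial degree\<close>

context equivariant_fusion_category
begin

definition Br :: "'g \<Rightarrow> 'o \<Rightarrow> 'o \<Rightarrow> ('o, 'm) arr" where
  "Br g V W = Arr (V \<otimes> W) (act C g W \<otimes> V) (br C g V W)"

lemma src_Br [simp]: "src (Br g V W) = V \<otimes> W" and tgt_Br [simp]: "tgt (Br g V W) = act C g W \<otimes> V"
  and isoa_Br [simp]: "V \<in> homog C g \<Longrightarrow> isoa (Br g V W)"
  by (simp_all add: Br_def isoa_def br_iso)

lemma Br_nat1: "\<lbrakk>val f; tgt f = V; V \<in> homog C g; src f \<in> homog C g\<rbrakk>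
    \<Longrightarrow> Br g V W \<odot> (f \<rhd> W) = (act C g W \<lhd> f) \<odot> Br g (src f) W"
  using br_natural[of "src f" g "tgt f" "mor f" "idm C W" W W]
  by (simp add: val_def comp_def lw_def rw_def Br_def actm_idm idm_hom)

lemma Br_nat2: "\<lbrakk>val f; tgt f = W; V \<in> homog C g\<rbrakk>
    \<Longrightarrow> Br g V W \<odot> (V \<lhd> f) = (Act g f \<rhd> V) \<odot> Br g V (src f)"
  using br_natural[of V g V "idm C V" "mor f" "src f" "tgt f"]
  by (simp add: val_def comp_def lw_def rw_def Br_def Act_def idm_hom)

lemma Br_tens_right: "V \<in> homog C g \<Longrightarrow> Br g V (X \<otimes> Y)
    = (ActT g X Y \<rhd> V) \<odot> inva (Asc (act C g X) (act C g Y) V) \<odot>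
      (act C g X \<lhd> Br g V Y) \<odot> Asc (act C g X) V Y \<odot> (Br g V X \<rhd> Y) \<odot> inva (Asc V X Y)"
  by (simp add: Br_def br_tens_right comp_def lw_def rw_def inva_def ActT_def Asc_def asci_def)

lemma Br_tens_left: "\<lbrakk>U \<in> homog C g; V \<in> homog C h\<rbrakk> \<Longrightarrow> Br (g + h) (U \<otimes> V) X
    = (ActC g h X \<rhd> (U \<otimes> V)) \<odot> Asc (act C g (act C h X)) U V \<odot>
      (Br g U (act C h X) \<rhd> V) \<odot> inva (Asc U (act C h X) V) \<odot> (U \<lhd> Br h V X) \<odot> Asc U V X"
  by (simp add: Br_def br_tens_left comp_def lw_def rw_def inva_def ActC_def Asc_def asci_def)

text \<open>The crossing of V with the outgoing strand R_{h^-1} K; the compositor R_h R_{h^-1} K ->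
  K brings its target to K (x) V, as in \<open>encircle\<close>.\<close>

definition Bra :: "'g \<Rightarrow> 'o \<Rightarrow> 'o \<Rightarrow> ('o, 'm) arr" where
  "Bra h V K = (ActC h (- h) K \<rhd> V) \<odot> Br h V (act C (- h) K)"

text \<open>Both inverse crossings of the loop, for a strand K of degree 0, whose braiding leaves V
  unchanged.\<close>

definition Gam :: "'g \<Rightarrow> 'o \<Rightarrow> 'o \<Rightarrow> ('o, 'm) arr" where
  "Gam h V K = inva (Bra h V K) \<odot> inva (Br 0 K V)"

definition Enc :: "'g \<Rightarrow> 'o \<Rightarrow> 'o \<Rightarrow> ('o, 'm) arr \<Rightarrow> ('o, 'm) arr" where
  "Enc h V K f = Ptr V K (act C (- h) K) (Gam h V K \<odot> (f \<rhd> K))"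

lemma src_Bra [simp]: "src (Bra h V K) = V \<otimes> act C (- h) K"
  and tgt_Bra [simp]: "tgt (Bra h V K) = K \<otimes> V"
  and isoa_Bra [simp]: "V \<in> homog C h \<Longrightarrow> isoa (Bra h V K)"
  by (simp_all add: Bra_def)

lemma src_Gam [simp]: "src (Gam h V K) = V \<otimes> K" and tgt_Gam [simp]: "tgt (Gam h V K) = V \<otimes> act C (- h) K"
  and val_Gam [simp]: "\<lbrakk>V \<in> homog C h; K \<in> homog C 0\<rbrakk> \<Longrightarrow> val (Gam h V K)"
  by (simp_all add: Gam_def)

lemma src_Enc [simp]: "src (Enc h V K f) = K" and tgt_Enc [simp]: "tgt (Enc h V K f) = act C (- h) K"
  and val_Enc [simp]: "\<lbrakk>V \<in> homog C h; K \<in> homog C 0; val f; src f = V; tgt f = V\<rbrakk> \<Longrightarrow> val (Enc h V K f)"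
  by (simp_all add: Enc_def)

lemma mor_Enc:
  assumes "V \<in> homog C h" "K \<in> homog C 0" "val f" "src f = V" "tgt f = V"
  shows "mor (Enc h V K f) = encircle C 0 h V K (mor f)"
proof -
  have "mor (Enc h V K f) = ptr_left C V K (act C (- h) K) (mor (Gam h V K \<odot> (f \<rhd> K)))"
    unfolding Enc_def by (rule mor_Ptr) (use assms in simp_all)
  also have "mor (Gam h V K \<odot> (f \<rhd> K)) = mor (inva (Bra h V K) \<odot> inva (Br 0 K V) \<odot> (f \<rhd> K))"
    using assms by (simp add: Gam_def)
  finally show ?thesis
    by (simp add: encircle_def comp_def Bra_def inva_def Br_def ActC_def rw_def)
qed

lemma Bra_nat:
  assumes "val f" "src f = V" "tgt f = V'" "V \<in> homog C h" "V' \<in> homog C h"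
  shows "Bra h V' K \<odot> (f \<rhd> act C (- h) K) = (K \<lhd> f) \<odot> Bra h V K"
proof -
  have "Bra h V' K \<odot> (f \<rhd> act C (- h) K) =
     ((ActC h (- h) K \<rhd> V') \<odot> (act C h (act C (- h) K) \<lhd> f)) \<odot> Br h V (act C (- h) K)"
    using assms by (simp add: Bra_def Br_nat1)
  also have "(ActC h (- h) K \<rhd> V') \<odot> (act C h (act C (- h) K) \<lhd> f) = (K \<lhd> f) \<odot> (ActC h (- h) K \<rhd> V)"
    by (rule slide[symmetric]) (use assms in simp_all)
  also have "((K \<lhd> f) \<odot> (ActC h (- h) K \<rhd> V)) \<odot> Br h V (act C (- h) K) = (K \<lhd> f) \<odot> Bra h V K"
    using assms by (simp add: Bra_def)
  finally show ?thesis .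
qed

text \<open>Both crossings are natural in V, and in degree 0 the action on f disappears.\<close>

lemma Gam_nat:
  assumes f: "val f" "src f = V" "tgt f = V'" "V \<in> homog C h" "V' \<in> homog C h" "K \<in> homog C 0"
  shows "Gam h V' K \<odot> (f \<rhd> K) = (f \<rhd> act C (- h) K) \<odot> Gam h V K"
proof -
  have 1: "inva (Br 0 K V') \<odot> (f \<rhd> K) = (K \<lhd> f) \<odot> inva (Br 0 K V)"
    using f Br_nat2[of f V' K 0] by (intro inva_nat) (simp_all add: Act_zero)
  have 2: "inva (Bra h V' K) \<odot> (K \<lhd> f) = (f \<rhd> act C (- h) K) \<odot> inva (Bra h V K)"
    using f by (intro inva_nat) (simp_all add: Bra_nat)
  have "Gam h V' K \<odot> (f \<rhd> K) = inva (Bra h V' K) \<odot> (inva (Br 0 K V') \<odot> (f \<rhd> K))"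
    using f by (simp add: Gam_def)
  also have "\<dots> = (inva (Bra h V' K) \<odot> (K \<lhd> f)) \<odot> inva (Br 0 K V)"
    unfolding 1 using f by simp
  also have "\<dots> = (f \<rhd> act C (- h) K) \<odot> Gam h V K"
    unfolding 2 using f by (simp add: Gam_def)
  finally show ?thesis .
qed

text \<open>q slides through both crossings by \<open>Gam_nat\<close> and then around the trace by
  \<open>Ptr_cyclic\<close>.\<close>

lemma Enc_cyclic:
  assumes "val p" "src p = V" "tgt p = X" "val q" "src q = X" "tgt q = V"
    "V \<in> homog C h" "X \<in> homog C h" "K \<in> homog C 0"
  shows "Enc h V K (q \<odot> p) = Enc h X K (p \<odot> q)"
proof -
  let ?L = "act C (- h) K"
  have "Enc h V K (q \<odot> p) = Ptr V K ?L ((Gam h V K \<odot> (q \<rhd> K)) \<odot> (p \<rhd> K))"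
    using assms by (simp add: Enc_def)
  also have "\<dots> = Ptr V K ?L (((q \<rhd> ?L) \<odot> Gam h X K) \<odot> (p \<rhd> K))"
    by (subst Gam_nat[where f = q and V = X]) (use assms in simp_all)
  also have "\<dots> = Ptr X K ?L ((p \<rhd> ?L) \<odot> (q \<rhd> ?L) \<odot> Gam h X K)"
    by (subst Ptr_cyclic) (use assms in simp_all)
  also have "\<dots> = Ptr X K ?L (((p \<odot> q) \<rhd> ?L) \<odot> Gam h X K)"
    using assms by simp
  also have "\<dots> = Enc h X K (p \<odot> q)"
    unfolding Enc_def by (subst Gam_nat[where V = X]) (use assms in simp_all)
  finally show ?thesis .
qed

text \<open>The two hexagon axioms split each crossing with U (x) V into one with U and one with V.
  The crossings with U meet in the middle and form \<open>Gam h1 U K\<close>, whiskered by V; those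
  with V stay outside.\<close>

lemma Gam_tens:
  assumes U: "U \<in> homog C h1" and V: "V \<in> homog C h2" and K: "K \<in> homog C 0"
  defines "X \<equiv> act C (- (h1 + h2)) K" and "k \<equiv> ActC h2 (- (h1 + h2)) K"
  shows "Gam (h1 + h2) (U \<otimes> V) K = inva (Asc U V X) \<odot> (U \<lhd> (inva (Br h2 V X) \<odot> (inva k \<rhd> V))) \<odot>
    (Asc U (act C (- h1) K) V \<odot> (Gam h1 U K \<rhd> V) \<odot> inva (Asc U K V)) \<odot> (U \<lhd> inva (Br 0 K V)) \<odot> Asc U V K"
proof -
  note [simp] = U V K
  have k [simp]: "isoa k" "src k = act C h2 X" "tgt k = act C (- h1) K"
    by (simp_all add: k_def X_def minus_add add_diff_eq)
  have UV: "U \<otimes> V \<in> homog C (h1 + h2)" by (simp add: homog_tens)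
  \<comment> \<open>Two ways of identifying R_h1 R_h2 X with K agree by associativity of the
    compositors; the second one turns the crossing with U into \<open>Bra h1 U K\<close>.\<close>
  define a where "a = ActC (h1 + h2) (- (h1 + h2)) K \<odot> ActC h1 h2 X"
  have a: "a = ActC h1 (- h1) K \<odot> Act h1 k"
    using ActC_assoc[of h1 h2 "- (h1 + h2)" K] by (simp add: a_def k_def X_def minus_add add_diff_eq)
  have [simp]: "val a" "src a = act C h1 (act C h2 X)" "tgt a = K"
    by (simp_all add: a_def X_def)
  have Fi: "(a \<rhd> U) \<odot> Br h1 U (act C h2 X) = Bra h1 U K \<odot> (U \<lhd> k)"
  proof -
    have "(a \<rhd> U) \<odot> Br h1 U (act C h2 X) = (ActC h1 (- h1) K \<rhd> U) \<odot> ((Act h1 k \<rhd> U) \<odot> Br h1 U (act C h2 X))"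
      by (simp add: a)
    also have "(Act h1 k \<rhd> U) \<odot> Br h1 U (act C h2 X) = Br h1 U (act C (- h1) K) \<odot> (U \<lhd> k)"
      using Br_nat2[of k "act C (- h1) K" U h1] by simp
    finally show ?thesis by (simp add: Bra_def)
  qed
  have F: "Bra (h1 + h2) (U \<otimes> V) K = Asc K U V \<odot> (Bra h1 U K \<rhd> V) \<odot> ((U \<lhd> k) \<rhd> V) \<odot> inva (Asc U (act C h2 X) V) \<odot>
      (U \<lhd> Br h2 V X) \<odot> Asc U V X"
  proof -
    have "Bra (h1 + h2) (U \<otimes> V) K = ((a \<rhd> (U \<otimes> V)) \<odot> Asc (act C h1 (act C h2 X)) U V) \<odot>
      (Br h1 U (act C h2 X) \<rhd> V) \<odot> inva (Asc U (act C h2 X) V) \<odot> (U \<lhd> Br h2 V X) \<odot> Asc U V X"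
      by (simp add: Bra_def Br_tens_left a_def flip: X_def)
    also have "(a \<rhd> (U \<otimes> V)) \<odot> Asc (act C h1 (act C h2 X)) U V = Asc K U V \<odot> ((a \<rhd> U) \<rhd> V)"
      by (subst Asc_nat1) simp_all
    also have "(Asc K U V \<odot> ((a \<rhd> U) \<rhd> V)) \<odot>
      (Br h1 U (act C h2 X) \<rhd> V) \<odot> inva (Asc U (act C h2 X) V) \<odot> (U \<lhd> Br h2 V X) \<odot> Asc U V X
      = Asc K U V \<odot> (((a \<rhd> U) \<odot> Br h1 U (act C h2 X)) \<rhd> V) \<odot> inva (Asc U (act C h2 X) V) \<odot> (U \<lhd> Br h2 V X) \<odot> Asc U V X"
      by simp
    finally show ?thesis unfolding Fi by simp
  qed
  have "inva (Bra (h1 + h2) (U \<otimes> V) K) = inva (Asc U V X) \<odot> (U \<lhd> inva (Br h2 V X)) \<odot>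
      (Asc U (act C h2 X) V \<odot> ((U \<lhd> inva k) \<rhd> V)) \<odot> (inva (Bra h1 U K) \<rhd> V) \<odot> inva (Asc K U V)"
    unfolding F by (simp add: inva_of_comp inva_lw inva_rw X_def)
  also have "Asc U (act C h2 X) V \<odot> ((U \<lhd> inva k) \<rhd> V) = (U \<lhd> (inva k \<rhd> V)) \<odot> Asc U (act C (- h1) K) V"
    by (subst Asc_nat2) simp_all
  finally have 1: "inva (Bra (h1 + h2) (U \<otimes> V) K) = inva (Asc U V X) \<odot> (U \<lhd> inva (Br h2 V X)) \<odot>
      (U \<lhd> (inva k \<rhd> V)) \<odot> Asc U (act C (- h1) K) V \<odot> (inva (Bra h1 U K) \<rhd> V) \<odot> inva (Asc K U V)"
    by simp
  have "ActT 0 U V = ida (U \<otimes> V)" by (simp add: ActT_def ida_def act_tens_zero)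
  then have "Br 0 K (U \<otimes> V) = inva (Asc U V K) \<odot> (U \<lhd> Br 0 K V) \<odot> Asc U K V \<odot> (Br 0 K U \<rhd> V) \<odot> inva (Asc K U V)"
    by (simp add: Br_tens_right)
  then have 2: "inva (Br 0 K (U \<otimes> V)) = Asc K U V \<odot> (inva (Br 0 K U) \<rhd> V) \<odot> inva (Asc U K V) \<odot>
      (U \<lhd> inva (Br 0 K V)) \<odot> Asc U V K"
    by (simp add: inva_of_comp inva_lw inva_rw)
  show ?thesis unfolding Gam_def[of "h1 + h2"] 1 2 by (simp add: Gam_def)
qed

text \<open>After \<open>Ptr_tens\<close>, \<open>Ptr_lw\<close> takes the crossings with V out of
  the trace over U and \<open>Ptr_rw\<close> removes the spectator V, so that this trace acts on the
  middle bracket of \<open>Gam_tens\<close> alone.\<close>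

lemma Enc_tens:
  assumes U: "U \<in> homog C h1" and V: "V \<in> homog C h2" and K: "K \<in> homog C 0"
  shows "Enc (h1 + h2) (U \<otimes> V) K (ida (U \<otimes> V))
    = ActC (- h2) (- h1) K \<odot> Act (- h2) (Enc h1 U K (ida U)) \<odot> Enc h2 V K (ida V)"
proof -
  note [simp] = U V K
  define X where "X = act C (- (h1 + h2)) K"
  define k where "k = ActC h2 (- (h1 + h2)) K"
  define e where "e = Enc h1 U K (ida U)"
  \<comment> \<open>R_{h2^-1}(e) with its target identified with X: the form that e takes beyond the
    crossing with V.\<close>
  define e' where "e' = ActC (- h2) (- h1) K \<odot> Act (- h2) e"
  have k [simp]: "isoa k" "src k = act C h2 X" "tgt k = act C (- h1) K"
    by (simp_all add: k_def X_def minus_add add_diff_eq)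
  have e [simp]: "val e" "src e = K" "tgt e = act C (- h1) K"
    by (simp_all add: e_def)
  have e' [simp]: "val e'" "src e' = act C (- h2) K" "tgt e' = X"
    by (simp_all add: e'_def X_def minus_add)
  have UV: "U \<otimes> V \<in> homog C (h1 + h2)" by (simp add: homog_tens)
  \<comment> \<open>R_h2 undoes R_{h2^-1} up to compositors, by their naturality and associativity;
    this is what sliding e through the crossing with V requires.\<close>
  have "k \<odot> Act h2 e' = e \<odot> ActC h2 (- h2) K"
  proof -
    have "k \<odot> Act h2 (ActC (- h2) (- h1) K) = ActC h2 (- h2) (act C (- h1) K)"
      using ActC_assoc[of h2 "- h2" "- h1" K] by (simp add: k_def minus_add ActC_zero_left)
    moreover have "k \<odot> Act h2 e' = (k \<odot> Act h2 (ActC (- h2) (- h1) K)) \<odot> Act h2 (Act (- h2) e)"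
      by (simp add: e'_def X_def minus_add)
    ultimately show ?thesis
      using ActC_nat[of e "act C (- h1) K" h2 "- h2"] by (simp add: Act_zero)
  qed
  then have "inva k \<odot> e \<odot> ActC h2 (- h2) K = inva k \<odot> k \<odot> Act h2 e'" by simp
  then have ee: "(inva k \<odot> e) \<odot> ActC h2 (- h2) K = Act h2 e'" by simp
  have Bn: "inva (Br h2 V X) \<odot> ((inva k \<odot> e) \<rhd> V) = (V \<lhd> e') \<odot> inva (Bra h2 V K)"
  proof (rule inva_nat)
    have "((inva k \<odot> e) \<rhd> V) \<odot> Bra h2 V K = (((inva k \<odot> e) \<odot> ActC h2 (- h2) K) \<rhd> V) \<odot> Br h2 V (act C (- h2) K)"
      by (simp add: Bra_def)
    also have "\<dots> = Br h2 V X \<odot> (V \<lhd> e')"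
      unfolding ee by (subst Br_nat2) simp_all
    finally show "Br h2 V X \<odot> (V \<lhd> e') = ((inva k \<odot> e) \<rhd> V) \<odot> Bra h2 V K" by simp
  qed simp_all
  let ?H = "Asc U (act C (- h1) K) V \<odot> (Gam h1 U K \<rhd> V) \<odot> inva (Asc U K V)"
  let ?l = "inva (Br h2 V X) \<odot> (inva k \<rhd> V)"
  let ?r = "inva (Br 0 K V)"
  have G: "Gam (h1 + h2) (U \<otimes> V) K = inva (Asc U V X) \<odot> (U \<lhd> ?l) \<odot> ?H \<odot> (U \<lhd> ?r) \<odot> Asc U V K"
    unfolding X_def k_def by (rule Gam_tens[OF U V K])
  have "Enc (h1 + h2) (U \<otimes> V) K (ida (U \<otimes> V)) = Ptr (U \<otimes> V) K X (Gam (h1 + h2) (U \<otimes> V) K)"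
    by (simp add: Enc_def X_def UV)
  also have "\<dots> = Ptr V K X (Ptr U (V \<otimes> K) (V \<otimes> X) (Asc U V X \<odot> Gam (h1 + h2) (U \<otimes> V) K \<odot> inva (Asc U V K)))"
    by (rule Ptr_tens) (simp_all add: X_def UV)
  also have "Asc U V X \<odot> Gam (h1 + h2) (U \<otimes> V) K \<odot> inva (Asc U V K) = (U \<lhd> ?l) \<odot> ?H \<odot> (U \<lhd> ?r)"
    unfolding G by simp
  also have "Ptr U (V \<otimes> K) (V \<otimes> X) ((U \<lhd> ?l) \<odot> ?H \<odot> (U \<lhd> ?r)) = ?l \<odot> Ptr U (K \<otimes> V) (act C (- h1) K \<otimes> V) ?H \<odot> ?r"
    by (rule Ptr_lw) simp_all
  also have "Ptr U (K \<otimes> V) (act C (- h1) K \<otimes> V) ?H = e \<rhd> V"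
    by (subst Ptr_rw[symmetric]) (simp_all add: e_def Enc_def)
  also have "?l \<odot> (e \<rhd> V) \<odot> ?r = (inva (Br h2 V X) \<odot> ((inva k \<odot> e) \<rhd> V)) \<odot> ?r" by simp
  also have "\<dots> = (V \<lhd> e') \<odot> Gam h2 V K \<odot> (V \<lhd> ida K)"
    unfolding Bn by (simp add: Gam_def)
  also have "Ptr V K X \<dots> = e' \<odot> Ptr V K (act C (- h2) K) (Gam h2 V K) \<odot> ida K"
    by (rule Ptr_lw) simp_all
  finally show ?thesis by (simp add: Enc_def e'_def e_def)
qed

end

section \<open>Schur's lemma and decompositions\<close>

context linear_category
begin

lemma hom_zero [simp]: "0 \<in> hom C X Y"
  and hom_add: "\<lbrakk>f \<in> hom C X Y; g \<in> hom C X Y\<rbrakk> \<Longrightarrow> f + g \<in> hom C X Y"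
  and hom_diff: "\<lbrakk>f \<in> hom C X Y; g \<in> hom C X Y\<rbrakk> \<Longrightarrow> f - g \<in> hom C X Y"
  and hom_scl: "f \<in> hom C X Y \<Longrightarrow> scl C c f \<in> hom C X Y"
  and hom_sum: "(\<And>a. a \<in> A \<Longrightarrow> F a \<in> hom C X Y) \<Longrightarrow> (\<Sum>a\<in>A. F a) \<in> hom C X Y"
  using hom_subspace[of X Y] by (auto intro: subspace_0 subspace_add subspace_diff subspace_scale subspace_sum)

lemma cmp_zero_left: "g \<in> hom C X Y \<Longrightarrow> 0 \<cdot> g = 0"
  using cmp_scl_left[of 0 Y Y g X 0] by simp

lemma cmp_zero_right: "f \<in> hom C Y Z \<Longrightarrow> f \<cdot> 0 = 0"
  using cmp_scl_right[of f Y Z 0 Y 0] by simp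

lemma cmp_sum_left: "\<lbrakk>\<And>a. a \<in> A \<Longrightarrow> F a \<in> hom C Y Z; g \<in> hom C X Y\<rbrakk> \<Longrightarrow> (\<Sum>a\<in>A. F a) \<cdot> g = (\<Sum>a\<in>A. F a \<cdot> g)"
proof (induction A rule: infinite_finite_induct)
  case (insert x A)
  then have "(F x + (\<Sum>a\<in>A. F a)) \<cdot> g = F x \<cdot> g + (\<Sum>a\<in>A. F a) \<cdot> g"
    by (intro cmp_add_left[where Y = Y and Z = Z and X = X] hom_sum) auto
  with insert show ?case by simp
qed (auto simp: cmp_zero_left)

lemma cmp_sum_right: "\<lbrakk>f \<in> hom C Y Z; \<And>a. a \<in> A \<Longrightarrow> F a \<in> hom C X Y\<rbrakk> \<Longrightarrow> f \<cdot> (\<Sum>a\<in>A. F a) = (\<Sum>a\<in>A. f \<cdot> F a)"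
proof (induction A rule: infinite_finite_induct)
  case (insert x A)
  then have "f \<cdot> (F x + (\<Sum>a\<in>A. F a)) = f \<cdot> F x + f \<cdot> (\<Sum>a\<in>A. F a)"
    by (intro cmp_add_right[where Y = Y and Z = Z and X = X] hom_sum) auto
  with insert show ?case by simp
qed (auto simp: cmp_zero_right)

lemma cmp_diff_right: "\<lbrakk>f \<in> hom C Y Z; g \<in> hom C X Y; h \<in> hom C X Y\<rbrakk> \<Longrightarrow> f \<cdot> (g - h) = f \<cdot> g - f \<cdot> h"
  using cmp_add_right[of f Y Z "g - h" X h] by (simp add: hom_diff)

lemma isoD:
  assumes "iso C X Y f"
  shows iso_hom: "f \<in> hom C X Y" and minv_hom: "minv C X Y f \<in> hom C Y X"
    and minv_cmp: "minv C X Y f \<cdot> f = idm C X" and cmp_minv: "f \<cdot> minv C X Y f = idm C Y"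
  using minv_inverse[OF assms] by (auto simp: inverse_mor_def)

lemma iso_sym: "iso C X Y f \<Longrightarrow> iso C Y X (minv C X Y f)"
  using minv_inverse[of X Y f] unfolding iso_def inverse_mor_def by blast

lemma iso_idm: "iso C X X (idm C X)"
  unfolding iso_def inverse_mor_def using idm_hom cmp_idm_left[OF idm_hom] by blast

lemma iso_cmp:
  assumes f: "iso C Y Z f" and g: "iso C X Y g"
  shows "iso C X Z (f \<cdot> g)"
proof -
  have "isoa (Arr Y Z f \<odot> Arr X Y g)" using f g by (intro isoa_comp) (simp_all add: isoa_def)
  then show ?thesis by (simp add: isoa_def comp_def)
qed

lemma isomorphic_sym: "isomorphic C X Y \<Longrightarrow> isomorphic C Y X"
  unfolding isomorphic_def using iso_sym by blast

lemma isomorphic_refl: "isomorphic C X X"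
  unfolding isomorphic_def using iso_idm by blast

text \<open>The value p(f) in the endomorphism algebra of X, by Horner's rule.\<close>

definition poly_end :: "'o \<Rightarrow> 'm \<Rightarrow> complex poly \<Rightarrow> 'm" where
  "poly_end X f p = fold_coeffs (\<lambda>a g. scl C a (idm C X) + f \<cdot> g) p 0"

context
  fixes X :: 'o and f :: 'm
  assumes f: "f \<in> hom C X X"
begin

lemma poly_end_0 [simp]: "poly_end X f 0 = 0"
  by (simp add: poly_end_def)

lemma poly_end_pCons: "poly_end X f (pCons a p) = scl C a (idm C X) + f \<cdot> poly_end X f p"
  using f by (cases "p = 0 \<and> a = 0") (auto simp: poly_end_def cmp_zero_right)

lemma poly_end_hom: "poly_end X f p \<in> hom C X X"
  by (induction p) (auto simp: poly_end_pCons intro!: hom_add hom_scl idm_hom cmp_hom[OF f])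

lemma poly_end_add: "poly_end X f (p + q) = poly_end X f p + poly_end X f q"
  by (induction p q rule: poly_induct2)
    (auto simp: poly_end_pCons scale_left_distrib cmp_add_right[OF f poly_end_hom poly_end_hom])

lemma poly_end_smult: "poly_end X f (smult c p) = scl C c (poly_end X f p)"
  by (induction p) (auto simp: poly_end_pCons scale_right_distrib cmp_scl_right[OF f poly_end_hom])

lemma poly_end_sum: "poly_end X f (\<Sum>a\<in>A. F a) = (\<Sum>a\<in>A. poly_end X f (F a))"
  by (induction A rule: infinite_finite_induct) (auto simp: poly_end_add)

lemma poly_end_linear_factor: "poly_end X f ([:- t, 1:] * q) = (f - scl C t (idm C X)) \<cdot> poly_end X f q"
proof -
  have "poly_end X f ([:- t, 1:] * q) = scl C (- t) (poly_end X f q) + f \<cdot> poly_end X f q"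
  proof -
    have "[:- t, 1:] * q = smult (- t) q + pCons 0 q" by simp
    then show ?thesis by (simp only: poly_end_add poly_end_smult poly_end_pCons) simp
  qed
  also have "f \<cdot> poly_end X f q = ((f - scl C t (idm C X)) + scl C t (idm C X)) \<cdot> poly_end X f q" by simp
  also have "\<dots> = (f - scl C t (idm C X)) \<cdot> poly_end X f q + scl C t (idm C X) \<cdot> poly_end X f q"
    by (rule cmp_add_left) (auto intro!: hom_diff f hom_scl idm_hom poly_end_hom)
  also have "scl C t (idm C X) \<cdot> poly_end X f q = scl C t (poly_end X f q)"
    using cmp_scl_left[OF idm_hom poly_end_hom] cmp_idm_left[OF poly_end_hom] by simp
  finally show ?thesis by (simp add: scale_minus_left)
qed

text \<open>The infinitely many powers of f lie in a finite-dimensional space, which forces a linear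
  relation between them.\<close>

lemma poly_end_annihilator:
  assumes "finite B" "hom C X X = span B"
  shows "\<exists>p. p \<noteq> 0 \<and> poly_end X f p = 0"
\<comment> \<open>Linear dependence is a property of the set of powers, so a coincidence of two
  powers is a separate case; there p is the difference of two monomials.\<close>
proof (cases "inj (\<lambda>i. poly_end X f (monom 1 i))")
  case False
  then obtain i j where "i \<noteq> j" "poly_end X f (monom 1 i) = poly_end X f (monom 1 j)" by (auto simp: inj_def)
  then have "poly_end X f (monom 1 i + smult (-1) (monom 1 j)) = 0"
    by (simp only: poly_end_add poly_end_smult scale_minus_left scale_one) simp
  moreover have "monom 1 i + smult (-1) (monom 1 j) \<noteq> (0 :: complex poly)"
    using \<open>i \<noteq> j\<close> by (metis add_eq_0_iff coeff_monom smult_1_left smult_minus_left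
        minus_minus zero_neq_one)
  ultimately show ?thesis by blast
next
  case True
  let ?m = "\<lambda>i. poly_end X f (monom 1 i)"
  have "infinite (range ?m)" using True by (simp add: finite_image_iff)
  moreover have "range ?m \<subseteq> span B" using poly_end_hom assms by auto
  ultimately have "dependent (range ?m)" using independent_span_bound[OF assms(1)] by blast
  then obtain S u v where S: "finite S" "S \<subseteq> range ?m" "(\<Sum>v\<in>S. scl C (u v) v) = 0" "v \<in> S" "u v \<noteq> 0"
    unfolding dependent_explicit by blast
  obtain A where A: "S = ?m ` A" "finite A" using S(1,2) True
    by (metis finite_subset_image)
  \<comment> \<open>The relation between the powers, reindexed by exponents; injectivity makes its
    coefficients those of p.\<close>
  define p where "p = (\<Sum>i\<in>A. smult (u (?m i)) (monom 1 i))"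
  have "poly_end X f p = (\<Sum>i\<in>A. scl C (u (?m i)) (?m i))" by (simp add: p_def poly_end_sum poly_end_smult)
  also have "\<dots> = (\<Sum>v\<in>S. scl C (u v) v)" unfolding A(1)
    by (subst sum.reindex) (use True in \<open>auto simp: inj_def inj_on_def\<close>)
  finally have 0: "poly_end X f p = 0" using S(3) by simp
  obtain j where j: "j \<in> A" "v = ?m j" using S(4) A(1) by auto
  have "coeff p j = (\<Sum>i\<in>A. if i = j then u (?m i) else 0)"
    by (auto simp: p_def coeff_sum intro!: sum.cong)
  then have "coeff p j = u v" using j A by simp
  then show ?thesis using 0 S(5) by (metis coeff_0)
qed

end

end

section \<open>Schur's lemma\<close>

context abelian_category
begin

text \<open>The kernel of f is a monomorphism into the simple X and cannot be an isomorphism, as f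
  is nonzero. Hence it is zero, f is a monomorphism into the simple Y, and simplicity of Y makes it
  invertible.\<close>

lemma Schur_iso:
  assumes X: "simple C X" and Y: "simple C Y" and f: "f \<in> hom C X Y" "f \<noteq> 0"
  shows "iso C X Y f"
proof -
  obtain K k where k: "is_kernel C X Y f K k" using kernels[OF f(1)] by blast
  then have kh: "k \<in> hom C K X" "f \<cdot> k = 0" by (auto simp: is_kernel_def)
  have fac: "\<exists>!u. u \<in> hom C W K \<and> k \<cdot> u = h" if "h \<in> hom C W X" "f \<cdot> h = 0" for W h
    using k that unfolding is_kernel_def by blast
  have "mono_mor C K X k"
    unfolding mono_mor_def
  proof (intro conjI allI ballI impI)
    fix W g h assume gh: "g \<in> hom C W K" "h \<in> hom C W K" "k \<cdot> g = k \<cdot> h"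
    have "f \<cdot> (k \<cdot> g) = 0" using cmp_assoc[OF f(1) kh(1) gh(1)] kh(2) cmp_zero_left[OF gh(1)] by simp
    from fac[OF cmp_hom[OF kh(1) gh(1)] this] gh show "g = h" by metis
  qed (fact kh)
  then have "k = 0 \<or> iso C K X k" using X unfolding simple_def by blast
  moreover have "\<not> iso C K X k"
  proof
    assume i: "iso C K X k"
    have "f = f \<cdot> (k \<cdot> minv C K X k)" using cmp_minv[OF i] cmp_idm_right[OF f(1)] by simp
    also have "\<dots> = 0" using cmp_assoc[OF f(1) kh(1) minv_hom[OF i]] kh(2) cmp_zero_left[OF minv_hom[OF i]] by simp
    finally show False using f(2) by simp
  qed
  ultimately have k0: "k = 0" by blast
  have "mono_mor C X Y f"
    unfolding mono_mor_def
  proof (intro conjI allI ballI impI)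
    fix W g h assume gh: "g \<in> hom C W X" "h \<in> hom C W X" "f \<cdot> g = f \<cdot> h"
    then have "f \<cdot> (g - h) = 0" using cmp_diff_right[OF f(1) gh(1,2)] by simp
    from fac[OF hom_diff[OF gh(1,2)] this] obtain u where "u \<in> hom C W K" "k \<cdot> u = g - h" by blast
    then show "g = h" using k0 cmp_zero_left by (metis eq_iff_diff_eq_0)
  qed (fact f)
  then show ?thesis using Y f(2) unfolding simple_def by blast
qed

end

context semisimple_category
begin

text \<open>An annihilating polynomial of least degree has a root t. Were f - t nonzero, it would be
  invertible by \<open>Schur_iso\<close>, and the cofactor q would annihilate f with smaller
  degree.\<close>

lemma Schur_scalar:
  assumes X: "simple C X" and f: "f \<in> hom C X X"
  shows "\<exists>t. f = scl C t (idm C X)"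
proof -
  obtain B where B: "finite B" "hom C X X = span B" using hom_finite_dim by blast
  let ?P = "\<lambda>p. p \<noteq> 0 \<and> poly_end X f p = 0"
  define p where "p = arg_min degree ?P"
  have "\<exists>p. ?P p" using poly_end_annihilator[OF f B] .
  then have p: "?P p" "\<And>q. ?P q \<Longrightarrow> degree p \<le> degree q"
    using arg_min_nat_lemma[of ?P _ degree] unfolding p_def by auto
  have d: "degree p \<noteq> 0"
  proof
    assume "degree p = 0"
    then obtain a where a: "p = [:a:]" by (metis degree_eq_zeroE)
    with p(1) have "a \<noteq> 0" "scl C a (idm C X) = 0"
      by (auto simp: poly_end_pCons[OF f] poly_end_0[OF f] cmp_zero_right[OF f])
    with X show False by (simp add: simple_def)
  qed
  then obtain t where "poly p t = 0"
    using fundamental_theorem_of_algebra[of p] constant_degree[of p] d by auto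
  then obtain q where q: "p = [:- t, 1:] * q" by (metis dvdE poly_eq_0_iff_dvd)
  with p(1) have q0: "q \<noteq> 0" by auto
  then have "degree p = Suc (degree q)" unfolding q by (subst degree_mult_eq) auto
  with p(2)[of q] q0 have q1: "poly_end X f q \<noteq> 0" by fastforce
  let ?g = "f - scl C t (idm C X)"
  have g: "?g \<in> hom C X X" by (intro hom_diff f hom_scl idm_hom)
  have z: "?g \<cdot> poly_end X f q = 0" using p(1) unfolding q poly_end_linear_factor[OF f] by simp
  have "?g = 0"
  proof (rule ccontr)
    assume "?g \<noteq> 0"
    then have i: "iso C X X ?g" using Schur_iso[OF X X g] by blast
    have "poly_end X f q = (minv C X X ?g \<cdot> ?g) \<cdot> poly_end X f q"
      using minv_cmp[OF i] cmp_idm_left[OF poly_end_hom[OF f]] by simp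
    also have "\<dots> = minv C X X ?g \<cdot> (?g \<cdot> poly_end X f q)"
      by (rule cmp_assoc[OF minv_hom[OF i] g poly_end_hom[OF f]])
    also have "\<dots> = 0" unfolding z by (rule cmp_zero_right[OF minv_hom[OF i]])
    finally show False using q1 by simp
  qed
  then show ?thesis by auto
qed

lemma Schur_hom:
  assumes X: "simple C X" and k: "iso C X Y k" and f: "f \<in> hom C X Y"
  shows "\<exists>t. f = scl C t k"
proof -
  have i: "minv C X Y k \<in> hom C Y X" and k': "k \<in> hom C X Y" using minv_hom[OF k] iso_hom[OF k] by blast+
  obtain t where t: "minv C X Y k \<cdot> f = scl C t (idm C X)" using Schur_scalar[OF X cmp_hom[OF i f]] by blast
  have "f = (k \<cdot> minv C X Y k) \<cdot> f" using cmp_minv[OF k] cmp_idm_left[OF f] by simp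
  also have "\<dots> = k \<cdot> scl C t (idm C X)" using cmp_assoc[OF k' i f] t by simp
  also have "\<dots> = scl C t k" using cmp_scl_right[OF k' idm_hom] cmp_idm_right[OF k'] by simp
  finally show ?thesis by blast
qed

lemma Schur_zero:
  assumes "simple C X" "simple C Y" "\<not> isomorphic C X Y" "f \<in> hom C X Y"
  shows "f = 0"
  using Schur_iso[OF assms(1,2,4)] assms(3) unfolding isomorphic_def by blast

lemma direct_sumD:
  assumes "direct_sum C J X V inc prj"
  shows "finite J" "\<And>j. j \<in> J \<Longrightarrow> inc j \<in> hom C (X j) V" "\<And>j. j \<in> J \<Longrightarrow> prj j \<in> hom C V (X j)"
    "\<And>j k. \<lbrakk>j \<in> J; k \<in> J\<rbrakk> \<Longrightarrow> prj j \<cdot> inc k = (if j = k then idm C (X j) else 0)"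
    "(\<Sum>j\<in>J. inc j \<cdot> prj j) = idm C V"
  using assms unfolding direct_sum_def by auto

end

section \<open>Degrees of simple objects\<close>

context graded_category
begin

lemma simple_iso:
  assumes "simple C X" "iso C X Y k"
  shows "simple C Y"
  unfolding simple_def
proof (intro conjI allI impI)
  note k = iso_hom[OF assms(2)] and i = minv_hom[OF assms(2)]
  show "idm C Y \<noteq> 0"
  proof
    assume "idm C Y = 0"
    then have "minv C X Y k \<cdot> (idm C Y \<cdot> k) = 0" using k i by (simp add: cmp_zero_left cmp_zero_right)
    then have "idm C X = 0" using minv_cmp[OF assms(2)] cmp_idm_left[OF k] by simp
    with assms(1) show False by (simp add: simple_def)
  qed
  fix Z f assume f: "mono_mor C Z Y f"
  then have fh: "f \<in> hom C Z Y" by (simp add: mono_mor_def)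
  let ?f = "minv C X Y k \<cdot> f"
  have kf: "k \<cdot> ?f = f"
    using cmp_assoc[OF k i fh, symmetric] cmp_minv[OF assms(2)] cmp_idm_left[OF fh] by simp
  have "mono_mor C Z X ?f"
    unfolding mono_mor_def
  proof (intro conjI allI ballI impI cmp_hom[OF i fh])
    fix W g h assume gh: "g \<in> hom C W Z" "h \<in> hom C W Z" "?f \<cdot> g = ?f \<cdot> h"
    then have "(k \<cdot> ?f) \<cdot> g = (k \<cdot> ?f) \<cdot> h"
      using cmp_assoc[OF k cmp_hom[OF i fh]] by simp
    with f gh show "g = h" unfolding kf mono_mor_def by blast
  qed
  then have "?f = 0 \<or> iso C Z X ?f" using assms(1) by (simp add: simple_def)
  then show "f = 0 \<or> iso C Z Y f"
    using iso_cmp[OF assms(2), of Z ?f] kf cmp_zero_right[OF k] by auto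
qed

text \<open>Some inclusion of a homogeneous component is nonzero; being a split monomorphism into a
  simple object, it is an isomorphism.\<close>

lemma simple_homog:
  assumes X: "simple C X"
  shows "\<exists>h. X \<in> homog C h"
proof -
  obtain Xs inc prj where d: "\<forall>g. Xs g \<in> homog C g" "direct_sum C UNIV Xs X inc prj"
    using homog_sum by blast
  note D = direct_sumD[OF d(2)]
  have "\<exists>g. inc g \<noteq> 0"
  proof (rule ccontr)
    assume "\<not> ?thesis"
    then have "inc g \<cdot> prj g = 0" for g using cmp_zero_left[OF D(3)[of g]] by simp
    then have "idm C X = 0" using D(5) by simp
    with X show False by (simp add: simple_def)
  qed
  then obtain g where g: "inc g \<noteq> 0" by blast
  have "mono_mor C (Xs g) X (inc g)"
    unfolding mono_mor_def
  proof (intro conjI allI ballI impI)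
    fix W u v assume uv: "u \<in> hom C W (Xs g)" "v \<in> hom C W (Xs g)" "inc g \<cdot> u = inc g \<cdot> v"
    have "u = (prj g \<cdot> inc g) \<cdot> u" "v = (prj g \<cdot> inc g) \<cdot> v" using D(4)[of g g] uv cmp_idm_left by auto
    then show "u = v" using uv cmp_assoc[OF D(3)[of g] D(2)[of g]] by simp
  qed (simp add: D)
  then have "iso C (Xs g) X (inc g)" using X g unfolding simple_def by blast
  then show ?thesis using homog_iso[of "Xs g" g X] d(1) unfolding isomorphic_def by blast
qed

lemma homog_unique:
  assumes "idm C X \<noteq> 0" "X \<in> homog C g" "X \<in> homog C h"
  shows "g = h"
  using homog_hom[OF assms(2,3)] idm_hom[of X] assms(1) by auto

text \<open>The unit is isomorphic to its tensor square, so its degree h satisfies h + h =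
  h.\<close>

lemma unt_homog: "\<one> \<in> homog C 0"
proof -
  obtain h where h: "\<one> \<in> homog C h" using simple_homog[OF unt_simple] by blast
  have "\<one> \<otimes> \<one> \<in> homog C (h + h)" by (rule homog_tens[OF h h])
  moreover have "isomorphic C (\<one> \<otimes> \<one>) \<one>" unfolding isomorphic_def using lun_iso by blast
  ultimately have hh: "\<one> \<in> homog C (h + h)" by (rule homog_iso)
  have "idm C \<one> \<noteq> 0" using unt_simple unfolding simple_def by blast
  from homog_unique[OF this h hh] have "h + h = h + 0" by simp
  then have "h = 0" by (rule add_left_imp_eq)
  with h show ?thesis by simp
qed

text \<open>Ensures that the choice in \<open>cls\<close> picks an actual decomposition:
  semisimplicity supplies simple summands, which are then replaced by their representatives.\<close>

lemma simple_reps_decomposition: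
  assumes "simple_reps C I"
  shows "\<exists>(n::nat) X inc prj. (\<forall>r<n. X r \<in> I) \<and> direct_sum C {..<n} X V inc prj"
proof -
  obtain n :: nat and Xs inc prj where d: "\<forall>r<n. simple C (Xs r)" "direct_sum C {..<n} Xs V inc prj"
    using semisimple by blast
  note D = direct_sumD[OF d(2)]
  have "\<exists>Y k. Y \<in> I \<and> iso C (Xs r) Y k" if "r < n" for r
    using assms d(1) that unfolding simple_reps_def isomorphic_def by blast
  then obtain Y k where Y: "\<And>r. r < n \<Longrightarrow> Y r \<in> I" "\<And>r. r < n \<Longrightarrow> iso C (Xs r) (Y r) (k r)" by metis
  define k' where "k' r = minv C (Xs r) (Y r) (k r)" for r
  have k: "k r \<in> hom C (Xs r) (Y r)" "k' r \<in> hom C (Y r) (Xs r)" "k' r \<cdot> k r = idm C (Xs r)" "k r \<cdot> k' r = idm C (Y r)"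
    if "r < n" for r
    using isoD[OF Y(2)[OF that]] by (auto simp: k'_def)
  have "direct_sum C {..<n} Y V (\<lambda>r. inc r \<cdot> k' r) (\<lambda>r. k r \<cdot> prj r)"
    unfolding direct_sum_def
  proof (intro conjI ballI)
    show "inc j \<cdot> k' j \<in> hom C (Y j) V" "k j \<cdot> prj j \<in> hom C V (Y j)" if "j \<in> {..<n}" for j
      using that D k by (auto intro!: cmp_hom)
    have "(inc j \<cdot> k' j) \<cdot> (k j \<cdot> prj j) = inc j \<cdot> prj j" if "j < n" for j
    proof -
      have "(inc j \<cdot> k' j) \<cdot> (k j \<cdot> prj j) = inc j \<cdot> (k' j \<cdot> (k j \<cdot> prj j))"
        using that D k by (intro cmp_assoc) (auto intro!: cmp_hom)
      also have "k' j \<cdot> (k j \<cdot> prj j) = (k' j \<cdot> k j) \<cdot> prj j"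
        using that D k by (intro cmp_assoc[symmetric]) auto
      finally show ?thesis using that D(3)[of j] k(3)[of j] by (simp add: cmp_idm_left)
    qed
    then show "(\<Sum>j<n. (inc j \<cdot> k' j) \<cdot> (k j \<cdot> prj j)) = idm C V" using D(5) by simp
    show "(k i \<cdot> prj i) \<cdot> (inc j \<cdot> k' j) = (if i = j then idm C (Y i) else 0)"
      if "i \<in> {..<n}" "j \<in> {..<n}" for i j
    proof -
      have "(k i \<cdot> prj i) \<cdot> (inc j \<cdot> k' j) = k i \<cdot> (prj i \<cdot> (inc j \<cdot> k' j))"
        using that D k by (intro cmp_assoc) (auto intro!: cmp_hom)
      also have "prj i \<cdot> (inc j \<cdot> k' j) = (prj i \<cdot> inc j) \<cdot> k' j"
        using that D k by (intro cmp_assoc[symmetric]) auto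
      finally show ?thesis
        using that D(4)[of i j] cmp_idm_left[OF k(2), of j] cmp_zero_left[OF k(2), of j] cmp_zero_right[OF k(1), of i] k(4)
        by auto
    qed
  qed simp
  with Y(1) show ?thesis by blast
qed

end

section \<open>Duality and the group action\<close>

context pivotal_category
begin

lemma Ev_Coev_zigzag:
  "Run V \<odot> (V \<lhd> Ev V) \<odot> Asc V (dual C V) V \<odot> (Coev V \<rhd> V) \<odot> inva (Lun V) = ida V"
  "Lun (dual C V) \<odot> (Ev V \<rhd> dual C V) \<odot> inva (Asc (dual C V) V (dual C V)) \<odot> (dual C V \<lhd> Coev V) \<odot>
    inva (Run (dual C V)) = ida (dual C V)"
  using left_dual[of V] unfolding is_dual_def asci_def luni_def runi_def
  by (simp_all add: comp_def lw_def rw_def Run_def Lun_def Asc_def inva_def ida_def Ev_def Coev_def)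

text \<open>Adjunction between tensoring with U and with its dual: \<open>?t\<close> is f bent at
  its dual leg, and bending back returns f by a zigzag. Both sides are compared as families and then
  taken at the unit.\<close>

lemma Coev_transpose:
  assumes "val f" "src f = \<one>" "tgt f = L \<otimes> dual C U"
  shows "f = ((Run L \<odot> (L \<lhd> Ev U) \<odot> Asc L (dual C U) U \<odot> (f \<rhd> U) \<odot> inva (Lun U)) \<rhd> dual C U) \<odot> Coev U"
    (is "f = (?t \<rhd> _) \<odot> _")
proof -
  let ?W = "dual C U"
  have [simp]: "val ?t" "src ?t = U" "tgt ?t = L" using assms by simp_all
  have t: "?t \<rhd> Z = (L \<lhd> evf U Z) \<odot> Cof L ?W f (U \<otimes> Z)" for Z
    unfolding evf_def by (rule zigzag_rw1) (use assms in simp_all)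
  have "Cof L ?W ((?t \<rhd> ?W) \<odot> Coev U) Z = Cof L ?W f Z" for Z
  proof -
    have "Cof L ?W ((?t \<rhd> ?W) \<odot> Coev U) Z = (?t \<rhd> (?W \<otimes> Z)) \<odot> cof U Z"
      using Asc_nat1_assoc[of ?t L "(Coev U \<rhd> Z) \<odot> inva (Lun Z)" ?W Z] by (simp add: Cof_def cof_def)
    also have "\<dots> = (L \<lhd> evf U (?W \<otimes> Z)) \<odot> (Cof L ?W f (U \<otimes> (?W \<otimes> Z)) \<odot> cof U Z)"
      unfolding t using assms by simp
    also have "\<dots> = (L \<lhd> (evf U (?W \<otimes> Z) \<odot> (?W \<lhd> cof U Z))) \<odot> Cof L ?W f Z"
      using assms by (subst Cof_nat[symmetric]) simp_all
    also have "\<dots> = Cof L ?W f Z"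
      unfolding ev.zz2 using assms by simp
    finally show ?thesis .
  qed
  then have "Asc L ?W \<one> \<odot> ((((?t \<rhd> ?W) \<odot> Coev U) \<rhd> \<one>) \<odot> inva (Lun \<one>)) = Asc L ?W \<one> \<odot> ((f \<rhd> \<one>) \<odot> inva (Lun \<one>))"
    unfolding Cof_def .
  then have "(((?t \<rhd> ?W) \<odot> Coev U) \<rhd> \<one>) \<odot> inva (Lun \<one>) = (f \<rhd> \<one>) \<odot> inva (Lun \<one>)"
    by (rule isoa_cancel_left) (use assms in simp_all)
  then have "((?t \<rhd> ?W) \<odot> Coev U) \<rhd> \<one> = f \<rhd> \<one>"
    by (rule isoa_cancel_right) (use assms in simp_all)
  then have "(?t \<rhd> ?W) \<odot> Coev U = f" by (rule rw_unit_inj) (use assms in simp_all)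
  then show ?thesis by simp
qed

text \<open>The member at the unit object already determines the morphism, since tensoring with the
  unit is faithful.\<close>

lemma Cof_inj:
  assumes "\<And>Z. Cof V W f Z = Cof V W g Z" "val f" "src f = \<one>" "tgt f = V \<otimes> W" "val g" "src g = \<one>" "tgt g = V \<otimes> W"
  shows "f = g"
proof -
  have "Asc V W \<one> \<odot> ((f \<rhd> \<one>) \<odot> inva (Lun \<one>)) = Asc V W \<one> \<odot> ((g \<rhd> \<one>) \<odot> inva (Lun \<one>))"
    using assms(1)[of "\<one>"] unfolding Cof_def .
  then have "(f \<rhd> \<one>) \<odot> inva (Lun \<one>) = (g \<rhd> \<one>) \<odot> inva (Lun \<one>)"
    by (rule isoa_cancel_left) (use assms(2-) in simp_all)
  then have "f \<rhd> \<one> = g \<rhd> \<one>"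
    by (rule isoa_cancel_right) (use assms(2-) in simp_all)
  then show ?thesis by (rule rw_unit_inj) (use assms(2-) in simp_all)
qed

lemma Cof_rw_arg1:
  assumes "val b" "src b = \<one>" "tgt b = V \<otimes> W" "val f" "src f = V"
  shows "Cof (tgt f) W ((f \<rhd> W) \<odot> b) Z = (f \<rhd> (W \<otimes> Z)) \<odot> Cof V W b Z"
  using assms Asc_nat1_assoc[of f "tgt f" "(b \<rhd> Z) \<odot> inva (Lun Z)" W Z] by (simp add: Cof_def)

lemma Dualm_Coev:
  assumes "val f" "src f = V" "tgt f = Y"
  shows "(Y \<lhd> Dualm f) \<odot> Coev Y = (f \<rhd> dual C V) \<odot> Coev V"
proof (rule Cof_inj)
  fix Z
  have "Cof Y (dual C V) ((Y \<lhd> Dualm f) \<odot> Coev Y) Z = (Y \<lhd> (Dualm f \<rhd> Z)) \<odot> cof Y Z"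
    using Cof_rw_arg[of "Coev Y" Y "dual C Y" "Dualm f" Z] assms by (simp add: cof_def)
  also have "\<dots> = (f \<rhd> (dual C V \<otimes> Z)) \<odot> cof V Z"
    using Dualm_cof[of f Y Z] assms by simp
  also have "\<dots> = Cof Y (dual C V) ((f \<rhd> dual C V) \<odot> Coev V) Z"
    using Cof_rw_arg1[of "Coev V" V "dual C V" f Z] assms by (simp add: cof_def)
  finally show "Cof Y (dual C V) ((Y \<lhd> Dualm f) \<odot> Coev Y) Z = Cof Y (dual C V) ((f \<rhd> dual C V) \<odot> Coev V) Z" .
qed (use assms in simp_all)

end

section \<open>The action preserves duals\<close>

context action_category
begin

text \<open>In this and the next four lemmas R_g of a structural arrow is solved for, so that the
  simplifier can push R_g inwards and the remaining tensor constraints cancel.\<close>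

lemma Act_rw: "val f \<Longrightarrow> Act g (f \<rhd> Y) = ActT g (tgt f) Y \<odot> (Act g f \<rhd> act C g Y) \<odot> inva (ActT g (src f) Y)"
proof -
  assume f: "val f"
  have "Act g (f \<rhd> Y) = (Act g (f \<rhd> Y) \<odot> ActT g (src f) Y) \<odot> inva (ActT g (src f) Y)" using f by simp
  also have "Act g (f \<rhd> Y) \<odot> ActT g (src f) Y = ActT g (tgt f) Y \<odot> (Act g f \<rhd> act C g Y)"
    by (rule ActT_nat1[OF f refl, symmetric])
  finally show ?thesis using f by simp
qed

lemma Act_lw: "val f \<Longrightarrow> Act g (X \<lhd> f) = ActT g X (tgt f) \<odot> (act C g X \<lhd> Act g f) \<odot> inva (ActT g X (src f))"
proof -
  assume f: "val f"
  have "Act g (X \<lhd> f) = (Act g (X \<lhd> f) \<odot> ActT g X (src f)) \<odot> inva (ActT g X (src f))" using f by simp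
  also have "Act g (X \<lhd> f) \<odot> ActT g X (src f) = ActT g X (tgt f) \<odot> (act C g X \<lhd> Act g f)"
    by (rule ActT_nat2[OF f refl, symmetric])
  finally show ?thesis using f by simp
qed

lemma Act_Asc: "Act g (Asc X Y Z) = ActT g X (Y \<otimes> Z) \<odot> (act C g X \<lhd> ActT g Y Z) \<odot>
  Asc (act C g X) (act C g Y) (act C g Z) \<odot> (inva (ActT g X Y) \<rhd> act C g Z) \<odot> inva (ActT g (X \<otimes> Y) Z)"
proof -
  have "Act g (Asc X Y Z) \<odot> (ActT g (X \<otimes> Y) Z \<odot> (ActT g X Y \<rhd> act C g Z))
    = ActT g X (Y \<otimes> Z) \<odot> (act C g X \<lhd> ActT g Y Z) \<odot> Asc (act C g X) (act C g Y) (act C g Z)"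
    using act_tens_asc[of g X Y Z] by (simp add: comp_def lw_def rw_def Act_def ActT_def Asc_def)
  also have "\<dots> = (ActT g X (Y \<otimes> Z) \<odot> (act C g X \<lhd> ActT g Y Z) \<odot>
      Asc (act C g X) (act C g Y) (act C g Z) \<odot> (inva (ActT g X Y) \<rhd> act C g Z) \<odot> inva (ActT g (X \<otimes> Y) Z)) \<odot>
      (ActT g (X \<otimes> Y) Z \<odot> (ActT g X Y \<rhd> act C g Z))"
    by (simp flip: inva_rw)
  finally show ?thesis by (rule isoa_cancel_right) simp_all
qed

lemma Act_Lun: "Act g (Lun X) = Lun (act C g X) \<odot> (inva (ActU g) \<rhd> act C g X) \<odot> inva (ActT g \<one> X)"
proof -
  have "Act g (Lun X) \<odot> (ActT g \<one> X \<odot> (ActU g \<rhd> act C g X)) = Lun (act C g X)"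
    using act_lun[of g X] by (simp add: comp_def lw_def rw_def Act_def ActT_def ActU_def Lun_def)
  also have "\<dots> = (Lun (act C g X) \<odot> (inva (ActU g) \<rhd> act C g X) \<odot> inva (ActT g \<one> X)) \<odot> (ActT g \<one> X \<odot> (ActU g \<rhd> act C g X))"
    by (simp flip: inva_rw)
  finally show ?thesis by (rule isoa_cancel_right) simp_all
qed

lemma Act_Run: "Act g (Run X) = Run (act C g X) \<odot> (act C g X \<lhd> inva (ActU g)) \<odot> inva (ActT g X \<one>)"
proof -
  have "Act g (Run X) \<odot> (ActT g X \<one> \<odot> (act C g X \<lhd> ActU g)) = Run (act C g X)"
    using act_run[of g X] by (simp add: comp_def lw_def rw_def Act_def ActT_def ActU_def Run_def)
  also have "\<dots> = (Run (act C g X) \<odot> (act C g X \<lhd> inva (ActU g)) \<odot> inva (ActT g X \<one>)) \<odot> (ActT g X \<one> \<odot> (act C g X \<lhd> ActU g))"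
    by (simp flip: inva_lw)
  finally show ?thesis by (rule isoa_cancel_right) simp_all
qed

definition DEv :: "'g \<Rightarrow> 'o \<Rightarrow> ('o, 'm) arr" where
  "DEv g X = inva (ActU g) \<odot> Act g (Ev X) \<odot> ActT g (dual C X) X"

definition DCo :: "'g \<Rightarrow> 'o \<Rightarrow> ('o, 'm) arr" where
  "DCo g X = inva (ActT g X (dual C X)) \<odot> Act g (Coev X) \<odot> ActU g"

definition Dact :: "'g \<Rightarrow> 'o \<Rightarrow> ('o, 'm) arr" where
  "Dact g X = Arr (act C g (dual C X)) (dual C (act C g X)) (dual_act C g X)"

lemma src_DEv [simp]: "src (DEv g X) = act C g (dual C X) \<otimes> act C g X" and tgt_DEv [simp]: "tgt (DEv g X) = \<one>"
  and val_DEv [simp]: "val (DEv g X)"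
  and src_DCo [simp]: "src (DCo g X) = \<one>" and tgt_DCo [simp]: "tgt (DCo g X) = act C g X \<otimes> act C g (dual C X)"
  and val_DCo [simp]: "val (DCo g X)"
  by (simp_all add: DEv_def DCo_def)

lemma Dact_Transp: "Dact g X = Transp (act C g X) (act C g X) (dual C (act C g X)) (act C g (dual C X)) (DEv g X)
   (Coev (act C g X)) (ida (act C g X))"
  by (simp add: Dact_def dual_act_def Transp_def DEv_def comp_def Act_def ActU_def ActT_def inva_def Ev_def Coev_def)

lemma src_Dact [simp]: "src (Dact g X) = act C g (dual C X)" and tgt_Dact [simp]: "tgt (Dact g X) = dual C (act C g X)"
  and val_Dact [simp]: "val (Dact g X)"
proof -
  show "val (Dact g X)" unfolding Dact_Transp by (rule val_Transp) simp_all
qed (simp_all add: Dact_def)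

text \<open>A monoidal functor preserves duals: R_g of the zigzag of X is, once the constraints have
  cancelled, the zigzag of the transported evaluation and coevaluation.\<close>

sublocale dv: dual_family C "act C g X" "act C g (dual C X)" "Evf (act C g (dual C X)) (act C g X) (DEv g X)"
  "Cof (act C g X) (act C g (dual C X)) (DCo g X)" for g X
proof (rule dual_familyI)
  let ?V = "act C g X" and ?W = "act C g (dual C X)"
  have 1: "Act g (inva f) = inva (Act g f)" if "isoa f" for f using that by (simp add: inva_Act)
  have "ida ?V = Act g (Run X \<odot> (X \<lhd> Ev X) \<odot> Asc X (dual C X) X \<odot> (Coev X \<rhd> X) \<odot> inva (Lun X))"
    unfolding Ev_Coev_zigzag by simp
  also have "\<dots> = Run ?V \<odot> (?V \<lhd> DEv g X) \<odot> Asc ?V ?W ?V \<odot> (DCo g X \<rhd> ?V) \<odot> inva (Lun ?V)"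
    by (simp add: 1) (simp add: Act_Run Act_Lun Act_lw Act_rw Act_Asc DEv_def DCo_def inva_of_comp inva_rw inva_lw)
  finally show "Run ?V \<odot> (?V \<lhd> DEv g X) \<odot> Asc ?V ?W ?V \<odot> (DCo g X \<rhd> ?V) \<odot> inva (Lun ?V) = ida ?V" by simp
  have "ida ?W = Act g (Lun (dual C X) \<odot> (Ev X \<rhd> dual C X) \<odot> inva (Asc (dual C X) X (dual C X)) \<odot> (dual C X \<lhd> Coev X) \<odot>
    inva (Run (dual C X)))"
    unfolding Ev_Coev_zigzag by simp
  also have "\<dots> = Lun ?W \<odot> (DEv g X \<rhd> ?W) \<odot> inva (Asc ?W ?V ?W) \<odot> (?W \<lhd> DCo g X) \<odot> inva (Run ?W)"
    by (simp add: 1) (simp add: Act_Run Act_Lun Act_lw Act_rw Act_Asc DEv_def DCo_def inva_of_comp inva_rw inva_lw)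
  finally show "Lun ?W \<odot> (DEv g X \<rhd> ?W) \<odot> inva (Asc ?W ?V ?W) \<odot> (?W \<lhd> DCo g X) \<odot> inva (Run ?W) = ida ?W" by simp
qed simp_all

text \<open>\<open>Dact\<close> is the transpose of the identity between two duals of R_g X, the
  transported and the chosen one, and so intertwines their coevaluations.\<close>

lemma Dact_DCo: "(act C g X \<lhd> Dact g X) \<odot> DCo g X = Coev (act C g X)"
proof (rule Cof_inj)
  let ?V = "act C g X" and ?W = "act C g (dual C X)"
  fix Z
  interpret dual_family_pair C ?V "dual C ?V" "evf ?V" "cof ?V" ?V ?W "Evf ?W ?V (DEv g X)" "Cof ?V ?W (DCo g X)" ..
  have fam: "Dact g X \<rhd> Z = Evf ?W ?V (DEv g X) (dual C ?V \<otimes> Z) \<odot> (?W \<lhd> (ida ?V \<rhd> (dual C ?V \<otimes> Z))) \<odot> (?W \<lhd> cof ?V Z)" for Z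
    unfolding Dact_Transp cof_def by (rule Transp_fam(2)) simp_all
  have "Cof ?V (dual C ?V) ((?V \<lhd> Dact g X) \<odot> DCo g X) Z = (?V \<lhd> (Dact g X \<rhd> Z)) \<odot> Cof ?V ?W (DCo g X) Z"
    using Cof_rw_arg[of "DCo g X" ?V ?W "Dact g X" Z] by simp
  also have "\<dots> = cof ?V Z"
    using transpose_B[OF _ _ _ _ _ _ fam] by simp
  finally show "Cof ?V (dual C ?V) ((?V \<lhd> Dact g X) \<odot> DCo g X) Z = Cof ?V (dual C ?V) (Coev ?V) Z"
    by (simp add: cof_def)
qed simp_all

definition Adj :: "'g \<Rightarrow> 'o \<Rightarrow> ('o, 'm) arr \<Rightarrow> ('o, 'm) arr" where
  "Adj g V f = Act (- g) (Dact g V) \<odot> inva (ActC (- g) g (dual C V)) \<odot> Dualm f"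

lemma src_Adj [simp]: "src (Adj g V f) = dual C (tgt f)"
  and tgt_Adj [simp]: "tgt (Adj g V f) = act C (- g) (dual C (act C g V))"
  and val_Adj [simp]: "\<lbrakk>val f; src f = V\<rbrakk> \<Longrightarrow> val (Adj g V f)"
  by (simp_all add: Adj_def)

lemma mor_Adj: "\<lbrakk>src f = V; tgt f = act C g V\<rbrakk> \<Longrightarrow> mor (Adj g V f) = adj C g V (mor f)"
  by (simp add: Adj_def adj_def comp_def inva_def ActC_def Act_def Dact_def Dualm_def)

text \<open>Moving the transpose of f across the coevaluation cancels the inverse of f contained in
  b. What remains says that the compositor R_{g^-1} R_g -> id, being natural and monoidal, takes the
  twice transported coevaluation of V to the original one. The form is evaluated through this vector
  b.\<close>

lemma Adj_Coev:
  assumes f: "isoa f" "src f = V" "tgt f = act C g V"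
  defines "W \<equiv> dual C (act C g V)"
  defines "p \<equiv> inva (Act (- g) f) \<odot> inva (ActC (- g) g V)"
  defines "b \<equiv> (inva f \<rhd> W) \<odot> Coev (act C g V)"
  shows "ActT (- g) V W \<odot> (p \<rhd> act C (- g) W) \<odot> (V \<lhd> Adj g V f) \<odot> b = Act (- g) b \<odot> ActU (- g)"
proof -
  note [simp] = f
  let ?h = "- g"
  let ?U = "act C g V" and ?V = "dual C V"
  define A where "A = Act ?h (Dact g V) \<odot> inva (ActC ?h g ?V)"
  have A [simp]: "val A" "src A = ?V" "tgt A = act C ?h W" by (simp_all add: A_def W_def)
  define co where "co = Coev ?U"
  have Co [simp]: "val co" "src co = \<one>" "tgt co = ?U \<otimes> W" by (simp_all add: co_def W_def)
  have [simp]: "tgt (Dact g V) = W" by (simp add: W_def)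
  define d where "d = Dualm f"
  have D [simp]: "val d" "src d = W" "tgt d = ?V" by (simp_all add: d_def W_def)
  have [simp]: "val p" "src p = V" "tgt p = act C ?h V" by (simp_all add: p_def)
  have Ad: "Adj g V f = A \<odot> d" by (simp add: Adj_def A_def W_def d_def)
  have DC: "(?U \<lhd> d) \<odot> co = (f \<rhd> ?V) \<odot> Coev V" unfolding d_def co_def by (rule Dualm_Coev) simp_all
  have "(V \<lhd> Adj g V f) \<odot> b = (V \<lhd> A) \<odot> (inva f \<rhd> ?V) \<odot> ((?U \<lhd> d) \<odot> co)"
    unfolding Ad b_def co_def[symmetric] by (simp add: slide_assoc[of "inva f" d ?U V W ?V])
  also have "\<dots> = (V \<lhd> A) \<odot> ((inva f \<odot> f) \<rhd> ?V) \<odot> Coev V"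
    unfolding DC by (simp del: inva_comp)
  finally have L: "(V \<lhd> Adj g V f) \<odot> b = (V \<lhd> A) \<odot> Coev V" by simp
  have "Act ?h (co) \<odot> ActU ?h = (ActT ?h ?U W \<odot> (inva (ActC ?h g V) \<rhd> act C ?h W) \<odot> (V \<lhd> A) \<odot> Coev V)"
  proof -
    have U: "ActC ?h g \<one> \<odot> Act ?h (ActU g) \<odot> ActU ?h = ida \<one>"
      using act_cmp_unt[of ?h g] by (simp add: comp_def ActC_def Act_def ActU_def ida_def act_unt_zero)
    have N: "Act ?h (Act g (Coev V)) = inva (ActC ?h g (V \<otimes> ?V)) \<odot> Coev V \<odot> ActC ?h g \<one>"
      using ActC_nat[of "Coev V" _ ?h g] inva_comp_assoc[of "ActC ?h g (V \<otimes> ?V)" "Act ?h (Act g (Coev V))"]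
      by (simp add: Act_zero)
    \<comment> \<open>Compatibility of the compositor with the tensor product of V and its dual,
      solved for the inverse compositor on that product.\<close>
    have T: "inva (Act ?h (ActT g V ?V)) \<odot> inva (ActC ?h g (V \<otimes> ?V)) =
      ActT ?h ?U (act C g ?V) \<odot> (inva (ActC ?h g V) \<rhd> act C ?h (act C g ?V)) \<odot> (V \<lhd> inva (ActC ?h g ?V))"
    proof -
      have "(act_cmp C ?h g V \<boxtimes> idm C ?V) \<cdot> (idm C (act C ?h ?U) \<boxtimes> act_cmp C ?h g ?V) = act_cmp C ?h g V \<boxtimes> act_cmp C ?h g ?V"
        using tensm_cmp[of "idm C (act C ?h ?U)" "act C ?h ?U" "act C ?h ?U" "act_cmp C ?h g V" V
            "act_cmp C ?h g ?V" "act C ?h (act C g ?V)" ?V "idm C ?V" ?V]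
          isoa_val[OF isoa_ActC, of ?h g, unfolded val_def ActC_def]
        by (simp add: idm_hom cmp_idm_left cmp_idm_right)
      then have e0: "ActC ?h g (V \<otimes> ?V) \<odot> Act ?h (ActT g V ?V) \<odot> ActT ?h ?U (act C g ?V)
        = (ActC ?h g V \<rhd> ?V) \<odot> (act C ?h ?U \<lhd> ActC ?h g ?V)"
        using act_cmp_tens[of ?h g V ?V]
          cmp_idm_left[of "act_cmp C ?h g V \<boxtimes> act_cmp C ?h g ?V" "act C ?h ?U \<otimes> act C ?h (act C g ?V)" "V \<otimes> ?V"]
          tensm_hom[of "act_cmp C ?h g V" "act C ?h ?U" V "act_cmp C ?h g ?V" "act C ?h (act C g ?V)" ?V]
          isoa_val[OF isoa_ActC, of ?h g, unfolded val_def ActC_def]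
        by (simp add: comp_def lw_def rw_def ActC_def Act_def ActT_def act_tens_zero)
      have e: "(ActC ?h g (V \<otimes> ?V) \<odot> Act ?h (ActT g V ?V)) \<odot> ActT ?h ?U (act C g ?V)
        = (ActC ?h g V \<rhd> ?V) \<odot> (act C ?h ?U \<lhd> ActC ?h g ?V)"
        unfolding e0[symmetric] by simp
      have "inva (Act ?h (ActT g V ?V)) \<odot> inva (ActC ?h g (V \<otimes> ?V)) = inva (ActC ?h g (V \<otimes> ?V) \<odot> Act ?h (ActT g V ?V))"
        by (simp add: inva_of_comp)
      also have "ActC ?h g (V \<otimes> ?V) \<odot> Act ?h (ActT g V ?V)
         = ((ActC ?h g V \<rhd> ?V) \<odot> (act C ?h ?U \<lhd> ActC ?h g ?V)) \<odot> inva (ActT ?h ?U (act C g ?V))"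
        unfolding e[symmetric] by simp
      also have "inva \<dots> = ActT ?h ?U (act C g ?V) \<odot> (act C ?h ?U \<lhd> inva (ActC ?h g ?V)) \<odot> (inva (ActC ?h g V) \<rhd> ?V)"
        by (simp add: inva_of_comp inva_lw inva_rw)
      also have "(act C ?h ?U \<lhd> inva (ActC ?h g ?V)) \<odot> (inva (ActC ?h g V) \<rhd> ?V)
        = (inva (ActC ?h g V) \<rhd> act C ?h (act C g ?V)) \<odot> (V \<lhd> inva (ActC ?h g ?V))"
        by (rule slide) simp_all
      finally show ?thesis .
    qed
    have "Act ?h (co) \<odot> ActU ?h = Act ?h (?U \<lhd> Dact g V) \<odot> inva (Act ?h (ActT g V ?V)) \<odot>
        Act ?h (Act g (Coev V)) \<odot> Act ?h (ActU g) \<odot> ActU ?h"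
      unfolding co_def Dact_DCo[symmetric] by (simp add: DCo_def inva_Act)
    also have "\<dots> = Act ?h (?U \<lhd> Dact g V) \<odot> inva (Act ?h (ActT g V ?V)) \<odot> inva (ActC ?h g (V \<otimes> ?V)) \<odot>
        Coev V \<odot> (ActC ?h g \<one> \<odot> Act ?h (ActU g) \<odot> ActU ?h)"
      unfolding N by simp
    also have "\<dots> = Act ?h (?U \<lhd> Dact g V) \<odot> (inva (Act ?h (ActT g V ?V)) \<odot> inva (ActC ?h g (V \<otimes> ?V))) \<odot> Coev V"
      unfolding U by simp
    also have "\<dots> = ActT ?h ?U W \<odot> ((act C ?h ?U \<lhd> Act ?h (Dact g V)) \<odot> (inva (ActC ?h g V) \<rhd> act C ?h (act C g ?V))) \<odot>
        (V \<lhd> inva (ActC ?h g ?V)) \<odot> Coev V"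
      unfolding T by (simp add: Act_lw W_def)
    also have "(act C ?h ?U \<lhd> Act ?h (Dact g V)) \<odot> (inva (ActC ?h g V) \<rhd> act C ?h (act C g ?V))
       = (inva (ActC ?h g V) \<rhd> act C ?h W) \<odot> (V \<lhd> Act ?h (Dact g V))"
      by (rule slide) (simp_all add: W_def)
    finally show ?thesis by (simp add: A_def W_def)
  qed
  then have "Act ?h b \<odot> ActU ?h = Act ?h (inva f \<rhd> W) \<odot> (ActT ?h ?U W \<odot> (inva (ActC ?h g V) \<rhd> act C ?h W) \<odot> (V \<lhd> A) \<odot> Coev V)"
    by (simp add: b_def flip: co_def)
  also have "\<dots> = ActT ?h V W \<odot> (p \<rhd> act C ?h W) \<odot> (V \<lhd> A) \<odot> Coev V"
    by (simp add: Act_rw p_def inva_Act)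
  finally show ?thesis unfolding L by simp
qed

end

section \<open>Zero morphisms, sums and decompositions\<close>

lemma sum_apply2: "(\<Sum>a\<in>A. F a) m i = (\<Sum>a\<in>A. F a m i)" for F :: "_ \<Rightarrow> 'b \<Rightarrow> 'c \<Rightarrow> 'd::ab_group_add"
  by (induction A rule: infinite_finite_induct) auto

context linear_category
begin

lemma comp_zero_left: "val f \<Longrightarrow> Arr Y Z 0 \<odot> f = Arr (src f) Z 0"
  by (simp add: comp_def val_def cmp_zero_left)

lemma comp_zero_right: "val f \<Longrightarrow> f \<odot> Arr X Y 0 = Arr X (tgt f) 0"
  by (simp add: comp_def val_def cmp_zero_right)

lemma cmp_eq_zero_iso:
  assumes "iso C X Y k" "f \<in> hom C Y Z" "f \<cdot> k = 0"
  shows "f = 0"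
proof -
  have "f = (f \<cdot> k) \<cdot> minv C X Y k"
    using cmp_assoc[OF assms(2) iso_hom[OF assms(1)] minv_hom[OF assms(1)]] cmp_minv[OF assms(1)]
      cmp_idm_right[OF assms(2)] by simp
  then show ?thesis using assms(3) cmp_zero_left[OF minv_hom[OF assms(1)]] by simp
qed

end

context monoidal_category
begin

lemma lw_zero: "X \<lhd> Arr Y Z 0 = Arr (X \<otimes> Y) (X \<otimes> Z) 0"
  using tensm_scl_right[of "idm C X" X X 0 Y Z 0] by (simp add: lw_def idm_hom)

lemma rw_zero: "Arr Y Z 0 \<rhd> X = Arr (Y \<otimes> X) (Z \<otimes> X) 0"
  using tensm_scl_left[of 0 Y Z "idm C X" X X 0] by (simp add: rw_def idm_hom)

lemma tensm_zero_left: "g \<in> hom C Y Y' \<Longrightarrow> 0 \<boxtimes> g = 0"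
  using tensm_scl_left[of 0 Y Y' g Y Y' 0] by simp

lemma tensm_zero_right: "f \<in> hom C X X' \<Longrightarrow> f \<boxtimes> 0 = 0"
  using tensm_scl_right[of f X X' 0 X X' 0] by simp

lemma tensm_sum_left: "\<lbrakk>\<And>a. a \<in> A \<Longrightarrow> F a \<in> hom C X X'; g \<in> hom C Y Y'\<rbrakk>
    \<Longrightarrow> (\<Sum>a\<in>A. F a) \<boxtimes> g = (\<Sum>a\<in>A. F a \<boxtimes> g)"
proof (induction A rule: infinite_finite_induct)
  case (insert x A)
  then have "(F x + (\<Sum>a\<in>A. F a)) \<boxtimes> g = F x \<boxtimes> g + (\<Sum>a\<in>A. F a) \<boxtimes> g"
    by (intro tensm_add_left[where X = X and X' = X' and Y = Y and Y' = Y'] hom_sum) auto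
  with insert show ?case by simp
qed (auto simp: tensm_zero_left)

lemma tensm_sum_right: "\<lbrakk>f \<in> hom C X X'; \<And>a. a \<in> A \<Longrightarrow> F a \<in> hom C Y Y'\<rbrakk>
    \<Longrightarrow> f \<boxtimes> (\<Sum>a\<in>A. F a) = (\<Sum>a\<in>A. f \<boxtimes> F a)"
proof (induction A rule: infinite_finite_induct)
  case (insert x A)
  then have "f \<boxtimes> (F x + (\<Sum>a\<in>A. F a)) = f \<boxtimes> F x + f \<boxtimes> (\<Sum>a\<in>A. F a)"
    by (intro tensm_add_right[where X = X and X' = X' and Y = Y and Y' = Y'] hom_sum) auto
  with insert show ?case by simp
qed (auto simp: tensm_zero_right)

text \<open>Leads back from two whiskerings to the tensor product of morphisms that occurs in
  \<open>vtens\<close>.\<close>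

lemma mor_tens:
  assumes "val f" "val g" "src f = X" "tgt g = Y"
  shows "mor ((f \<rhd> Y) \<odot> (X \<lhd> g)) = mor f \<boxtimes> mor g"
  using assms tensm_cmp[of "idm C X" X X "mor f" "tgt f" "mor g" "src g" "tgt g" "idm C Y" Y]
  by (simp add: comp_def lw_def rw_def val_def idm_hom cmp_idm_left cmp_idm_right)

text \<open>Refines a decomposition of W by one of each L (x) X_r. Thus the separate decompositions
  picked in \<open>vstar\<close> and \<open>vtens\<close> become a single one of L (x) W.\<close>

lemma direct_sum_tens:
  assumes d: "direct_sum C J X W inc prj"
    and e: "\<And>r. r \<in> J \<Longrightarrow> direct_sum C (S r) (Y r) (L \<otimes> X r) (jnc r) (qrj r)"
  shows "direct_sum C (Sigma J S) (\<lambda>(r, s). Y r s) (L \<otimes> W) (\<lambda>(r, s). (idm C L \<boxtimes> inc r) \<cdot> jnc r s)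
    (\<lambda>(r, s). qrj r s \<cdot> (idm C L \<boxtimes> prj r))"
proof -
  have D: "finite J" "\<And>j. j \<in> J \<Longrightarrow> inc j \<in> hom C (X j) W" "\<And>j. j \<in> J \<Longrightarrow> prj j \<in> hom C W (X j)"
    "\<And>j k. \<lbrakk>j \<in> J; k \<in> J\<rbrakk> \<Longrightarrow> prj j \<cdot> inc k = (if j = k then idm C (X j) else 0)"
    "(\<Sum>j\<in>J. inc j \<cdot> prj j) = idm C W"
    using d unfolding direct_sum_def by auto
  have E: "finite (S r)" "\<And>j. j \<in> S r \<Longrightarrow> jnc r j \<in> hom C (Y r j) (L \<otimes> X r)"
    "\<And>j. j \<in> S r \<Longrightarrow> qrj r j \<in> hom C (L \<otimes> X r) (Y r j)"
    "\<And>j k. \<lbrakk>j \<in> S r; k \<in> S r\<rbrakk> \<Longrightarrow> qrj r j \<cdot> jnc r k = (if j = k then idm C (Y r j) else 0)"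
    "(\<Sum>j\<in>S r. jnc r j \<cdot> qrj r j) = idm C (L \<otimes> X r)" if "r \<in> J" for r
    using e[OF that] unfolding direct_sum_def by auto
  have I: "idm C L \<boxtimes> inc r \<in> hom C (L \<otimes> X r) (L \<otimes> W)" and P: "idm C L \<boxtimes> prj r \<in> hom C (L \<otimes> W) (L \<otimes> X r)"
    if "r \<in> J" for r using D that by (auto intro!: tensm_hom idm_hom)
  have PI: "(idm C L \<boxtimes> prj r) \<cdot> (idm C L \<boxtimes> inc r') = (if r = r' then idm C (L \<otimes> X r) else 0)"
    and IP: "(idm C L \<boxtimes> inc r) \<cdot> (idm C L \<boxtimes> prj r) = idm C L \<boxtimes> (inc r \<cdot> prj r)" if "r \<in> J" "r' \<in> J" for r r'
    using tensm_cmp[OF idm_hom idm_hom D(2)[OF that(2)] D(3)[OF that(1)], of L] D(4)[OF that]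
      tensm_cmp[OF idm_hom idm_hom D(3)[OF that(1)] D(2)[OF that(1)], of L]
    by (auto simp: cmp_idm_left[OF idm_hom] tensm_idm tensm_zero_right[OF idm_hom])
  show ?thesis unfolding direct_sum_def
  proof (intro conjI ballI)
    show "finite (Sigma J S)" using D(1) E(1) by auto
    show "(case j of (r, s) \<Rightarrow> (idm C L \<boxtimes> inc r) \<cdot> jnc r s) \<in> hom C (case j of (r, s) \<Rightarrow> Y r s) (L \<otimes> W)"
      "(case j of (r, s) \<Rightarrow> qrj r s \<cdot> (idm C L \<boxtimes> prj r)) \<in> hom C (L \<otimes> W) (case j of (r, s) \<Rightarrow> Y r s)"
      if "j \<in> Sigma J S" for j using that I P E by (auto intro!: cmp_hom)
    have "(qrj r s \<cdot> (idm C L \<boxtimes> prj r)) \<cdot> ((idm C L \<boxtimes> inc r') \<cdot> jnc r' s')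
      = (if (r, s) = (r', s') then idm C (Y r s) else 0)" if *: "r \<in> J" "s \<in> S r" "r' \<in> J" "s' \<in> S r'" for r s r' s'
    proof -
      have "(qrj r s \<cdot> (idm C L \<boxtimes> prj r)) \<cdot> ((idm C L \<boxtimes> inc r') \<cdot> jnc r' s')
        = qrj r s \<cdot> (((idm C L \<boxtimes> prj r) \<cdot> (idm C L \<boxtimes> inc r')) \<cdot> jnc r' s')"
        using cmp_assoc[OF E(3)[OF *(1,2)] P[OF *(1)] cmp_hom[OF I[OF *(3)] E(2)[OF *(3,4)]]]
          cmp_assoc[OF P[OF *(1)] I[OF *(3)] E(2)[OF *(3,4)]] by simp
      then show ?thesis using * PI[OF *(1,3)] E(4)[OF *(1,2), of s']
          cmp_idm_left[OF E(2)[OF *(3,4)]] cmp_zero_left[OF E(2)[OF *(3,4)]] cmp_zero_right[OF E(3)[OF *(1,2)]]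
        by auto
    qed
    then show "(case j of (r, s) \<Rightarrow> qrj r s \<cdot> (idm C L \<boxtimes> prj r)) \<cdot> (case k of (r, s) \<Rightarrow> (idm C L \<boxtimes> inc r) \<cdot> jnc r s)
      = (if j = k then idm C (case j of (r, s) \<Rightarrow> Y r s) else 0)" if "j \<in> Sigma J S" "k \<in> Sigma J S" for j k
      using that by (auto split: prod.splits)
    have "((idm C L \<boxtimes> inc r) \<cdot> jnc r s) \<cdot> (qrj r s \<cdot> (idm C L \<boxtimes> prj r))
      = (idm C L \<boxtimes> inc r) \<cdot> ((jnc r s \<cdot> qrj r s) \<cdot> (idm C L \<boxtimes> prj r))" if *: "r \<in> J" "s \<in> S r" for r s
      using cmp_assoc[OF I[OF *(1)] E(2)[OF *] cmp_hom[OF E(3)[OF *] P[OF *(1)]]]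
        cmp_assoc[OF E(2)[OF *] E(3)[OF *] P[OF *(1)]] by simp
    then have "(\<Sum>j\<in>Sigma J S. (case j of (r, s) \<Rightarrow> (idm C L \<boxtimes> inc r) \<cdot> jnc r s) \<cdot> (case j of (r, s) \<Rightarrow> qrj r s \<cdot> (idm C L \<boxtimes> prj r)))
      = (\<Sum>(r, s)\<in>Sigma J S. (idm C L \<boxtimes> inc r) \<cdot> ((jnc r s \<cdot> qrj r s) \<cdot> (idm C L \<boxtimes> prj r)))"
      by (intro sum.cong) auto
    also have "\<dots> = (\<Sum>r\<in>J. \<Sum>s\<in>S r. (idm C L \<boxtimes> inc r) \<cdot> ((jnc r s \<cdot> qrj r s) \<cdot> (idm C L \<boxtimes> prj r)))"
      by (rule sum.Sigma[symmetric]) (use D(1) E(1) in auto)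
    also have "\<dots> = (\<Sum>r\<in>J. idm C L \<boxtimes> (inc r \<cdot> prj r))"
    proof (rule sum.cong[OF refl])
      fix r assume r: "r \<in> J"
      have "(\<Sum>s\<in>S r. (idm C L \<boxtimes> inc r) \<cdot> ((jnc r s \<cdot> qrj r s) \<cdot> (idm C L \<boxtimes> prj r)))
        = (idm C L \<boxtimes> inc r) \<cdot> (\<Sum>s\<in>S r. (jnc r s \<cdot> qrj r s) \<cdot> (idm C L \<boxtimes> prj r))"
        by (rule cmp_sum_right[OF I[OF r], symmetric]) (use E[OF r] P[OF r] in \<open>auto intro!: cmp_hom\<close>)
      also have "(\<Sum>s\<in>S r. (jnc r s \<cdot> qrj r s) \<cdot> (idm C L \<boxtimes> prj r)) = (\<Sum>s\<in>S r. jnc r s \<cdot> qrj r s) \<cdot> (idm C L \<boxtimes> prj r)"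
        by (rule cmp_sum_left[OF _ P[OF r], symmetric]) (use E[OF r] in \<open>auto intro!: cmp_hom\<close>)
      finally show "(\<Sum>s\<in>S r. (idm C L \<boxtimes> inc r) \<cdot> ((jnc r s \<cdot> qrj r s) \<cdot> (idm C L \<boxtimes> prj r))) = idm C L \<boxtimes> (inc r \<cdot> prj r)"
        using E(5)[OF r] cmp_idm_left[OF P[OF r]] IP[OF r r] by simp
    qed
    also have "\<dots> = idm C L \<boxtimes> (\<Sum>r\<in>J. inc r \<cdot> prj r)"
      by (rule tensm_sum_right[OF idm_hom, symmetric]) (use D in \<open>auto intro!: cmp_hom\<close>)
    finally show "(\<Sum>j\<in>Sigma J S. (case j of (r, s) \<Rightarrow> (idm C L \<boxtimes> inc r) \<cdot> jnc r s) \<cdot> (case j of (r, s) \<Rightarrow> qrj r s \<cdot> (idm C L \<boxtimes> prj r)))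
      = idm C (L \<otimes> W)" unfolding D(5) by (simp add: tensm_idm)
  qed
qed

end

locale simple_representatives = equivariant_fusion_category C
  for C :: "('o, 'm::ab_group_add, 'g::{group_add, finite}, 'z) eqcat_scheme" (structure) +
  fixes I :: "'o set"
  assumes reps: "simple_reps C I" and fin: "finite I"
begin

lemma rep_simple: "i \<in> I \<Longrightarrow> simple C i" and unt_rep: "\<one> \<in> I"
  using reps by (auto simp: simple_reps_def)

lemma rep_unique: "\<lbrakk>i \<in> I; j \<in> I; isomorphic C i j\<rbrakk> \<Longrightarrow> i = j"
proof -
  assume *: "i \<in> I" "j \<in> I" "isomorphic C i j"
  have "\<exists>!k. k \<in> I \<and> isomorphic C i k" using reps rep_simple[OF *(1)] unfolding simple_reps_def by blast
  then obtain k where k: "\<And>x. x \<in> I \<and> isomorphic C i x \<Longrightarrow> x = k" unfolding Ex1_def by blast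
  have "i = k" "j = k" using * isomorphic_refl[of i] by (auto intro: k)
  then show "i = j" by simp
qed

lemma rep_hom_zero: "\<lbrakk>i \<in> I; j \<in> I; i \<noteq> j; f \<in> hom C i j\<rbrakk> \<Longrightarrow> f = 0"
  by (rule Schur_zero[OF rep_simple rep_simple]) (auto dest: rep_unique)

lemma idm_nonzero: "i \<in> I \<Longrightarrow> idm C i \<noteq> 0"
  using rep_simple by (simp add: simple_def)

lemma sing_zero [simp]: "sing g i 0 = 0"
  by (auto simp: sing_def fun_eq_iff)

lemma sing_add: "sing g i (a + b) = sing g i a + sing g i b"
  by (auto simp: sing_def fun_eq_iff)

text \<open>The decomposition is picked from V alone, so the same one serves every g and every
  morphism; additivity of \<open>cls\<close> rests on this.\<close>

lemma cls_spec:
  obtains n X inc prj where "\<And>r. r < n \<Longrightarrow> X r \<in> I" "direct_sum C {..<n::nat} X V inc prj"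
    "\<And>g \<phi>. cls C I g V \<phi> = (\<Sum>r<n. sing g (X r) (actm C g (prj r) \<cdot> \<phi> \<cdot> inc r))"
proof -
  let ?P = "\<lambda>(n, X, inc, prj). (\<forall>r<n. X r \<in> I) \<and> direct_sum C {..<n::nat} X V inc prj"
  have "\<exists>t. ?P t" using simple_reps_decomposition[OF reps, of V] by auto
  then have s: "?P (Eps ?P)" by (rule someI_ex)
  obtain n X inc prj where t: "Eps ?P = (n, X, inc, prj)" by (rule prod_cases4)
  show ?thesis
  proof (rule that)
    show "\<And>r. r < n \<Longrightarrow> X r \<in> I" "direct_sum C {..<n::nat} X V inc prj" using s unfolding t by auto
    show "\<And>g \<phi>. cls C I g V \<phi> = (\<Sum>r<n. sing g (X r) (actm C g (prj r) \<cdot> \<phi> \<cdot> inc r))"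
      unfolding cls_def t by simp
  qed
qed

lemma cls_zero: "cls C I g V 0 = 0"
proof -
  obtain n X inc prj where d: "\<And>r. r < n \<Longrightarrow> X r \<in> I" "direct_sum C {..<n::nat} X V inc prj"
    "\<And>g \<phi>. cls C I g V \<phi> = (\<Sum>r<n. sing g (X r) (actm C g (prj r) \<cdot> \<phi> \<cdot> inc r))" using cls_spec[of V] by blast
  note D = direct_sumD[OF d(2)]
  have "actm C g (prj r) \<cdot> 0 \<cdot> inc r = 0" if "r < n" for r
    using D(2,3)[of r] that by (simp add: cmp_zero_left cmp_zero_right[OF actm_hom])
  then show ?thesis by (simp add: d(3))
qed

lemma cls_sum:
  assumes "\<And>a. a \<in> A \<Longrightarrow> F a \<in> hom C V (act C g V)"
  shows "cls C I g V (\<Sum>a\<in>A. F a) = (\<Sum>a\<in>A. cls C I g V (F a))"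
proof -
  obtain n X inc prj where d: "\<And>r. r < n \<Longrightarrow> X r \<in> I" "direct_sum C {..<n::nat} X V inc prj"
    "\<And>g \<phi>. cls C I g V \<phi> = (\<Sum>r<n. sing g (X r) (actm C g (prj r) \<cdot> \<phi> \<cdot> inc r))" using cls_spec[of V] by blast
  note D = direct_sumD[OF d(2)]
  have "actm C g (prj r) \<cdot> (\<Sum>a\<in>A. F a) \<cdot> inc r = (\<Sum>a\<in>A. actm C g (prj r) \<cdot> F a \<cdot> inc r)" if r: "r < n" for r
  proof -
    have "(\<Sum>a\<in>A. F a) \<cdot> inc r = (\<Sum>a\<in>A. F a \<cdot> inc r)"
      by (rule cmp_sum_left[OF assms D(2)[of r]]) (use r in auto)
    moreover have "actm C g (prj r) \<cdot> (\<Sum>a\<in>A. F a \<cdot> inc r) = (\<Sum>a\<in>A. actm C g (prj r) \<cdot> F a \<cdot> inc r)"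
      by (rule cmp_sum_right[OF actm_hom[OF D(3)[of r]] cmp_hom[OF assms D(2)[of r]]]) (use r in auto)
    ultimately show ?thesis by simp
  qed
  moreover have "sing g i (\<Sum>a\<in>A. G a) = (\<Sum>a\<in>A. sing g i (G a))" for i :: 'o and G :: "_ \<Rightarrow> 'm"
    by (induction A rule: infinite_finite_induct) (simp_all add: sing_add)
  ultimately show ?thesis by (simp add: d(3) sum.swap[of _ A])
qed

lemma cls_off: "m \<noteq> g \<Longrightarrow> cls C I g V \<phi> m i = 0"
proof -
  assume "m \<noteq> g"
  obtain n X inc prj where d: "\<And>r. r < n \<Longrightarrow> X r \<in> I" "direct_sum C {..<n::nat} X V inc prj"
    "\<And>g \<phi>. cls C I g V \<phi> = (\<Sum>r<n. sing g (X r) (actm C g (prj r) \<cdot> \<phi> \<cdot> inc r))" using cls_spec[of V] by blast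
  have "(\<Sum>r<n. sing g (X r) (F r)) m i = 0" for F :: "nat \<Rightarrow> 'm"
    by (induction n) (auto simp: sing_def \<open>m \<noteq> g\<close>)
  then show ?thesis by (simp add: d(3))
qed

lemma sum_sing_apply: "(\<Sum>r\<in>A. sing g (X r) (F r)) m i = (\<Sum>r\<in>A. if m = g \<and> i = X r then F r else 0)"
  by (induction A rule: infinite_finite_induct) (auto simp: sing_def)

text \<open>Every inclusion of a unit summand is a multiple of b. Hence there is at most one such
  summand, none if b = 0, and the diagonal entry of p there is determined by the effect of p on
  b.\<close>

lemma unit_component:
  assumes d: "direct_sum C J Y V inc prj" and Y: "\<And>j. j \<in> J \<Longrightarrow> Y j \<in> I"
    and b: "b \<in> hom C \<one> V" "\<And>f. f \<in> hom C \<one> V \<Longrightarrow> \<exists>c. f = scl C c b"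
    and p: "p \<in> hom C V (act C h V)" "p \<cdot> b = scl C t (actm C h b \<cdot> act_unt C h)"
  shows "(\<Sum>j\<in>J. if \<one> = Y j then actm C h (prj j) \<cdot> p \<cdot> inc j else 0) = (if b = 0 then 0 else scl C t (act_unt C h))"
proof -
  note D = direct_sumD[OF d]
  have u: "act_unt C h \<in> hom C \<one> (act C h \<one>)" using act_unt_iso iso_hom by blast
  let ?J = "{j \<in> J. Y j = \<one>}"
  have inc: "\<exists>c. inc j = scl C c b" if "j \<in> ?J" for j using D(2)[of j] b(2) that by fastforce
  have one: "actm C h (prj j) \<cdot> p \<cdot> inc j = scl C t (act_unt C h)" if j: "j \<in> ?J" for j
  proof -
    obtain c where c: "inc j = scl C c b" using inc[OF j] by blast
    have i: "inc j \<in> hom C \<one> V" and q: "prj j \<in> hom C V \<one>" and e: "prj j \<cdot> inc j = idm C \<one>"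
      using D(2)[of j] D(3)[of j] D(4)[of j j] j by auto
    have "p \<cdot> inc j = scl C c (scl C t (actm C h b \<cdot> act_unt C h))"
      using p b(1) by (simp add: c cmp_scl_right)
    also have "\<dots> = scl C t (actm C h (inc j) \<cdot> act_unt C h)"
      using cmp_scl_left[OF actm_hom[OF b(1)] u] b(1) by (simp add: c actm_scl mult.commute)
    finally have "actm C h (prj j) \<cdot> p \<cdot> inc j = scl C t (actm C h (prj j) \<cdot> actm C h (inc j) \<cdot> act_unt C h)"
      using cmp_scl_right[OF actm_hom[OF q] cmp_hom[OF actm_hom[OF i] u]] by simp
    also have "actm C h (prj j) \<cdot> actm C h (inc j) \<cdot> act_unt C h = actm C h (prj j \<cdot> inc j) \<cdot> act_unt C h"
      using cmp_assoc[OF actm_hom[OF q] actm_hom[OF i] u] actm_cmp[OF q i] by simp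
    finally show ?thesis using e cmp_idm_left[OF u] by (simp add: actm_idm)
  qed
  have "(\<Sum>j\<in>J. if \<one> = Y j then actm C h (prj j) \<cdot> p \<cdot> inc j else 0) = (\<Sum>j\<in>?J. actm C h (prj j) \<cdot> p \<cdot> inc j)"
    using D(1) by (intro sum.mono_neutral_cong_right) auto
  also have "\<dots> = (\<Sum>j\<in>?J. scl C t (act_unt C h))" by (intro sum.cong one) auto
  finally have S: "(\<Sum>j\<in>J. if \<one> = Y j then actm C h (prj j) \<cdot> p \<cdot> inc j else 0) = (\<Sum>j\<in>?J. scl C t (act_unt C h))" .
  show ?thesis
  proof (cases "b = 0")
    case True
    have "?J = {}"
    proof (rule ccontr)
      assume "?J \<noteq> {}"
      then obtain j where j: "j \<in> J" "Y j = \<one>" by blast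
      then have "inc j = 0" using inc[of j] True by auto
      then have "idm C \<one> = 0" using D(4)[of j j] j cmp_zero_right[OF D(3)[of j]] by simp
      then show False using idm_nonzero[OF unt_rep] by simp
    qed
    with True show ?thesis unfolding S by (simp only: if_True sum.empty simp_thms)
  next
    case False
    \<comment> \<open>Without a unit summand all components of b vanish by Schur's lemma, and then
      so does b.\<close>
    have "\<exists>j. j \<in> ?J"
    proof (rule ccontr)
      assume n: "\<not> ?thesis"
      have "prj j \<cdot> b = 0" if "j \<in> J" for j
        using rep_hom_zero[OF unt_rep Y[OF that] _ cmp_hom[OF D(3)[OF that] b(1)]] n that by auto
      then have "inc j \<cdot> (prj j \<cdot> b) = 0" if "j \<in> J" for j using that cmp_zero_right[OF D(2)] by simp
      then have "(\<Sum>j\<in>J. (inc j \<cdot> prj j) \<cdot> b) = 0"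
        using cmp_assoc[OF D(2) D(3) b(1)] by simp
      moreover have "(\<Sum>j\<in>J. (inc j \<cdot> prj j) \<cdot> b) = (\<Sum>j\<in>J. inc j \<cdot> prj j) \<cdot> b"
        by (rule cmp_sum_left[OF _ b(1), symmetric]) (use D cmp_hom in blast)
      ultimately show False using False D(5) cmp_idm_left[OF b(1)] by simp
    qed
    then obtain j where j: "j \<in> ?J" by blast
    \<comment> \<open>Two unit summands would have proportional inclusions, against the
      orthogonality of projections and inclusions.\<close>
    have "?J = {j}"
    proof (rule ccontr)
      assume "?J \<noteq> {j}"
      then obtain k where k: "k \<in> ?J" "k \<noteq> j" using j by blast
      obtain c where c: "inc j = scl C c b" using inc[OF j] by blast
      obtain c' where c': "inc k = scl C c' b" using inc[OF k(1)] by blast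
      have q: "prj j \<in> hom C V \<one>" using D(3)[of j] j by auto
      have "prj j \<cdot> inc j = idm C \<one>" "prj j \<cdot> inc k = 0" using D(4)[of j j] D(4)[of j k] j k by auto
      then have e: "scl C c (prj j \<cdot> b) = idm C \<one>" "scl C c' (prj j \<cdot> b) = 0"
        unfolding c c' using cmp_scl_right[OF q b(1)] by auto
      then have "prj j \<cdot> b \<noteq> 0" using idm_nonzero[OF unt_rep] by auto
      with e(2) have "c' = 0" by simp
      then have "inc k = 0" using c' by simp
      then have "idm C \<one> = 0" using D(4)[of k k] k(1) cmp_zero_right[OF D(3)[of k]] by simp
      then show False using idm_nonzero[OF unt_rep] by simp
    qed
    with False show ?thesis unfolding S by simp
  qed
qed

end

section \<open>The bilinear form\<close>

context pivotal_category
begin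

lemma Dualm_zero: "Dualm (Arr X Y 0) = Arr (dual C Y) (dual C X) 0"
proof -
  let ?f = "Arr X Y 0"
  have "Dualm ?f = Lun (dual C X) \<odot> (Ev Y \<rhd> dual C X) \<odot> inva (Asc (dual C Y) Y (dual C X)) \<odot>
    (dual C Y \<lhd> ((?f \<rhd> dual C X) \<odot> Coev X)) \<odot> inva (Run (dual C Y))"
    unfolding Dualm_Transp by (simp add: Transp_alt del: lw_comp rw_comp)
  also have "\<dots> = Arr (dual C Y) (dual C X) 0"
    by (simp add: rw_zero lw_zero comp_zero_left comp_zero_right del: lw_comp)
  finally show ?thesis .
qed

end

section \<open>The action preserves simple objects\<close>

context action_category
begin

lemma adj_zero: "adj C g V 0 = 0"
proof -
  have "adj C g V 0 = mor (Adj g V (Arr V (act C g V) 0))" by (simp add: mor_Adj)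
  also have "\<dots> = 0" by (simp add: Adj_def Dualm_zero comp_zero_right)
  finally show ?thesis .
qed

text \<open>R_g is an equivalence with inverse R_{g^-1}: the two test arrows are transported to
  R_{g^-1} W -> Y, where f can be cancelled, and are recovered from their images.\<close>

lemma mono_Act:
  assumes f: "mono_mor C Y Z f"
  shows "mono_mor C (act C g Y) (act C g Z) (actm C g f)"
  unfolding mono_mor_def
proof (intro conjI allI ballI impI)
  have fh: "f \<in> hom C Y Z" using f by (simp add: mono_mor_def)
  show "actm C g f \<in> hom C (act C g Y) (act C g Z)" by (rule actm_hom[OF fh])
  fix W u v assume u: "u \<in> hom C W (act C g Y)" and v: "v \<in> hom C W (act C g Y)"
    and eq: "actm C g f \<cdot> u = actm C g f \<cdot> v"
  define F where "F = Arr Y Z f"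
  have F [simp]: "val F" "src F = Y" "tgt F = Z" using fh by (simp_all add: F_def)
  let ?c = "\<lambda>u. ActC (- g) g Y \<odot> Act (- g) (Arr W (act C g Y) u)"
  have 1: "F \<odot> ?c w = ActC (- g) g Z \<odot> Act (- g) (Act g F \<odot> Arr W (act C g Y) w)" if "w \<in> hom C W (act C g Y)" for w
  proof -
    have "ActC (- g) g Z \<odot> Act (- g) (Act g F \<odot> Arr W (act C g Y) w)
      = (ActC (- g) g Z \<odot> Act (- g) (Act g F)) \<odot> Act (- g) (Arr W (act C g Y) w)" using that by simp
    also have "\<dots> = F \<odot> ?c w" using that by (subst ActC_nat) (simp_all add: Act_zero)
    finally show ?thesis by simp
  qed
  have 2: "Act g F \<odot> Arr W (act C g Y) u = Act g F \<odot> Arr W (act C g Y) v"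
    using eq by (simp add: comp_def Act_def F_def)
  have "F \<odot> ?c u = F \<odot> ?c v" unfolding 1[OF u] 1[OF v] 2 ..
  then have "f \<cdot> mor (?c u) = f \<cdot> mor (?c v)" by (simp add: F_def comp_def)
  moreover have "mor (?c w) \<in> hom C (act C (- g) W) Y" if "w \<in> hom C W (act C g Y)" for w
  proof -
    have "val (?c w)" using that by simp
    then show ?thesis unfolding val_def by simp
  qed
  ultimately have "mor (?c u) = mor (?c v)" using f u v unfolding mono_mor_def by blast
  then have "?c u = ?c v" by (simp add: comp_def)
  then have A: "Act (- g) (Arr W (act C g Y) u) = Act (- g) (Arr W (act C g Y) v)"
    by (rule isoa_cancel_left) (use u v in simp_all)
  have "Arr W (act C g Y) w \<odot> ActC g (- g) W = ActC g (- g) (act C g Y) \<odot> Act g (Act (- g) (Arr W (act C g Y) w))"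
    if "w \<in> hom C W (act C g Y)" for w
    using that by (subst ActC_nat) (simp_all add: Act_zero)
  then have "Arr W (act C g Y) u \<odot> ActC g (- g) W = Arr W (act C g Y) v \<odot> ActC g (- g) W"
    using A u v by simp
  then have "Arr W (act C g Y) u = Arr W (act C g Y) v"
    by (rule isoa_cancel_right) (use u v in simp_all)
  then show "u = v" by simp
qed

text \<open>Under R_{g^-1} a monomorphism into R_g X becomes one into a copy of X, so it is zero or
  invertible there; applying R_g carries this back.\<close>

lemma simple_act:
  assumes X: "simple C X"
  shows "simple C (act C g X)"
  unfolding simple_def
proof (intro conjI allI impI)
  have iX: "iso C (act C (- g) (act C g X)) X (act_cmp C (- g) g X)"
    using act_cmp_iso[of "- g" g X] by simp
  have s: "simple C (act C (- g) (act C g X))" by (rule simple_iso[OF X iso_sym[OF iX]])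
  show "idm C (act C g X) \<noteq> 0"
  proof
    assume "idm C (act C g X) = 0"
    moreover have "actm C (- g) 0 = 0" using actm_scl[of 0 X X "- g" 0] by simp
    ultimately have "idm C (act C (- g) (act C g X)) = 0" using actm_idm[of "- g" "act C g X"] by simp
    with s show False by (simp add: simple_def)
  qed
  fix Y f assume f: "mono_mor C Y (act C g X) f"
  then have fh: "f \<in> hom C Y (act C g X)" by (simp add: mono_mor_def)
  define F where "F = Arr Y (act C g X) f"
  have F [simp]: "val F" "src F = Y" "tgt F = act C g X" using fh by (simp_all add: F_def)
  \<comment> \<open>f is recovered from R_{g^-1} f by applying R_g and conjugating with the
    compositors.\<close>
  have e: "F = ActC g (- g) (act C g X) \<odot> Act g (Act (- g) F) \<odot> inva (ActC g (- g) Y)"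
  proof -
    have "ActC g (- g) (act C g X) \<odot> Act g (Act (- g) F) \<odot> inva (ActC g (- g) Y)
      = (ActC g (- g) (act C g X) \<odot> Act g (Act (- g) F)) \<odot> inva (ActC g (- g) Y)" by simp
    also have "\<dots> = F" by (subst ActC_nat) (simp_all add: Act_zero)
    finally show ?thesis by simp
  qed
  have "actm C (- g) f = 0 \<or> iso C (act C (- g) Y) (act C (- g) (act C g X)) (actm C (- g) f)"
    using mono_Act[OF f, of "- g"] s unfolding simple_def by blast
  then show "f = 0 \<or> iso C Y (act C g X) f"
  proof
    assume "actm C (- g) f = 0"
    then have "Act (- g) F = Arr (act C (- g) Y) (act C (- g) (act C g X)) 0" by (simp add: F_def Act_def)
    moreover have "Act g (Arr U V 0) = Arr (act C g U) (act C g V) 0" for U V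
      using actm_scl[of 0 U V g 0] by (simp add: Act_def)
    ultimately have "F = Arr Y (act C g X) 0"
      by (subst e) (simp add: comp_zero_left comp_zero_right)
    then show ?thesis by (simp add: F_def)
  next
    assume "iso C (act C (- g) Y) (act C (- g) (act C g X)) (actm C (- g) f)"
    then have "isoa (Act (- g) F)" by (simp add: isoa_def Act_def F_def)
    then have "isoa F" by (subst e) simp
    then show ?thesis by (simp add: isoa_def F_def)
  qed
qed

end

section \<open>Evaluation of the form on a basis vector\<close>

context simple_representatives
begin

text \<open>The canonical isomorphisms \<open>act_unt\<close> are nonzero, which makes the scalars
  described by \<open>THE\<close> in \<open>br0\<close> unique.\<close>

lemma br0_unit:
  assumes "\<And>m. x m \<one> = (if m = h then scl C t (act_unt C h) else 0)"
  shows "br0 C x = t"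
proof -
  have u: "act_unt C m \<noteq> 0" for m
  proof
    assume "act_unt C m = 0"
    then have "iso C \<one> (act C m \<one>) 0" using act_unt_iso[of m] by simp
    then have "idm C \<one> = 0" using minv_cmp cmp_zero_right[OF minv_hom] by metis
    then show False using idm_nonzero[OF unt_rep] by simp
  qed
  have "(THE s. x m \<one> = scl C s (act_unt C m)) = (if m = h then t else 0)" for m
    using u[of m] by (intro the_equality) (auto simp: assms split: if_splits)
  then show ?thesis by (simp add: br0_def)
qed

lemma vstar_sing:
  assumes "k \<in> I"
  shows "vstar C I (sing g k f) = cls C I (- g) (dual C (act C g k)) (adj C g k f)"
proof -
  have "cls C I (- m) (dual C (act C m i)) (adj C m i (sing g k f m i))
    = (if m = g then if i = k then cls C I (- g) (dual C (act C g k)) (adj C g k f) else 0 else 0)" for m i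
    by (auto simp: sing_def adj_zero cls_zero)
  then have "vstar C I (sing g k f) = (\<Sum>m\<in>UNIV. \<Sum>i\<in>I. (if m = g then if i = k then cls C I (- g) (dual C (act C g k)) (adj C g k f) else 0 else 0))"
    unfolding vstar_def by simp
  also have "\<dots> = (\<Sum>m\<in>UNIV. if m = g then (\<Sum>i\<in>I. if i = k then cls C I (- g) (dual C (act C g k)) (adj C g k f) else 0) else 0)"
    by (intro sum.cong) auto
  finally show ?thesis using assms fin by simp
qed

text \<open>By \<open>Coev_transpose\<close> such a morphism is a coevaluation followed by some R_g
  k -> i; composed with \<open>P\<close> the latter becomes k -> i, where Schur's lemma
  applies.\<close>

lemma hom_unit_tens_dual:
  assumes i: "i \<in> I" and k: "k \<in> I" and p: "isoa P" "src P = k" "tgt P = act C g k"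
    and f: "f \<in> hom C \<one> (i \<otimes> dual C (act C g k))"
  shows "\<exists>c. f = scl C c (if i = k then mor ((inva P \<rhd> dual C (act C g k)) \<odot> Coev (act C g k)) else 0)"
proof -
  let ?U = "act C g k" and ?W = "dual C (act C g k)"
  note [simp] = p
  define F where "F = Arr \<one> (i \<otimes> ?W) f"
  have F [simp]: "val F" "src F = \<one>" "tgt F = i \<otimes> ?W" using f by (simp_all add: F_def)
  define T where "T = Run i \<odot> (i \<lhd> Ev ?U) \<odot> Asc i ?W ?U \<odot> (F \<rhd> ?U) \<odot> inva (Lun ?U)"
  have T [simp]: "val T" "src T = ?U" "tgt T = i" by (simp_all add: T_def)
  have FT: "F = (T \<rhd> ?W) \<odot> Coev ?U" unfolding T_def by (rule Coev_transpose) simp_all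
  have "val (T \<odot> P)" by simp
  then have TP: "mor (T \<odot> P) \<in> hom C k i" unfolding val_def by simp
  show ?thesis
  proof (cases "i = k")
    case True
    obtain c where c: "mor (T \<odot> P) = scl C c (idm C k)" using Schur_scalar[OF rep_simple[OF k]] TP True by blast
    have "T = (T \<odot> P) \<odot> inva P" by simp
    then have "mor T = mor (T \<odot> P) \<cdot> mor (inva P)" by (metis mor_comp)
    also have "\<dots> = scl C c (mor (inva P))"
      using c cmp_scl_left[OF idm_hom] cmp_idm_left val_inva[OF p(1)] by (simp add: val_def)
    finally have mT: "mor T = scl C c (mor (inva P))" .
    have iP: "mor (inva P) \<in> hom C ?U k" using val_inva[OF p(1)] by (simp add: val_def)
    have Cf: "mor (Coev ?U) \<in> hom C \<one> (?U \<otimes> ?W)" using val_Coev[of ?U] by (simp add: val_def)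
    have "f = mor ((T \<rhd> ?W) \<odot> Coev ?U)" using FT by (metis F_def arr.sel(3))
    also have "\<dots> = scl C c (mor (inva P) \<boxtimes> idm C ?W) \<cdot> mor (Coev ?U)"
      by (simp add: mor_comp rw_def mT tensm_scl_left[OF iP idm_hom])
    also have "\<dots> = scl C c (mor ((inva P \<rhd> ?W) \<odot> Coev ?U))"
      using cmp_scl_left[OF tensm_hom[OF iP idm_hom] Cf] by (simp add: mor_comp rw_def)
    finally show ?thesis using True by auto
  next
    case False
    have "mor T \<cdot> mor P = 0" using rep_hom_zero[OF k i _ TP] False by (simp add: mor_comp)
    then have "mor T = 0" using cmp_eq_zero_iso[of k ?U "mor P" "mor T" i] p T by (simp add: isoa_def val_def)
    then have "T = Arr ?U i 0" by (metis T(2,3) arr.collapse)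
    then have "F = Arr \<one> (i \<otimes> ?W) 0" using FT by (simp add: rw_zero comp_zero_left)
    then show ?thesis using False by (simp add: F_def)
  qed
qed

text \<open>Only degree -g of the product contributes to the form. There the class on each i (x) W
  is read off at the unit, and with all decompositions merged \<open>unit_component\<close> yields t
  for i = k and 0 for the other i.\<close>

lemma vform_sing:
  assumes k: "k \<in> I" and p: "iso C k (act C g k) q"
    and xh: "\<And>m i. i \<in> I \<Longrightarrow> x m i \<in> hom C i (act C m i)"
    and t: "act_cmp C (- g) g k \<cdot> actm C (- g) q \<cdot> x (- g) k = scl C t (idm C k)"
  shows "vform C I x (sing g k q) = t"
proof -
  let ?U = "act C g k" and ?h = "- g"
  define W where "W = dual C ?U"
  define P where "P = Arr k ?U q"
  have P [simp]: "isoa P" "src P = k" "tgt P = ?U" "mor P = q" using p by (simp_all add: P_def isoa_def)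
  define a where "a = adj C g k q"
  have Adj: "Adj g k P = Arr W (act C ?h W) a"
    using mor_Adj[of P k g] by (cases "Adj g k P") (metis P(2,3,4) W_def a_def arr.sel src_Adj tgt_Adj)
  have a: "a \<in> hom C W (act C ?h W)" using val_Adj[of P k g] unfolding Adj by simp
  obtain n X inc prj where d: "\<And>r. r < n \<Longrightarrow> X r \<in> I" "direct_sum C {..<n::nat} X W inc prj"
    "\<And>g \<phi>. cls C I g W \<phi> = (\<Sum>r<n. sing g (X r) (actm C g (prj r) \<cdot> \<phi> \<cdot> inc r))" using cls_spec[of W] by blast
  note D = direct_sumD[OF d(2)]
  \<comment> \<open>The class of the adjoint retains its diagonal entries, as separate morphisms on
    the summands \<open>X r\<close> of W.\<close>
  define al where "al r = actm C ?h (prj r) \<cdot> a \<cdot> inc r" for r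
  have al: "al r \<in> hom C (X r) (act C ?h (X r))" if "r < n" for r
    unfolding al_def using that D(2,3)[of r] a by (auto intro!: cmp_hom actm_hom)
  define y where "y = vstar C I (sing g k q)"
  have "y = (\<Sum>r<n. sing ?h (X r) (al r))"
    unfolding y_def vstar_sing[OF k] W_def[symmetric] a_def[symmetric] d(3) al_def ..
  then have y: "y m j = (\<Sum>r<n. if m = ?h \<and> j = X r then al r else 0)" for m j
    by (simp add: sum_sing_apply)
  let ?F = "vtens C I x y"
  have F: "?F m \<one> = (\<Sum>i\<in>I. \<Sum>j\<in>I. cls C I m (i \<otimes> j) (act_tens C m i j \<cdot> (x m i \<boxtimes> y m j)) m \<one>)" for m
  proof -
    have "?F m \<one> = (\<Sum>g\<in>UNIV. \<Sum>i\<in>I. \<Sum>j\<in>I. cls C I g (i \<otimes> j) (act_tens C g i j \<cdot> (x g i \<boxtimes> y g j)) m \<one>)"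
      by (simp add: vtens_def sum_apply2)
    also have "\<dots> = (\<Sum>g\<in>UNIV. if g = m then \<Sum>i\<in>I. \<Sum>j\<in>I. cls C I g (i \<otimes> j) (act_tens C g i j \<cdot> (x g i \<boxtimes> y g j)) m \<one> else 0)"
      by (intro sum.cong) (auto simp: cls_off)
    finally show ?thesis by simp
  qed
  have T: "act_tens C m i j \<in> hom C (act C m i \<otimes> act C m j) (act C m (i \<otimes> j))" for m i j
    using act_tens_iso iso_hom by blast
  have main: "(\<Sum>j\<in>I. cls C I ?h (i \<otimes> j) (act_tens C ?h i j \<cdot> (x ?h i \<boxtimes> y ?h j)) ?h \<one>)
     = (if i = k then scl C t (act_unt C ?h) else 0)" if i: "i \<in> I" for i
  proof -
    have G: "act_tens C ?h i (X r) \<cdot> (x ?h i \<boxtimes> al r) \<in> hom C (i \<otimes> X r) (act C ?h (i \<otimes> X r))" if "r < n" for r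
      using T xh[OF i] al[OF that] by (blast intro: cmp_hom tensm_hom)
    have "cls C I ?h (i \<otimes> j) (act_tens C ?h i j \<cdot> (x ?h i \<boxtimes> y ?h j))
      = (\<Sum>r<n. if j = X r then cls C I ?h (i \<otimes> X r) (act_tens C ?h i (X r) \<cdot> (x ?h i \<boxtimes> al r)) else 0)" for j
    proof -
      have 1: "(if j = X r then al r else 0) \<in> hom C j (act C ?h j)" if "r < n" for r using al[OF that] by simp
      have "x ?h i \<boxtimes> y ?h j = (\<Sum>r<n. x ?h i \<boxtimes> (if j = X r then al r else 0))"
        unfolding y by (simp, rule tensm_sum_right[OF xh[OF i] 1]) simp
      then have "act_tens C ?h i j \<cdot> (x ?h i \<boxtimes> y ?h j) = (\<Sum>r<n. act_tens C ?h i j \<cdot> (x ?h i \<boxtimes> (if j = X r then al r else 0)))"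
        using cmp_sum_right[OF T tensm_hom[OF xh[OF i] 1], of "{..<n}" "\<lambda>r. r"] by simp
      then have "cls C I ?h (i \<otimes> j) (act_tens C ?h i j \<cdot> (x ?h i \<boxtimes> y ?h j)) =
         (\<Sum>r<n. cls C I ?h (i \<otimes> j) (act_tens C ?h i j \<cdot> (x ?h i \<boxtimes> (if j = X r then al r else 0))))"
        using cls_sum[OF cmp_hom[OF T tensm_hom[OF xh[OF i] 1]], of "{..<n}" "\<lambda>r. r"] by simp
      also have "\<dots> = (\<Sum>r<n. if j = X r then cls C I ?h (i \<otimes> X r) (act_tens C ?h i (X r) \<cdot> (x ?h i \<boxtimes> al r)) else 0)"
        by (intro sum.cong) (auto simp: tensm_zero_right[OF xh[OF i]] cmp_zero_right[OF T] cls_zero)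
      finally show ?thesis .
    qed
    then have "(\<Sum>j\<in>I. cls C I ?h (i \<otimes> j) (act_tens C ?h i j \<cdot> (x ?h i \<boxtimes> y ?h j)))
      = (\<Sum>j\<in>I. \<Sum>r<n. if j = X r then cls C I ?h (i \<otimes> X r) (act_tens C ?h i (X r) \<cdot> (x ?h i \<boxtimes> al r)) else 0)" by simp
    also have "\<dots> = (\<Sum>r<n. \<Sum>j\<in>I. if j = X r then cls C I ?h (i \<otimes> X r) (act_tens C ?h i (X r) \<cdot> (x ?h i \<boxtimes> al r)) else 0)"
      by (rule sum.swap)
    also have "\<dots> = (\<Sum>r<n. cls C I ?h (i \<otimes> X r) (act_tens C ?h i (X r) \<cdot> (x ?h i \<boxtimes> al r)))"
      using d(1) fin by (intro sum.cong) auto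
    finally have S: "(\<Sum>j\<in>I. cls C I ?h (i \<otimes> j) (act_tens C ?h i j \<cdot> (x ?h i \<boxtimes> y ?h j)))
      = (\<Sum>r<n. cls C I ?h (i \<otimes> X r) (act_tens C ?h i (X r) \<cdot> (x ?h i \<boxtimes> al r)))" .
    \<comment> \<open>The decompositions that \<open>cls\<close> picks for the products of i with
      the \<open>X r\<close>, named for all r at once.\<close>
    have "\<forall>r. \<exists>N Y jnc qrj. (\<forall>s<N. Y s \<in> I) \<and> direct_sum C {..<N::nat} Y (i \<otimes> X r) jnc qrj \<and>
      (\<forall>g \<phi>. cls C I g (i \<otimes> X r) \<phi> = (\<Sum>s<N. sing g (Y s) (actm C g (qrj s) \<cdot> \<phi> \<cdot> jnc s)))"
      by (rule allI, rule cls_spec) blast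
    from this[unfolded choice_iff] obtain N Y jnc qrj where e: "\<forall>r. (\<forall>s<N r. Y r s \<in> I) \<and> direct_sum C {..<N r::nat} (Y r) (i \<otimes> X r) (jnc r) (qrj r) \<and>
      (\<forall>g \<phi>. cls C I g (i \<otimes> X r) \<phi> = (\<Sum>s<N r. sing g (Y r s) (actm C g (qrj r s) \<cdot> \<phi> \<cdot> jnc r s)))"
      by (elim exE)
    have e: "\<And>r s. s < N r \<Longrightarrow> Y r s \<in> I" "\<And>r. direct_sum C {..<N r::nat} (Y r) (i \<otimes> X r) (jnc r) (qrj r)"
      "\<And>r g \<phi>. cls C I g (i \<otimes> X r) \<phi> = (\<Sum>s<N r. sing g (Y r s) (actm C g (qrj r s) \<cdot> \<phi> \<cdot> jnc r s))"
      using e by simp_all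
    let ?J = "SIGMA r:{..<n}. {..<N r}"
    have ds: "direct_sum C ?J (\<lambda>(r, s). Y r s) (i \<otimes> W) (\<lambda>(r, s). (idm C i \<boxtimes> inc r) \<cdot> jnc r s)
      (\<lambda>(r, s). qrj r s \<cdot> (idm C i \<boxtimes> prj r))"
      by (rule direct_sum_tens[OF d(2) e(2)])
    define XI where "XI = Arr i (act C ?h i) (x ?h i)"
    have XI [simp]: "val XI" "src XI = i" "tgt XI = act C ?h i" using xh[OF i] by (simp_all add: XI_def)
    define AA where "AA = Arr W (act C ?h W) a"
    have AA [simp]: "val AA" "src AA = W" "tgt AA = act C ?h W" using a by (simp_all add: AA_def)
    \<comment> \<open>The product of x with the adjoint on the undivided i (x) W; its diagonal
      entries in the merged decomposition are the terms of the double sum, by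
      \<open>summand\<close>.\<close>
    define PH where "PH = ActT ?h i W \<odot> (XI \<rhd> act C ?h W) \<odot> (i \<lhd> AA)"
    have PH [simp]: "val PH" "src PH = i \<otimes> W" "tgt PH = act C ?h (i \<otimes> W)" by (simp_all add: PH_def)
    have summand: "actm C ?h (qrj r s) \<cdot> (act_tens C ?h i (X r) \<cdot> (x ?h i \<boxtimes> al r)) \<cdot> jnc r s
      = actm C ?h (qrj r s \<cdot> (idm C i \<boxtimes> prj r)) \<cdot> mor PH \<cdot> ((idm C i \<boxtimes> inc r) \<cdot> jnc r s)" if rs: "r < n" "s < N r" for r s
    proof -
      define Q J' N' R where "Q = Arr (i \<otimes> X r) (Y r s) (qrj r s)" and "J' = Arr (Y r s) (i \<otimes> X r) (jnc r s)"
        and "N' = Arr (X r) W (inc r)" and "R = Arr W (X r) (prj r)"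
      have [simp]: "val Q" "src Q = i \<otimes> X r" "tgt Q = Y r s" "val J'" "src J' = Y r s" "tgt J' = i \<otimes> X r"
        "val N'" "src N' = X r" "tgt N' = W" "val R" "src R = W" "tgt R = X r"
        using rs D(2,3)[of r] direct_sumD(2,3)[OF e(2), of s r] by (simp_all add: Q_def J'_def N'_def R_def)
      let ?b = "Act ?h R \<odot> AA \<odot> N'"
      have "actm C ?h (qrj r s) \<cdot> (act_tens C ?h i (X r) \<cdot> (x ?h i \<boxtimes> al r)) \<cdot> jnc r s
        = mor (Act ?h Q \<odot> (ActT ?h i (X r) \<odot> ((XI \<rhd> act C ?h (X r)) \<odot> (i \<lhd> ?b))) \<odot> J')"
      proof -
        have "mor ((XI \<rhd> act C ?h (X r)) \<odot> (i \<lhd> ?b)) = mor XI \<boxtimes> mor ?b" by (rule mor_tens) simp_all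
        then show ?thesis
          by (simp add: mor_comp Act_def Q_def J'_def ActT_def al_def XI_def AA_def N'_def R_def del: lw_comp)
      qed
      also have "Act ?h Q \<odot> (ActT ?h i (X r) \<odot> ((XI \<rhd> act C ?h (X r)) \<odot> (i \<lhd> ?b))) \<odot> J'
        = Act ?h Q \<odot> ActT ?h i (X r) \<odot> ((XI \<rhd> act C ?h (X r)) \<odot> (i \<lhd> Act ?h R)) \<odot> (i \<lhd> AA) \<odot> (i \<lhd> N') \<odot> J'"
        by simp
      also have "(XI \<rhd> act C ?h (X r)) \<odot> (i \<lhd> Act ?h R) = (act C ?h i \<lhd> Act ?h R) \<odot> (XI \<rhd> act C ?h W)"
        by (rule slide[symmetric]) simp_all
      also have "Act ?h Q \<odot> ActT ?h i (X r) \<odot> ((act C ?h i \<lhd> Act ?h R) \<odot> (XI \<rhd> act C ?h W)) \<odot> (i \<lhd> AA) \<odot> (i \<lhd> N') \<odot> J'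
        = Act ?h Q \<odot> (ActT ?h i (X r) \<odot> (act C ?h i \<lhd> Act ?h R)) \<odot> (XI \<rhd> act C ?h W) \<odot> (i \<lhd> AA) \<odot> (i \<lhd> N') \<odot> J'"
        by simp
      also have "ActT ?h i (X r) \<odot> (act C ?h i \<lhd> Act ?h R) = Act ?h (i \<lhd> R) \<odot> ActT ?h i W"
        by (subst ActT_nat2) simp_all
      also have "Act ?h Q \<odot> (Act ?h (i \<lhd> R) \<odot> ActT ?h i W) \<odot> (XI \<rhd> act C ?h W) \<odot> (i \<lhd> AA) \<odot> (i \<lhd> N') \<odot> J'
        = Act ?h (Q \<odot> (i \<lhd> R)) \<odot> PH \<odot> ((i \<lhd> N') \<odot> J')"
        by (simp add: PH_def)
      also have "mor \<dots> = actm C ?h (qrj r s \<cdot> (idm C i \<boxtimes> prj r)) \<cdot> mor PH \<cdot> ((idm C i \<boxtimes> inc r) \<cdot> jnc r s)"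
        by (simp only: mor_comp Act_def arr.sel) (simp add: Q_def R_def N'_def J'_def lw_def mor_comp)
      finally show ?thesis .
    qed
    \<comment> \<open>The vector that spans the morphisms from the unit to i (x) W, by
      \<open>hom_unit_tens_dual\<close>.\<close>
    define B where "B = (if i = k then mor ((inva P \<rhd> W) \<odot> Coev ?U) else 0)"
    have hB: "B \<in> hom C \<one> (i \<otimes> W)"
    proof -
      have "val ((inva P \<rhd> W) \<odot> Coev ?U)" by (simp add: W_def)
      then show ?thesis unfolding val_def by (simp add: B_def)
    qed
    have PB: "mor PH \<cdot> B = scl C t (actm C ?h B \<cdot> act_unt C ?h)"
    proof (cases "i = k")
      case True
      have mAA: "mor AA = a" and mXI: "mor XI = x ?h i" by (simp_all add: AA_def XI_def)
      define p0 where "p0 = inva (Act ?h P) \<odot> inva (ActC ?h g k)"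
      have p0 [simp]: "val p0" "src p0 = k" "tgt p0 = act C ?h k" by (simp_all add: p0_def)
      \<comment> \<open>The hypothesis on x fixes its component at k to be t times
        \<open>p0\<close>, the morphism to which \<open>Adj_Coev\<close> applies.\<close>
      have xt: "x ?h k = scl C t (mor p0)"
      proof -
        define XK where "XK = Arr k (act C ?h k) (x ?h k)"
        have XK [simp]: "val XK" "src XK = k" "tgt XK = act C ?h k" using xh[OF k] by (simp_all add: XK_def)
        have "XK = p0 \<odot> (ActC ?h g k \<odot> Act ?h P \<odot> XK)" by (simp add: p0_def)
        then have "mor XK = mor p0 \<cdot> mor (ActC ?h g k \<odot> Act ?h P \<odot> XK)" by (metis mor_comp)
        also have "mor (ActC ?h g k \<odot> Act ?h P \<odot> XK) = scl C t (idm C k)"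
          using t by (simp add: mor_comp ActC_def Act_def XK_def)
        also have "mor p0 \<cdot> scl C t (idm C k) = scl C t (mor p0)"
          using cmp_scl_right[OF _ idm_hom] cmp_idm_right p0 by (simp add: val_def)
        finally show ?thesis by (simp add: XK_def)
      qed
      define b where "b = (inva P \<rhd> W) \<odot> Coev ?U"
      have b [simp]: "val b" "src b = \<one>" "tgt b = k \<otimes> W" by (simp_all add: b_def W_def)
      have "ActT ?h k W \<odot> (p0 \<rhd> act C ?h W) \<odot> (k \<lhd> Adj g k P) \<odot> b = Act ?h b \<odot> ActU ?h"
        unfolding p0_def W_def b_def by (rule Adj_Coev) simp_all
      then have "ActT ?h k W \<odot> ((p0 \<rhd> act C ?h W) \<odot> (k \<lhd> AA)) \<odot> b = Act ?h b \<odot> ActU ?h"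
        by (simp add: Adj AA_def[symmetric])
      then have "mor (ActT ?h k W \<odot> ((p0 \<rhd> act C ?h W) \<odot> (k \<lhd> AA)) \<odot> b) = mor (Act ?h b \<odot> ActU ?h)" by simp
      then have "mor (ActT ?h k W) \<cdot> (mor (p0 \<rhd> act C ?h W) \<cdot> mor (k \<lhd> AA)) \<cdot> mor b = mor (Act ?h b) \<cdot> mor (ActU ?h)"
        unfolding mor_comp .
      moreover have "mor (p0 \<rhd> act C ?h W) \<cdot> mor (k \<lhd> AA) = mor p0 \<boxtimes> a"
        using mor_tens[of p0 AA k "act C ?h W"] mAA by (simp add: mor_comp)
      ultimately have e: "act_tens C ?h k W \<cdot> (mor p0 \<boxtimes> a) \<cdot> mor b = actm C ?h (mor b) \<cdot> act_unt C ?h"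
        by (simp add: ActT_def ActU_def Act_def)
      have mph: "mor PH = act_tens C ?h k W \<cdot> (x ?h k \<boxtimes> a)"
        using mor_tens[of XI AA i "act C ?h W"] mAA mXI True by (simp add: PH_def mor_comp ActT_def)
      have p0h: "mor p0 \<boxtimes> a \<in> hom C (k \<otimes> W) (act C ?h k \<otimes> act C ?h W)"
        using p0 a by (intro tensm_hom) (simp_all add: val_def)
      have bh: "mor b \<in> hom C \<one> (k \<otimes> W)" using b by (simp add: val_def)
      have "mor PH = scl C t (act_tens C ?h k W \<cdot> (mor p0 \<boxtimes> a))"
        unfolding mph xt using tensm_scl_left[OF _ a, of "mor p0" k "act C ?h k"] p0 cmp_scl_right[OF T p0h]
        by (simp add: val_def)
      then have "mor PH \<cdot> mor b = scl C t ((act_tens C ?h k W \<cdot> (mor p0 \<boxtimes> a)) \<cdot> mor b)"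
        using cmp_scl_left[OF cmp_hom[OF T p0h] bh] by simp
      also have "(act_tens C ?h k W \<cdot> (mor p0 \<boxtimes> a)) \<cdot> mor b = actm C ?h (mor b) \<cdot> act_unt C ?h"
        using cmp_assoc[OF T p0h bh] e by simp
      finally show ?thesis using True by (simp add: B_def b_def)
    next
      case False
      have "actm C ?h 0 = 0" using actm_scl[of 0 i i ?h 0] by simp
      moreover have "act_unt C ?h \<in> hom C \<one> (act C ?h \<one>)" using act_unt_iso iso_hom by blast
      ultimately show ?thesis using False PH cmp_zero_left cmp_zero_right[of "mor PH" "i \<otimes> W"]
        by (simp add: B_def val_def)
    qed
    have "(\<Sum>j\<in>I. cls C I ?h (i \<otimes> j) (act_tens C ?h i j \<cdot> (x ?h i \<boxtimes> y ?h j)) ?h \<one>)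
       = (\<Sum>j\<in>I. cls C I ?h (i \<otimes> j) (act_tens C ?h i j \<cdot> (x ?h i \<boxtimes> y ?h j))) ?h \<one>"
      by (simp add: sum_apply2)
    also have "\<dots> = (\<Sum>r<n. \<Sum>s<N r. if \<one> = Y r s then actm C ?h (qrj r s) \<cdot> (act_tens C ?h i (X r) \<cdot> (x ?h i \<boxtimes> al r)) \<cdot> jnc r s else 0)"
      unfolding S by (simp add: e(3) sum_sing_apply sum_apply2)
    also have "\<dots> = (\<Sum>(r, s)\<in>?J. if \<one> = Y r s then actm C ?h (qrj r s) \<cdot> (act_tens C ?h i (X r) \<cdot> (x ?h i \<boxtimes> al r)) \<cdot> jnc r s else 0)"
      by (rule sum.Sigma) auto
    also have "\<dots> = (\<Sum>j\<in>?J. if \<one> = (case j of (r, s) \<Rightarrow> Y r s) then actm C ?h (case j of (r, s) \<Rightarrow> qrj r s \<cdot> (idm C i \<boxtimes> prj r)) \<cdot> mor PH \<cdot>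
       (case j of (r, s) \<Rightarrow> (idm C i \<boxtimes> inc r) \<cdot> jnc r s) else 0)"
      by (intro sum.cong) (auto simp: summand)
    also have "\<dots> = (if B = 0 then 0 else scl C t (act_unt C ?h))"
    proof (rule unit_component[OF ds _ hB _ _ PB])
      show "mor PH \<in> hom C (i \<otimes> W) (act C ?h (i \<otimes> W))" using PH by (simp add: val_def)
      show "\<exists>c. f = scl C c B" if "f \<in> hom C \<one> (i \<otimes> W)" for f
        using hom_unit_tens_dual[OF i k P(1-3), of f] that unfolding B_def W_def by simp
    qed (use e(1) in auto)
    \<comment> \<open>For i = k a vanishing B would make the coevaluation of R_g k vanish, hence by
      the zigzag also its identity, against simplicity.\<close>
    also have "B = 0 \<longleftrightarrow> i \<noteq> k"
    proof
      assume "B = 0"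
      show "i \<noteq> k"
      proof
        assume "i = k"
        then have "mor ((inva P \<rhd> W) \<odot> Coev ?U) = 0" using \<open>B = 0\<close> by (simp add: B_def)
        then have z: "(inva P \<rhd> W) \<odot> Coev ?U = Arr \<one> (k \<otimes> W) 0" by (simp add: comp_def)
        have "Coev ?U = (P \<rhd> W) \<odot> ((inva P \<rhd> W) \<odot> Coev ?U)"
          unfolding inva_rw[OF P(1), symmetric] by (simp add: W_def)
        then have cz: "Coev ?U = Arr \<one> (?U \<otimes> W) 0" unfolding z by (simp add: comp_zero_right)
        have "ida ?U = Arr ?U ?U 0"
          using Ev_Coev_zigzag(1)[of ?U] unfolding cz by (simp add: rw_zero comp_zero_left comp_zero_right)
        then have "idm C ?U = 0" by (simp add: ida_def)
        then show False using simple_act[OF rep_simple[OF k], of g] by (simp add: simple_def)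
      qed
    qed (simp add: B_def)
    finally show ?thesis by auto
  qed
  have "br0 C ?F = t"
  proof (rule br0_unit[where h = ?h])
    fix m
    show "?F m \<one> = (if m = ?h then scl C t (act_unt C ?h) else 0)"
    proof (cases "m = ?h")
      case True
      then show ?thesis unfolding F using k fin by (simp add: main)
    next
      case False
      then have "y m j = 0" for j unfolding y by simp
      then show ?thesis unfolding F using False
        by (simp add: tensm_zero_right[OF xh] cmp_zero_right[OF T] cls_zero)
    qed
  qed
  then show ?thesis by (simp add: vform_def y_def)
qed

end

section \<open>The s-matrix\<close>

context pivotal_category
begin

end

section \<open>Linearity and multiplicativity of loops\<close>

context equivariant_fusion_category
begin

lemma encircle_eq_mor:
  assumes "V \<in> homog C h" "K \<in> homog C g" "val f" "src f = V" "tgt f = act C g V"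
  shows "encircle C g h V K (mor f)
    = mor (Ptr V K (act C (- h) K) (inva (Bra h V K) \<odot> inva (Br g K V) \<odot> (f \<rhd> K)))"
proof -
  have "mor (Ptr V K (act C (- h) K) (inva (Bra h V K) \<odot> inva (Br g K V) \<odot> (f \<rhd> K)))
    = ptr_left C V K (act C (- h) K) (mor (inva (Bra h V K) \<odot> inva (Br g K V) \<odot> (f \<rhd> K)))"
    by (rule mor_Ptr) (use assms in simp_all)
  then show ?thesis
    by (simp add: encircle_def comp_def Bra_def inva_def Br_def ActC_def rw_def)
qed

lemma encircle_hom:
  assumes "V \<in> homog C h" "K \<in> homog C g" "f \<in> hom C V (act C g V)"
  shows "encircle C g h V K f \<in> hom C K (act C (- h) K)"
proof -
  have "val (Ptr V K (act C (- h) K) (inva (Bra h V K) \<odot> inva (Br g K V) \<odot> (Arr V (act C g V) f \<rhd> K)))"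
    using assms by simp
  then show ?thesis
    using encircle_eq_mor[of V h K g "Arr V (act C g V) f"] assms unfolding val_def by simp
qed

text \<open>Displays the loop as fixed arrows around f, from which additivity and homogeneity in f
  follow by bilinearity.\<close>

lemma encircle_factors:
  assumes "V \<in> homog C h" "K \<in> homog C g"
  obtains E Z A R where "E \<in> hom C (dual C V \<otimes> Z) (act C (- h) K)" "A \<in> hom C (act C g V \<otimes> K) Z"
    "R \<in> hom C K (dual C V \<otimes> (V \<otimes> K))"
    "\<And>f. f \<in> hom C V (act C g V) \<Longrightarrow> encircle C g h V K f = E \<cdot> (idm C (dual C V) \<boxtimes> (A \<cdot> (f \<boxtimes> idm C K))) \<cdot> R"
proof
  let ?L = "act C (- h) K" and ?A = "inva (Bra h V K) \<odot> inva (Br g K V)"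
  have "val (evf V ?L)" by simp
  then show "mor (evf V ?L) \<in> hom C (dual C V \<otimes> (V \<otimes> ?L)) ?L" unfolding val_def by simp
  have "val ?A" using assms by simp
  then show "mor ?A \<in> hom C (act C g V \<otimes> K) (V \<otimes> ?L)" unfolding val_def by simp
  have "val (rcf V K)" by simp
  then show "mor (rcf V K) \<in> hom C K (dual C V \<otimes> (V \<otimes> K))" unfolding val_def by simp
  fix f assume f: "f \<in> hom C V (act C g V)"
  have "encircle C g h V K f = mor (Ptr V K ?L (?A \<odot> (Arr V (act C g V) f \<rhd> K)))"
    using encircle_eq_mor[of V h K g "Arr V (act C g V) f"] assms f by simp
  also have "\<dots> = mor (evf V ?L) \<cdot> (idm C (dual C V) \<boxtimes> (mor ?A \<cdot> (f \<boxtimes> idm C K))) \<cdot> mor (rcf V K)"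
    unfolding Ptr_def mor_comp by (simp add: lw_def rw_def mor_comp)
  finally show "encircle C g h V K f = mor (evf V ?L) \<cdot> (idm C (dual C V) \<boxtimes> (mor ?A \<cdot> (f \<boxtimes> idm C K))) \<cdot> mor (rcf V K)" .
qed

lemma encircle_sum:
  assumes V: "V \<in> homog C h" "K \<in> homog C g" and F: "\<And>a. a \<in> A \<Longrightarrow> F a \<in> hom C V (act C g V)"
  shows "encircle C g h V K (\<Sum>a\<in>A. F a) = (\<Sum>a\<in>A. encircle C g h V K (F a))"
proof -
  obtain E Z B R where *: "E \<in> hom C (dual C V \<otimes> Z) (act C (- h) K)" "B \<in> hom C (act C g V \<otimes> K) Z"
    "R \<in> hom C K (dual C V \<otimes> (V \<otimes> K))"
    "\<And>f. f \<in> hom C V (act C g V) \<Longrightarrow> encircle C g h V K f = E \<cdot> (idm C (dual C V) \<boxtimes> (B \<cdot> (f \<boxtimes> idm C K))) \<cdot> R"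
    using encircle_factors[OF V] by blast
  have 1: "F a \<boxtimes> idm C K \<in> hom C (V \<otimes> K) (act C g V \<otimes> K)" if "a \<in> A" for a
    using F[OF that] by (intro tensm_hom idm_hom)
  have 2: "idm C (dual C V) \<boxtimes> (B \<cdot> (F a \<boxtimes> idm C K)) \<in> hom C (dual C V \<otimes> (V \<otimes> K)) (dual C V \<otimes> Z)" if "a \<in> A" for a
    using 1[OF that] *(2) by (intro tensm_hom idm_hom cmp_hom)
  have "encircle C g h V K (\<Sum>a\<in>A. F a) = E \<cdot> (idm C (dual C V) \<boxtimes> (B \<cdot> ((\<Sum>a\<in>A. F a) \<boxtimes> idm C K))) \<cdot> R"
    by (rule *(4)[OF hom_sum[OF F]])
  also have "(\<Sum>a\<in>A. F a) \<boxtimes> idm C K = (\<Sum>a\<in>A. F a \<boxtimes> idm C K)" by (rule tensm_sum_left[OF F idm_hom])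
  also have "B \<cdot> \<dots> = (\<Sum>a\<in>A. B \<cdot> (F a \<boxtimes> idm C K))" by (rule cmp_sum_right[OF *(2) 1])
  also have "idm C (dual C V) \<boxtimes> \<dots> = (\<Sum>a\<in>A. idm C (dual C V) \<boxtimes> (B \<cdot> (F a \<boxtimes> idm C K)))"
    by (rule tensm_sum_right[OF idm_hom cmp_hom[OF *(2) 1]])
  also have "\<dots> \<cdot> R = (\<Sum>a\<in>A. (idm C (dual C V) \<boxtimes> (B \<cdot> (F a \<boxtimes> idm C K))) \<cdot> R)"
    by (rule cmp_sum_left[OF 2 *(3)])
  also have "E \<cdot> \<dots> = (\<Sum>a\<in>A. E \<cdot> (idm C (dual C V) \<boxtimes> (B \<cdot> (F a \<boxtimes> idm C K))) \<cdot> R)"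
    by (rule cmp_sum_right[OF *(1) cmp_hom[OF 2 *(3)]])
  also have "\<dots> = (\<Sum>a\<in>A. encircle C g h V K (F a))"
    by (intro sum.cong refl) (simp add: *(4) F)
  finally show ?thesis .
qed

lemma encircle_zero: "\<lbrakk>V \<in> homog C h; K \<in> homog C g\<rbrakk> \<Longrightarrow> encircle C g h V K 0 = 0"
  using encircle_sum[where A = "{}"] by simp

lemma encircle_scl:
  assumes V: "V \<in> homog C h" "K \<in> homog C g" and f: "f \<in> hom C V (act C g V)"
  shows "encircle C g h V K (scl C c f) = scl C c (encircle C g h V K f)"
proof -
  obtain E Z B R where *: "E \<in> hom C (dual C V \<otimes> Z) (act C (- h) K)" "B \<in> hom C (act C g V \<otimes> K) Z"
    "R \<in> hom C K (dual C V \<otimes> (V \<otimes> K))"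
    "\<And>f. f \<in> hom C V (act C g V) \<Longrightarrow> encircle C g h V K f = E \<cdot> (idm C (dual C V) \<boxtimes> (B \<cdot> (f \<boxtimes> idm C K))) \<cdot> R"
    using encircle_factors[OF V] by blast
  have 1: "f \<boxtimes> idm C K \<in> hom C (V \<otimes> K) (act C g V \<otimes> K)" using f by (intro tensm_hom idm_hom)
  have 2: "idm C (dual C V) \<boxtimes> (B \<cdot> (f \<boxtimes> idm C K)) \<in> hom C (dual C V \<otimes> (V \<otimes> K)) (dual C V \<otimes> Z)"
    using 1 *(2) by (intro tensm_hom idm_hom cmp_hom)
  show ?thesis
    by (simp add: *(4) hom_scl f tensm_scl_left[OF f idm_hom] cmp_scl_right[OF *(2) 1]
        tensm_scl_right[OF idm_hom cmp_hom[OF *(2) 1]] cmp_scl_left[OF 2 *(3)] cmp_scl_right[OF *(1) cmp_hom[OF 2 *(3)]])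
qed

lemma encircle_cyclic:
  assumes "p \<in> hom C V X" "q \<in> hom C X V" "V \<in> homog C h" "X \<in> homog C h" "K \<in> homog C 0"
  shows "encircle C 0 h V K (q \<cdot> p) = encircle C 0 h X K (p \<cdot> q)"
proof -
  let ?p = "Arr V X p" and ?q = "Arr X V q"
  have "encircle C 0 h V K (q \<cdot> p) = mor (Enc h V K (?q \<odot> ?p))"
    using assms by (subst mor_Enc) (simp_all add: mor_comp)
  also have "Enc h V K (?q \<odot> ?p) = Enc h X K (?p \<odot> ?q)"
    using assms by (intro Enc_cyclic) simp_all
  also have "mor \<dots> = encircle C 0 h X K (p \<cdot> q)"
    using assms by (subst mor_Enc) (simp_all add: mor_comp)
  finally show ?thesis .
qed

lemma encircle_tens:
  assumes "U \<in> homog C h1" "V \<in> homog C h2" "K \<in> homog C 0"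
  shows "encircle C 0 (h1 + h2) (U \<otimes> V) K (idm C (U \<otimes> V)) = act_cmp C (- h2) (- h1) K \<cdot>
    actm C (- h2) (encircle C 0 h1 U K (idm C U)) \<cdot> encircle C 0 h2 V K (idm C V)"
proof -
  have "encircle C 0 (h1 + h2) (U \<otimes> V) K (idm C (U \<otimes> V)) = mor (Enc (h1 + h2) (U \<otimes> V) K (ida (U \<otimes> V)))"
    using assms by (subst mor_Enc) (simp_all add: homog_tens)
  also have "\<dots> = act_cmp C (- h2) (- h1) K \<cdot> actm C (- h2) (mor (Enc h1 U K (ida U))) \<cdot> mor (Enc h2 V K (ida V))"
    unfolding Enc_tens[OF assms] by (simp add: mor_comp ActC_def Act_def)
  finally show ?thesis using assms by (simp add: mor_Enc)
qed

end

section \<open>Components of the s-operator and consequences of its surjectivity\<close>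

context simple_representatives
begin

lemma IdegD: "i \<in> Ideg C I h \<Longrightarrow> i \<in> I" "i \<in> Ideg C I h \<Longrightarrow> i \<in> homog C h"
  by (auto simp: Ideg_def)

lemma finite_Ideg [simp]: "finite (Ideg C I h)" and finite_Iinv [simp]: "finite (Iinv C I g h)"
  using fin by (auto simp: Ideg_def Iinv_def)

lemma rep_degree_unique: "\<lbrakk>i \<in> I; i \<in> homog C g; i \<in> homog C h\<rbrakk> \<Longrightarrow> g = h"
  using homog_unique idm_nonzero by blast

lemma stilde_apply: "stilde C I x m k = (\<Sum>g\<in>UNIV. if k \<in> Iinv C I m g
  then \<Sum>i\<in>Ideg C I (- m). scl C (dim_ob C k) (encircle C g (- m) i k (x g i)) else 0)"
proof -
  have neg: "m = - h \<longleftrightarrow> h = - m" for h :: 'g by auto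
  have "stilde C I x m k = (\<Sum>g\<in>UNIV. \<Sum>h\<in>UNIV. \<Sum>i\<in>Ideg C I h. \<Sum>k'\<in>Iinv C I (- h) g.
     if m = - h \<and> k = k' then scl C (dim_ob C k') (encircle C g h i k' (x g i)) else 0)"
    unfolding stilde_def stilde_gen_def sum_apply2 by (intro sum.cong refl) (auto simp: sing_def)
  also have "\<dots> = (\<Sum>g\<in>UNIV. \<Sum>h\<in>UNIV. if h = - m then if k \<in> Iinv C I m g then
     \<Sum>i\<in>Ideg C I h. scl C (dim_ob C k) (encircle C g h i k (x g i)) else 0 else 0)"
    by (intro sum.cong refl) (auto simp: neg)
  also have "\<dots> = (\<Sum>g\<in>UNIV. if k \<in> Iinv C I m g
     then \<Sum>i\<in>Ideg C I (- m). scl C (dim_ob C k) (encircle C g (- m) i k (x g i)) else 0)"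
    by simp
  finally show ?thesis .
qed

text \<open>A simple object has only one degree, so for k of degree 0 only g = 0 survives and the
  loops carry endomorphisms.\<close>

lemma stilde_degree_zero:
  assumes k: "k \<in> Ideg C I 0"
  shows "stilde C I x m k = (if k \<in> Iinv C I m 0
    then \<Sum>i\<in>Ideg C I (- m). scl C (dim_ob C k) (encircle C 0 (- m) i k (x 0 i)) else 0)"
proof -
  have *: "k \<notin> Iinv C I m g" if "g \<noteq> 0" for g
    using k that rep_degree_unique by (auto simp: Iinv_def Ideg_def)
  have "stilde C I x m k = (\<Sum>g\<in>(UNIV :: 'g set). if g = 0 then if k \<in> Iinv C I m 0
     then \<Sum>i\<in>Ideg C I (- m). scl C (dim_ob C k) (encircle C 0 (- m) i k (x 0 i)) else 0 else 0)"
    unfolding stilde_apply by (intro sum.cong refl) (auto simp: *)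
  then show ?thesis by simp
qed

lemma stilde_outside:
  assumes "\<And>g i. g \<noteq> 0 \<Longrightarrow> x g i = 0" "k \<notin> Ideg C I 0"
  shows "stilde C I x m k = 0"
proof -
  have "scl C (dim_ob C k) (encircle C g (- m) i k (x g i)) = 0" if "k \<in> Iinv C I m g" "i \<in> Ideg C I (- m)" for g i
  proof -
    have "g \<noteq> 0" using that assms(2) by (auto simp: Iinv_def)
    then show ?thesis using that assms(1) by (simp add: encircle_zero Iinv_def Ideg_def)
  qed
  then have "(\<Sum>i\<in>Ideg C I (- m). scl C (dim_ob C k) (encircle C g (- m) i k (x g i))) = 0" if "k \<in> Iinv C I m g" for g
    using that by (intro sum.neutral) blast
  then show ?thesis unfolding stilde_apply by (intro sum.neutral) simp
qed

lemma stilde_hom: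
  assumes "\<And>g i. i \<in> I \<Longrightarrow> x g i \<in> hom C i (act C g i)"
  shows "stilde C I x m k \<in> hom C k (act C m k)"
proof -
  have "encircle C g (- m) i k (x g i) \<in> hom C k (act C m k)" if "k \<in> Iinv C I m g" "i \<in> Ideg C I (- m)" for g i
    using encircle_hom[of i "- m" k g "x g i"] that assms by (simp add: Iinv_def Ideg_def)
  then show ?thesis unfolding stilde_apply by (auto intro!: hom_sum hom_scl)
qed

text \<open>The point where the choice in \<open>cls\<close> drops out:
  \<open>encircle_cyclic\<close> moves each term inc prj of the identity of V onto its
  summand.\<close>

lemma stilde_cls:
  assumes V: "V \<in> homog C h" and k: "k \<in> Ideg C I 0"
  shows "stilde C I (cls C I 0 V (idm C V)) m k = (if m = - h \<and> k \<in> Iinv C I m 0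
    then scl C (dim_ob C k) (encircle C 0 h V k (idm C V)) else 0)"
proof (cases "k \<in> Iinv C I m 0")
  case True
  obtain n X inc prj where d: "\<And>r. r < n \<Longrightarrow> X r \<in> I" "direct_sum C {..<n::nat} X V inc prj"
    "\<And>g \<phi>. cls C I g V \<phi> = (\<Sum>r<n. sing g (X r) (actm C g (prj r) \<cdot> \<phi> \<cdot> inc r))" using cls_spec[of V] by blast
  note D = direct_sumD[OF d(2)]
  have kh: "k \<in> homog C 0" using k by (simp add: Ideg_def)
  have pi: "prj r \<cdot> inc r = idm C (X r)" if "r < n" for r using D(4)[of r r] that by simp
  \<comment> \<open>A summand has the degree of V because its inclusion is nonzero;
    \<open>encircle_cyclic\<close> compares objects of equal degree.\<close>
  have X: "X r \<in> homog C h" if "r < n" for r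
  proof -
    have "X r \<in> I" by (rule d(1)[OF that])
    then obtain h' where h': "X r \<in> homog C h'" using simple_homog rep_simple by blast
    have "inc r \<noteq> 0" using pi[OF that] idm_nonzero[OF d(1)[OF that]] cmp_zero_right[OF D(3)[of r]] that by auto
    then have "h' = h" using homog_hom[OF h' V] D(2)[of r] that by auto
    with h' show ?thesis by simp
  qed
  have "actm C 0 (prj r) \<cdot> idm C V \<cdot> inc r = idm C (X r)" if "r < n" for r
    using pi[OF that] that D(2,3)[of r] by (simp add: actm_zero cmp_idm_left)
  then have y: "cls C I 0 V (idm C V) 0 i = (\<Sum>r<n. if i = X r then idm C (X r) else 0)" for i
    unfolding d(3) sum_sing_apply by (intro sum.cong) auto
  have t: "(\<Sum>r<n. encircle C 0 h (X r) k (idm C (X r))) = encircle C 0 h V k (idm C V)"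
  proof -
    have "encircle C 0 h V k (idm C V) = (\<Sum>r<n. encircle C 0 h V k (inc r \<cdot> prj r))"
      unfolding D(5)[symmetric] by (rule encircle_sum[OF V kh]) (use D(2,3) in \<open>auto intro!: cmp_hom\<close>)
    also have "\<dots> = (\<Sum>r<n. encircle C 0 h (X r) k (idm C (X r)))"
    proof (rule sum.cong[OF refl])
      fix r assume r: "r \<in> {..<n}"
      then have "encircle C 0 h V k (inc r \<cdot> prj r) = encircle C 0 h (X r) k (prj r \<cdot> inc r)"
        using X by (intro encircle_cyclic[OF D(3) D(2) V _ kh]) auto
      with r show "encircle C 0 h V k (inc r \<cdot> prj r) = encircle C 0 h (X r) k (idm C (X r))"
        by (simp add: pi)
    qed
    finally show ?thesis by simp
  qed
  have "(\<Sum>i\<in>Ideg C I (- m). encircle C 0 (- m) i k (\<Sum>r<n. if i = X r then idm C (X r) else 0))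
    = (\<Sum>i\<in>Ideg C I (- m). \<Sum>r<n. if i = X r then encircle C 0 (- m) i k (idm C i) else 0)"
  proof (rule sum.cong[OF refl])
    fix i assume i: "i \<in> Ideg C I (- m)"
    then have ih: "i \<in> homog C (- m)" by (simp add: Ideg_def)
    have "encircle C 0 (- m) i k (\<Sum>r<n. if i = X r then idm C (X r) else 0)
      = (\<Sum>r<n. encircle C 0 (- m) i k (if i = X r then idm C (X r) else 0))"
      by (rule encircle_sum[OF ih kh]) (auto intro: idm_hom)
    also have "\<dots> = (\<Sum>r<n. if i = X r then encircle C 0 (- m) i k (idm C i) else 0)"
      by (intro sum.cong refl) (auto simp: encircle_zero[OF ih kh])
    finally show "encircle C 0 (- m) i k (\<Sum>r<n. if i = X r then idm C (X r) else 0) = \<dots>" .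
  qed
  also have "\<dots> = (\<Sum>r<n. \<Sum>i\<in>Ideg C I (- m). if i = X r then encircle C 0 (- m) i k (idm C i) else 0)"
    by (rule sum.swap)
  also have "\<dots> = (\<Sum>r<n. if X r \<in> Ideg C I (- m) then encircle C 0 (- m) (X r) k (idm C (X r)) else 0)"
    by (intro sum.cong refl) simp
  also have "\<dots> = (\<Sum>r<n. if - m = h then encircle C 0 h (X r) k (idm C (X r)) else 0)"
  proof (rule sum.cong[OF refl])
    fix r assume "r \<in> {..<n}"
    then have "X r \<in> Ideg C I (- m) \<longleftrightarrow> - m = h"
      using X[of r] d(1)[of r] rep_degree_unique[of "X r" "- m" h] by (auto simp: Ideg_def)
    then show "(if X r \<in> Ideg C I (- m) then encircle C 0 (- m) (X r) k (idm C (X r)) else 0)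
      = (if - m = h then encircle C 0 h (X r) k (idm C (X r)) else 0)" by simp
  qed
  also have "\<dots> = (if m = - h then encircle C 0 h V k (idm C V) else 0)"
    using t by (auto simp: minus_equation_iff[of m h])
  finally have "(\<Sum>i\<in>Ideg C I (- m). encircle C 0 (- m) i k (cls C I 0 V (idm C V) 0 i))
     = (if m = - h then encircle C 0 h V k (idm C V) else 0)" unfolding y .
  then show ?thesis using True unfolding stilde_degree_zero[OF k] scale_sum_right[symmetric] by auto
qed (simp add: stilde_degree_zero[OF k])

lemma stilde_sing:
  assumes i: "i \<in> Ideg C I h" and k: "k \<in> Ideg C I 0"
  shows "stilde C I (sing 0 i (idm C i)) m k = (if m = - h \<and> k \<in> Iinv C I m 0
    then scl C (dim_ob C k) (encircle C 0 h i k (idm C i)) else 0)"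
proof (cases "k \<in> Iinv C I m 0")
  case True
  have kh: "k \<in> homog C 0" using k by (simp add: Ideg_def)
  have "(\<Sum>j\<in>Ideg C I (- m). scl C (dim_ob C k) (encircle C 0 (- m) j k (sing 0 i (idm C i) 0 j)))
    = (\<Sum>j\<in>Ideg C I (- m). if j = i then scl C (dim_ob C k) (encircle C 0 (- m) i k (idm C i)) else 0)"
    by (intro sum.cong refl) (auto simp: sing_def Ideg_def encircle_zero[OF _ kh])
  also have "\<dots> = (if i \<in> Ideg C I (- m) then scl C (dim_ob C k) (encircle C 0 (- m) i k (idm C i)) else 0)"
    by simp
  also have "i \<in> Ideg C I (- m) \<longleftrightarrow> - m = h"
    using i rep_degree_unique[of i "- m" h] by (auto simp: Ideg_def)
  finally show ?thesis using True unfolding stilde_degree_zero[OF k] by (auto simp: minus_equation_iff[of m h])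
qed (simp add: stilde_degree_zero[OF k])

lemma vtens_sing:
  assumes "i \<in> I" "j \<in> I"
  shows "vtens C I (sing 0 i (idm C i)) (sing 0 j (idm C j)) = cls C I 0 (i \<otimes> j) (idm C (i \<otimes> j))"
proof -
  have T: "act_tens C g p q \<in> hom C (act C g p \<otimes> act C g q) (act C g (p \<otimes> q))" for g p q
    using act_tens_iso iso_hom by blast
  have z: "act_tens C g p q \<cdot> 0 = 0" for g p q by (rule cmp_zero_right[OF T])
  have "cls C I g (p \<otimes> q) (act_tens C g p q \<cdot> (sing 0 i (idm C i) g p \<boxtimes> sing 0 j (idm C j) g q))
    = (if g = 0 then if p = i then if q = j then cls C I 0 (i \<otimes> j) (idm C (i \<otimes> j)) else 0 else 0 else 0)" for g p q
    using z[of g p q] tensm_zero_left[OF idm_hom] tensm_zero_right[OF idm_hom] tensm_zero_left[OF hom_zero]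
    by (auto simp: sing_def cls_zero act_tens_zero tensm_idm cmp_idm_left[OF idm_hom])
  then have "vtens C I (sing 0 i (idm C i)) (sing 0 j (idm C j)) = (\<Sum>g\<in>(UNIV :: 'g set). \<Sum>p\<in>I. \<Sum>q\<in>I.
    if g = 0 then if p = i then if q = j then cls C I 0 (i \<otimes> j) (idm C (i \<otimes> j)) else 0 else 0 else 0)"
    by (simp add: vtens_def)
  also have "\<dots> = (\<Sum>g\<in>(UNIV :: 'g set). if g = 0 then \<Sum>p\<in>I. if p = i then \<Sum>q\<in>I.
      if q = j then cls C I 0 (i \<otimes> j) (idm C (i \<otimes> j)) else 0 else 0 else 0)"
    by (rule sum.cong[OF refl], case_tac "x = 0") (auto intro!: sum.cong)
  finally show ?thesis using assms fin by simp
qed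

text \<open>All values of \<open>stilde\<close> have a factor \<open>dim_ob C k\<close> in their \<open>k\<close>-th component.\<close>

lemma surj_nonzero:
  assumes surj: "Verl C I \<subseteq> stilde C I ` Verl C I" and k: "k \<in> Ideg C I 0"
  shows "dim_ob C k \<noteq> 0" "\<exists>i \<in> Ideg C I 0. encircle C 0 0 i k (idm C i) \<noteq> 0"
proof -
  have kI: "k \<in> I" and kh: "k \<in> homog C 0" using k by (auto simp: Ideg_def)
  have ki: "k \<in> Iinv C I 0 0" using k isomorphic_refl by (simp add: Iinv_def)
  \<comment> \<open>Surjectivity is applied to the basis vector \<lambda>_k: its preimage x writes
    id_k as d_k times a sum of loops, so neither factor can be zero.\<close>
  have "sing 0 k (idm C k) \<in> Verl C I"
    unfolding Verl_def
  proof (intro CollectI conjI allI impI)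
    have "{(g, i). sing 0 k (idm C k) g i \<noteq> (0::'m)} \<subseteq> {(0, k)}" by (auto simp: sing_def split: if_splits)
    then show "finite {(g :: 'g, i). sing 0 k (idm C k) g i \<noteq> (0::'m)}" by (rule finite_subset) simp
    show "sing 0 k (idm C k) g i \<in> hom C i (act C g i)" for g i using idm_hom by (simp add: sing_def)
    show "\<exists>h. i \<in> Ideg C I h \<and> g + h = h + g" if "sing 0 k (idm C k) g i \<noteq> 0" for g :: 'g and i
      using that k by (intro exI[of _ 0]) (auto simp: sing_def split: if_splits)
  qed
  from subsetD[OF surj this] obtain x where x: "sing 0 k (idm C k) = stilde C I x" "x \<in> Verl C I" by (rule imageE)
  have "idm C k = stilde C I x 0 k" unfolding x(1)[symmetric] by (simp add: sing_def)
  also have "\<dots> = scl C (dim_ob C k) (\<Sum>i\<in>Ideg C I 0. encircle C 0 0 i k (x 0 i))"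
    using ki by (simp add: stilde_degree_zero[OF k] scale_sum_right)
  finally have e: "idm C k = scl C (dim_ob C k) (\<Sum>i\<in>Ideg C I 0. encircle C 0 0 i k (x 0 i))" .
  then show "dim_ob C k \<noteq> 0" using idm_nonzero[OF kI] by auto
  have "(\<Sum>i\<in>Ideg C I 0. encircle C 0 0 i k (x 0 i)) \<noteq> 0" using e idm_nonzero[OF kI] by auto
  then obtain i where i: "i \<in> Ideg C I 0" "encircle C 0 0 i k (x 0 i) \<noteq> 0"
    by (rule sum.not_neutral_contains_not_neutral)
  have "x 0 i \<in> hom C i (act C 0 i)" using x(2) unfolding Verl_def by blast
  then have xi: "x 0 i \<in> hom C i i" by simp
  \<comment> \<open>By Schur's lemma the loop carrying the component of x is a multiple of the one
    carrying the identity.\<close>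
  obtain c where c: "x 0 i = scl C c (idm C i)" using Schur_scalar[OF rep_simple xi] i(1) by (auto simp: Ideg_def)
  have "encircle C 0 0 i k (x 0 i) = scl C c (encircle C 0 0 i k (idm C i))"
    unfolding c using i(1) kh by (intro encircle_scl) (simp_all add: Ideg_def idm_hom)
  then have "encircle C 0 0 i k (idm C i) \<noteq> 0" using i(2) by auto
  with i(1) show "\<exists>i \<in> Ideg C I 0. encircle C 0 0 i k (idm C i) \<noteq> 0" by blast
qed

text \<open>Since \<open>\<one> \<otimes> i \<simeq> i\<close>, the scalar of a loop coloured by \<open>\<one>\<close> acts as \<open>1\<close> on the scalar of a loop coloured by \<open>i\<close>,
  and the latter is nonzero for some \<open>i\<close>.\<close>

lemma encircle_unit:
  assumes surj: "Verl C I \<subseteq> stilde C I ` Verl C I" and k: "k \<in> Ideg C I 0"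
  shows "encircle C 0 0 \<one> k (idm C \<one>) = idm C k"
proof -
  have kI: "k \<in> I" and kh: "k \<in> homog C 0" using k by (auto simp: Ideg_def)
  obtain i where i: "i \<in> homog C 0" "encircle C 0 0 i k (idm C i) \<noteq> 0"
    using surj_nonzero(2)[OF surj k] by (auto simp: Ideg_def)
  let ?e = "encircle C 0 0 \<one> k (idm C \<one>)" and ?f = "encircle C 0 0 i k (idm C i)"
  have "?e \<in> hom C k k" using encircle_hom[OF unt_homog kh, of "idm C \<one>"] idm_hom by simp
  then obtain c where c: "?e = scl C c (idm C k)" using Schur_scalar[OF rep_simple[OF kI]] by blast
  have f: "?f \<in> hom C k k" using encircle_hom[OF i(1) kh, of "idm C i"] idm_hom by simp
  have h: "\<one> \<otimes> i \<in> homog C 0" using homog_tens[OF unt_homog i(1)] by simp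
  note l = lun_iso[of i]
  have "encircle C 0 0 (\<one> \<otimes> i) k (idm C (\<one> \<otimes> i)) = ?f"
    using encircle_cyclic[OF iso_hom[OF l] minv_hom[OF l] h i(1) kh] minv_cmp[OF l] cmp_minv[OF l] by simp
  moreover have "encircle C 0 0 (\<one> \<otimes> i) k (idm C (\<one> \<otimes> i)) = act_cmp C 0 0 k \<cdot> actm C 0 ?e \<cdot> ?f"
    using encircle_tens[OF unt_homog i(1) kh] by simp
  ultimately have "?f = scl C c ?f"
    unfolding c using cmp_scl_left[OF idm_hom f] cmp_idm_left[OF f] cmp_idm_left[OF hom_scl[OF f]]
    by (simp add: actm_zero[OF hom_scl[OF idm_hom]] act_cmp_zero_left)
  then have "scl C (c - 1) ?f = 0" by (simp add: scale_left_diff_distrib)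
  with i(2) have "c = 1" by simp
  with c show ?thesis by simp
qed

end

section \<open>Bases and matrices\<close>

context simple_representatives
begin

lemma conv_gen_zero:
  assumes "f \<in> hom C i (act C g i)" "f' \<in> hom C j (act C h j)" "f = 0 \<or> f' = 0"
  shows "conv_gen C g i f h j f' = 0"
proof (cases "isomorphic C (act C h j) i")
  case True
  define k where "k = (SOME k. iso C (act C h j) i k)"
  have k: "iso C (act C h j) i k" unfolding k_def using True by (auto simp: isomorphic_def intro: someI_ex)
  have c: "act_cmp C g h j \<in> hom C (act C g (act C h j)) (act C (g + h) j)" using act_cmp_iso iso_hom by blast
  have "act_cmp C g h j \<cdot> actm C g (minv C (act C h j) i k) \<cdot> f \<cdot> k \<cdot> f' = 0"
    using assms(3)
  proof
    assume "f = 0"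
    then show ?thesis using cmp_zero_left[OF cmp_hom[OF iso_hom[OF k] assms(2)]]
        cmp_zero_right[OF actm_hom[OF minv_hom[OF k]]] cmp_zero_right[OF c] by simp
  next
    assume "f' = 0"
    then show ?thesis using cmp_zero_right[OF iso_hom[OF k]] cmp_zero_right[OF assms(1)]
        cmp_zero_right[OF actm_hom[OF minv_hom[OF k]]] cmp_zero_right[OF c] by simp
  qed
  then show ?thesis using True by (simp add: conv_gen_def Let_def k_def[symmetric] vscl_def fun_eq_iff)
qed (simp add: conv_gen_def)

lemma conv_sing:
  assumes i: "i \<in> I" "f \<in> hom C i (act C g i)" and j: "j \<in> I" "f' \<in> hom C j (act C h j)"
  shows "conv C I (sing g i f) (sing h j f') = conv_gen C g i f h j f'"
proof -
  let ?r = "conv_gen C g i f h j f'"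
  have h1: "sing g i f m p \<in> hom C p (act C m p)" for m p using i by (simp add: sing_def)
  have h2: "sing h j f' m p \<in> hom C p (act C m p)" for m p using j by (simp add: sing_def)
  have e: "conv_gen C m p (sing g i f m p) n q (sing h j f' n q) =
    (if m = g \<and> n = h \<and> p = i \<and> q = j then ?r else 0)" for m n p q
  proof (cases "m = g \<and> n = h \<and> p = i \<and> q = j")
    case False
    then have "sing g i f m p = 0 \<or> sing h j f' n q = 0" by (auto simp: sing_def)
    with False show ?thesis using conv_gen_zero[OF h1 h2] by auto
  qed (auto simp: sing_def)
  have "conv C I (sing g i f) (sing h j f') =
    (\<Sum>m\<in>UNIV. \<Sum>n\<in>UNIV. \<Sum>p\<in>I. \<Sum>q\<in>I. if m = g \<and> n = h \<and> p = i \<and> q = j then ?r else 0)"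
    unfolding conv_def e ..
  moreover have "(\<Sum>q\<in>I. if m = g \<and> n = h \<and> p = i \<and> q = j then ?r else 0) = (if m = g \<and> n = h \<and> p = i then ?r else 0)" for m n p
    using j fin by (cases "m = g \<and> n = h \<and> p = i") auto
  moreover have "(\<Sum>p\<in>I. if m = g \<and> n = h \<and> p = i then ?r else 0) = (if m = g \<and> n = h then ?r else 0)" for m n
    using i fin by (cases "m = g \<and> n = h") auto
  moreover have "(\<Sum>n\<in>UNIV. if m = g \<and> n = h then ?r else 0) = (if m = g then ?r else 0)" for m
    by (cases "m = g") auto
  ultimately show ?thesis by simp
qed

text \<open>The isomorphism \<kappa> in the convolution is arbitrary, but by Schur's lemma l is t
  times its inverse, where t is the scalar of \<kappa> l. Shifting t from one factor to the other
  replaces the inverse of \<kappa> by l.\<close>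

lemma conv_gen_square:
  assumes i: "i \<in> I" and l: "iso C i (act C g i) l"
  shows "conv_gen C g i l g i l = vscl C (inverse (dim_ob C i))
    (sing (g + g) i (act_cmp C g g i \<cdot> actm C g l \<cdot> l))"
proof -
  have ii: "isomorphic C (act C g i) i" using l iso_sym unfolding isomorphic_def by blast
  define k where "k = (SOME k. iso C (act C g i) i k)"
  have k: "iso C (act C g i) i k" unfolding k_def using ii by (auto simp: isomorphic_def intro: someI_ex)
  let ?k' = "minv C (act C g i) i k"
  note lh = iso_hom[OF l] and kh = iso_hom[OF k] and k'h = minv_hom[OF k]
  have c: "act_cmp C g g i \<in> hom C (act C g (act C g i)) (act C (g + g) i)" using act_cmp_iso iso_hom by blast
  obtain t where t: "k \<cdot> l = scl C t (idm C i)" using Schur_scalar[OF rep_simple[OF i] cmp_hom[OF kh lh]] by blast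
  have "l = (?k' \<cdot> k) \<cdot> l" using minv_cmp[OF k] cmp_idm_left[OF lh] by simp
  also have "\<dots> = scl C t ?k'" using cmp_assoc[OF k'h kh lh] t cmp_scl_right[OF k'h idm_hom] cmp_idm_right[OF k'h] by simp
  finally have lk: "l = scl C t ?k'" .
  have "actm C g ?k' \<cdot> l \<cdot> k \<cdot> l = scl C t (actm C g ?k' \<cdot> l)"
    unfolding t using cmp_scl_right[OF lh idm_hom] cmp_idm_right[OF lh] cmp_scl_right[OF actm_hom[OF k'h] lh] by simp
  also have "\<dots> = scl C t (actm C g ?k') \<cdot> l" by (rule cmp_scl_left[OF actm_hom[OF k'h] lh, symmetric])
  also have "scl C t (actm C g ?k') = actm C g l" using actm_scl[OF k'h, of g t] lk by simp
  finally show ?thesis using ii by (simp add: conv_gen_def Let_def k_def[symmetric])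
qed

text \<open>Independence makes coordinates unique on J, and outside J they are fixed to be 0, so the
  \<open>THE\<close> in \<open>coord\<close> is determined.\<close>

lemma coord_eq:
  assumes inj: "\<And>c c'. (\<Sum>j\<in>J. vscl C (c j) (f j)) = (\<Sum>j\<in>J. vscl C (c' j) (f j)) \<Longrightarrow> \<forall>j\<in>J. c j = c' j"
    and x: "x = (\<Sum>j\<in>J. vscl C (c j) (f j))" and j: "j \<in> J"
  shows "coord C f J x j = c j"
proof -
  let ?c = "\<lambda>j. if j \<in> J then c j else 0"
  have s: "(\<Sum>j\<in>J. vscl C (?c j) (f j)) = x" unfolding x by (rule sum.cong) auto
  have "(THE c. (\<forall>j. j \<notin> J \<longrightarrow> c j = 0) \<and> x = (\<Sum>j\<in>J. vscl C (c j) (f j))) = ?c"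
  proof (rule the_equality)
    show "(\<forall>j. j \<notin> J \<longrightarrow> ?c j = 0) \<and> x = (\<Sum>j\<in>J. vscl C (?c j) (f j))" using s by simp
    fix d assume d: "(\<forall>j. j \<notin> J \<longrightarrow> d j = 0) \<and> x = (\<Sum>j\<in>J. vscl C (d j) (f j))"
    have "(\<Sum>j\<in>J. vscl C (d j) (f j)) = (\<Sum>j\<in>J. vscl C (?c j) (f j))" using d s by simp
    from inj[OF this] d show "d = ?c" by (auto simp: fun_eq_iff)
  qed
  then show ?thesis unfolding coord_def using j by simp
qed

lemma Verl_star_zero: "0 \<in> Verl_star C I h"
  by (simp add: Verl_star_def Verl_def)

lemma Verl_star_add: "\<lbrakk>x \<in> Verl_star C I h; y \<in> Verl_star C I h\<rbrakk> \<Longrightarrow> x + y \<in> Verl_star C I h"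
proof -
  assume x: "x \<in> Verl_star C I h" and y: "y \<in> Verl_star C I h"
  have nz: "x g i \<noteq> 0 \<or> y g i \<noteq> 0" if "(x + y) g i \<noteq> 0" for g i using that by auto
  have "finite ({(g, i). x g i \<noteq> 0} \<union> {(g, i). y g i \<noteq> 0})" using x y unfolding Verl_star_def Verl_def by simp
  then have f: "finite {(g, i). (x + y) g i \<noteq> 0}" by (rule rev_finite_subset) auto
  show ?thesis unfolding Verl_star_def Verl_def
  proof (intro CollectI conjI allI impI)
    show "(x + y) g i \<in> hom C i (act C g i)" for g i
      using x y unfolding Verl_star_def Verl_def by (auto intro: hom_add)
    fix g i assume "(x + y) g i \<noteq> 0"
    from nz[OF this] show "\<exists>h. i \<in> Ideg C I h \<and> g + h = h + g" "i \<in> Ideg C I h"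
      using x y unfolding Verl_star_def Verl_def by blast+
  qed (fact f)
qed

lemma Verl_star_vscl: "x \<in> Verl_star C I h \<Longrightarrow> vscl C c x \<in> Verl_star C I h"
proof -
  assume x: "x \<in> Verl_star C I h"
  have "{(g, i). vscl C c x g i \<noteq> 0} \<subseteq> {(g, i). x g i \<noteq> 0}" by (auto simp: vscl_def)
  then show ?thesis using x unfolding Verl_star_def Verl_def
    by (auto intro: hom_scl dest: finite_subset simp: vscl_def)
qed

lemma Verl_star_sing:
  assumes "k \<in> Ideg C I h" "f \<in> hom C k (act C g k)" "g + h = h + g"
  shows "sing g k f \<in> Verl_star C I h"
proof -
  have "{(m, i). sing g k f m i \<noteq> 0} \<subseteq> {(g, k)}" by (auto simp: sing_def split: if_splits)
  then have "finite {(m, i). sing g k f m i \<noteq> 0}" by (rule finite_subset) simp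
  then show ?thesis using assms unfolding Verl_star_def Verl_def
    by (auto simp: sing_def split: if_splits)
qed

lemma vscl_zero_right [simp]: "vscl C c 0 = 0"
  by (simp add: vscl_def fun_eq_iff)

lemma vscl_zero_left [simp]: "vscl C 0 x = 0"
  by (simp add: vscl_def fun_eq_iff)

lemma lin_op_sum:
  assumes M: "lin_op C (Verl_star C I h) T M" and F: "\<And>a. a \<in> A \<Longrightarrow> F a \<in> Verl_star C I h"
  shows "M (\<Sum>a\<in>A. vscl C (c a) (F a)) = (\<Sum>a\<in>A. vscl C (c a) (M (F a)))"
proof -
  have M0: "M 0 = 0"
  proof -
    have "M (vscl C 0 0) = vscl C 0 (M 0)" using M Verl_star_zero unfolding lin_op_def by blast
    then show ?thesis by simp
  qed
  have "M (\<Sum>a\<in>A. vscl C (c a) (F a)) = (\<Sum>a\<in>A. vscl C (c a) (M (F a))) \<and> (\<Sum>a\<in>A. vscl C (c a) (F a)) \<in> Verl_star C I h"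
    using F
  proof (induction A rule: infinite_finite_induct)
    case (insert a A)
    then have "vscl C (c a) (F a) \<in> Verl_star C I h" "(\<Sum>a\<in>A. vscl C (c a) (F a)) \<in> Verl_star C I h"
      and IH: "M (\<Sum>a\<in>A. vscl C (c a) (F a)) = (\<Sum>a\<in>A. vscl C (c a) (M (F a)))"
      by (simp_all add: Verl_star_vscl)
    then have "M (vscl C (c a) (F a) + (\<Sum>a\<in>A. vscl C (c a) (F a))) = vscl C (c a) (M (F a)) + M (\<Sum>a\<in>A. vscl C (c a) (F a))"
      and "vscl C (c a) (F a) + (\<Sum>a\<in>A. vscl C (c a) (F a)) \<in> Verl_star C I h"
      using M insert.prems unfolding lin_op_def by (simp_all add: Verl_star_add)
    then show ?case by (simp only: sum.insert[OF insert.hyps] IH simp_thms)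
  qed (simp_all add: M0 Verl_star_zero)
  then show ?thesis by blast
qed

end

section \<open>The group of order two: generic and adapted bases\<close>

locale bit_representatives = simple_representatives C I
  for C :: "('o, 'm::ab_group_add, bit, 'z) eqcat_scheme" (structure) and I +
  fixes lam :: "bit \<Rightarrow> 'o \<Rightarrow> 'm"
  assumes basis: "generic_basis C I lam"
begin

lemma lam_hom: "i \<in> I \<Longrightarrow> lam g i \<in> hom C i (act C g i)" and lam_zero: "i \<in> I \<Longrightarrow> lam 0 i = idm C i"
  and lam_nonzero: "\<lbrakk>i \<in> I; isomorphic C (act C g i) i\<rbrakk> \<Longrightarrow> lam g i \<noteq> 0"
  using basis by (auto simp: generic_basis_def)

lemma lam_iso:
  assumes "i \<in> I" "isomorphic C (act C g i) i"
  shows "iso C i (act C g i) (lam g i)"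
  by (rule Schur_iso[OF rep_simple[OF assms(1)] simple_act[OF rep_simple[OF assms(1)]] lam_hom[OF assms(1)] lam_nonzero[OF assms]])

lemma IinvD: "k \<in> Iinv C I g h \<Longrightarrow> k \<in> Ideg C I h" "k \<in> Iinv C I g h \<Longrightarrow> k \<in> I"
  "k \<in> Iinv C I g h \<Longrightarrow> isomorphic C (act C g k) k"
  by (auto simp: Iinv_def Ideg_def)

lemma idx_iff: "(g, k) \<in> idx C I \<longleftrightarrow> (if g = 0 then k \<in> Ideg C I 0 else k \<in> Iinv C I 1 0)"
  by (cases g) (auto simp: idx_def)

lemma sum_idx: "(\<Sum>q\<in>idx C I. F q) = (\<Sum>k\<in>Ideg C I 0. F (0, k)) + (\<Sum>k\<in>Iinv C I 1 0. F (1, k))"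
proof -
  have "(\<Sum>q\<in>idx C I. F q) = (\<Sum>q\<in>{0} \<times> Ideg C I 0. F q) + (\<Sum>q\<in>{1} \<times> Iinv C I 1 0. F q)"
    unfolding idx_def by (rule sum.union_disjoint) auto
  also have "{0} \<times> Ideg C I 0 = Pair 0 ` Ideg C I 0" by auto
  also have "{1} \<times> Iinv C I 1 0 = Pair 1 ` Iinv C I 1 0" by auto
  finally show ?thesis by (simp add: sum.reindex inj_on_def)
qed

lemma finite_idx: "finite (idx C I)"
  by (simp add: idx_def)

lemma basis_el_apply: "basis_el lam (g, k) m i = (if m = g \<and> i = k then lam g k else 0)"
  by (simp add: basis_el_def sing_def)

lemma lam_idx: "(g, k) \<in> idx C I \<Longrightarrow> lam g k \<noteq> 0"
  using lam_nonzero[of k g] isomorphic_refl IinvD[of k 1 0]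
  by (cases g) (auto simp: idx_iff Ideg_def)

lemma basis_sum_apply:
  "(\<Sum>q\<in>idx C I. vscl C (c q) (basis_el lam q)) m k = (if (m, k) \<in> idx C I then scl C (c (m, k)) (lam m k) else 0)"
proof -
  have "(\<Sum>q\<in>idx C I. vscl C (c q) (basis_el lam q)) m k = (\<Sum>q\<in>idx C I. if q = (m, k) then scl C (c q) (lam m k) else 0)"
    unfolding sum_apply2
  proof (rule sum.cong[OF refl])
    fix q
    show "vscl C (c q) (basis_el lam q) m k = (if q = (m, k) then scl C (c q) (lam m k) else 0)"
      by (cases q) (auto simp: vscl_def basis_el_apply)
  qed
  then show ?thesis using finite_idx by simp
qed

lemma basis_inj:
  assumes "(\<Sum>q\<in>idx C I. vscl C (c q) (basis_el lam q)) = (\<Sum>q\<in>idx C I. vscl C (c' q) (basis_el lam q))"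
  shows "\<forall>q\<in>idx C I. c q = c' q"
proof
  fix q assume q: "q \<in> idx C I"
  obtain g k where gk: "q = (g, k)" by (cases q)
  have "scl C (c (g, k)) (lam g k) = scl C (c' (g, k)) (lam g k)"
    using fun_cong[OF fun_cong[OF assms, of g], of k] q gk by (simp add: basis_sum_apply)
  then show "c q = c' q" using lam_idx q gk by simp
qed

lemma vscl_add: "vscl C c (x + y) = vscl C c x + vscl C c y"
  by (simp add: vscl_def fun_eq_iff scale_right_distrib)

lemma vscl_diff: "vscl C c (x - y) = vscl C c x + vscl C (- c) y"
  by (simp add: vscl_def fun_eq_iff scale_right_diff_distrib scale_minus_left)

lemma adapted_apply:
  assumes "(g, k) \<in> idx C I"
  shows "adapted_el C lam I (g, k) = (if k \<in> Iinv C I 1 0 then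
    vscl C (1/2) (basis_el lam (1, k)) + vscl C (if g = 0 then - (1/2) else 1/2) (basis_el lam (0, k))
    else basis_el lam (0, k))"
proof (cases "k \<in> Iinv C I 1 0")
  case True
  then show ?thesis unfolding adapted_el_def alpha_def beta_def by (simp add: vscl_add vscl_diff)
next
  case False
  \<comment> \<open>Index pairs (1, k) exist only for invariant k.\<close>
  then have "g = 0" using assms by (cases g) (simp_all add: idx_iff)
  with False show ?thesis by (simp add: adapted_el_def)
qed

text \<open>c_0 \<alpha>_k + c_1 \<beta>_k has half difference and half sum of c_1, c_0 as its
  generic coordinates. This reduces independence of the adapted elements to that of the generic
  basis.\<close>

lemma adapted_sum:
  "(\<Sum>q\<in>idx C I. vscl C (c q) (adapted_el C lam I q)) = (\<Sum>q\<in>idx C I. vscl C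
     (if snd q \<in> Iinv C I 1 0 then if fst q = 0 then (c (1, snd q) - c (0, snd q)) / 2 else (c (1, snd q) + c (0, snd q)) / 2
      else c q) (basis_el lam q))"
proof (intro ext)
  fix m k
  let ?v = "Iinv C I 1 0"
  let ?l = "\<lambda>g. basis_el lam (g, k) m k"
  have "(\<Sum>q\<in>idx C I. vscl C (c q) (adapted_el C lam I q)) m k
    = (\<Sum>i\<in>Ideg C I 0. vscl C (c (0, i)) (adapted_el C lam I (0, i)) m k) + (\<Sum>i\<in>?v. vscl C (c (1, i)) (adapted_el C lam I (1, i)) m k)"
    unfolding sum_apply2 by (rule sum_idx)
  also have "(\<Sum>i\<in>Ideg C I 0. vscl C (c (0, i)) (adapted_el C lam I (0, i)) m k)
    = (\<Sum>i\<in>Ideg C I 0. if i = k then if k \<in> ?v then scl C (c (0, k) / 2) (?l 1) + scl C (- c (0, k) / 2) (?l 0) else scl C (c (0, k)) (?l 0) else 0)"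
    by (intro sum.cong refl) (auto simp: adapted_apply idx_iff vscl_def basis_el_apply scale_right_distrib)
  also have "(\<Sum>i\<in>?v. vscl C (c (1, i)) (adapted_el C lam I (1, i)) m k)
    = (\<Sum>i\<in>?v. if i = k then scl C (c (1, k) / 2) (?l 1) + scl C (c (1, k) / 2) (?l 0) else 0)"
    by (intro sum.cong refl) (auto simp: adapted_apply idx_iff vscl_def basis_el_apply scale_right_distrib)
  finally have L: "(\<Sum>q\<in>idx C I. vscl C (c q) (adapted_el C lam I q)) m k
    = (if k \<in> Ideg C I 0 then if k \<in> ?v then scl C (c (0, k) / 2) (?l 1) + scl C (- c (0, k) / 2) (?l 0) else scl C (c (0, k)) (?l 0) else 0)
      + (if k \<in> ?v then scl C (c (1, k) / 2) (?l 1) + scl C (c (1, k) / 2) (?l 0) else 0)" by simp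
  show "(\<Sum>q\<in>idx C I. vscl C (c q) (adapted_el C lam I q)) m k = (\<Sum>q\<in>idx C I. vscl C
     (if snd q \<in> ?v then if fst q = 0 then (c (1, snd q) - c (0, snd q)) / 2 else (c (1, snd q) + c (0, snd q)) / 2
      else c q) (basis_el lam q)) m k"
    unfolding L basis_sum_apply using IinvD(1)[of k 1 0]
    by (cases m) (auto simp: basis_el_apply idx_iff scale_left_distrib[symmetric] scale_left_diff_distrib[symmetric] add_divide_distrib diff_divide_distrib)
qed

lemma adapted_inj:
  assumes "(\<Sum>q\<in>idx C I. vscl C (c q) (adapted_el C lam I q)) = (\<Sum>q\<in>idx C I. vscl C (c' q) (adapted_el C lam I q))"
  shows "\<forall>q\<in>idx C I. c q = c' q"
proof
  fix q assume q: "q \<in> idx C I"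
  obtain g k where gk: "q = (g, k)" by (cases q)
  note * = basis_inj[OF assms[unfolded adapted_sum]]
  show "c q = c' q"
  proof (cases "k \<in> Iinv C I 1 0")
    case True
    then have "(0, k) \<in> idx C I" "(1, k) \<in> idx C I" using IinvD by (auto simp: idx_iff)
    from *[rule_format, OF this(1)] *[rule_format, OF this(2)]
    have d: "(c (1, k) - c (0, k)) / 2 = (c' (1, k) - c' (0, k)) / 2" "(c (1, k) + c (0, k)) / 2 = (c' (1, k) + c' (0, k)) / 2"
      unfolding fst_conv snd_conv using True by (simp_all only: if_True if_False simp_thms zero_neq_one one_neq_zero)
    \<comment> \<open>Two numbers are determined by their half sum and half difference.\<close>
    have "x = (x + y) / 2 + (x - y) / 2" "y = (x + y) / 2 - (x - y) / 2" for x y :: complex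
      by (simp_all add: field_simps)
    then have "c (0, k) = c' (0, k) \<and> c (1, k) = c' (1, k)" using d by metis
    then show ?thesis unfolding gk by (cases g) auto
  next
    case False
    then show ?thesis using *[rule_format, OF q] gk by simp
  qed
qed

end

section \<open>Loops of degree a and the values of the form\<close>

locale normalized_bit_representatives = bit_representatives C I lam
  for C :: "('o, 'm::ab_group_add, bit, 'z) eqcat_scheme" (structure) and I and lam :: "bit \<Rightarrow> 'o \<Rightarrow> 'm" +
  assumes surj: "Verl C I \<subseteq> stilde C I ` Verl C I"
    and normalized: "k \<in> Iinv C I 1 0 \<Longrightarrow>
           conv C I (basis_el lam (1, k)) (basis_el lam (1, k))
             = vscl C (inverse (dim_ob C k)) (basis_el lam (0, k))"
begin

text \<open>\<open>conv_gen_square\<close> evaluates the left side of the normalization; the factor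
  d_k^-1 on both sides cancels because d_k is nonzero.\<close>

lemma lam_square:
  assumes k: "k \<in> Iinv C I 1 0"
  shows "act_cmp C 1 1 k \<cdot> actm C 1 (lam 1 k) \<cdot> lam 1 k = idm C k"
proof -
  note kI = IinvD(2)[OF k]
  have "vscl C (inverse (dim_ob C k)) (sing (1 + 1) k (act_cmp C 1 1 k \<cdot> actm C 1 (lam 1 k) \<cdot> lam 1 k))
    = conv C I (basis_el lam (1, k)) (basis_el lam (1, k))"
    using conv_sing[OF kI lam_hom[OF kI] kI lam_hom[OF kI], of 1 1] conv_gen_square[OF kI lam_iso[OF kI IinvD(3)[OF k]]]
    by (simp add: basis_el_def)
  also have "\<dots> = vscl C (inverse (dim_ob C k)) (sing 0 k (idm C k))"
    unfolding normalized[OF k] by (simp add: basis_el_def lam_zero[OF kI])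
  finally have "vscl C (inverse (dim_ob C k)) (sing (1 + 1) k (act_cmp C 1 1 k \<cdot> actm C 1 (lam 1 k) \<cdot> lam 1 k)) 0 k
     = vscl C (inverse (dim_ob C k)) (sing 0 k (idm C k)) 0 k" by simp
  then show ?thesis using surj_nonzero(1)[OF surj IinvD(1)[OF k]] by (simp add: vscl_def sing_def)
qed

text \<open>The e_i of the overview on the strand k; \<open>encircle_invariant\<close> shows that
  such a scalar exists for i of degree a and invariant k.\<close>

definition loop_coeff :: "'o \<Rightarrow> 'o \<Rightarrow> complex" where
  "loop_coeff i k = (SOME t. encircle C 0 1 i k (idm C i) = scl C t (lam 1 k))"

lemma encircle_invariant:
  assumes i: "i \<in> Ideg C I 1" and k: "k \<in> Iinv C I 1 0"
  shows "encircle C 0 1 i k (idm C i) = scl C (loop_coeff i k) (lam 1 k)"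
proof -
  note kI = IinvD(2)[OF k]
  have "encircle C 0 1 i k (idm C i) \<in> hom C k (act C 1 k)"
    using encircle_hom[of i 1 k 0 "idm C i"] i IinvD(1)[OF k] by (simp add: Ideg_def idm_hom)
  from Schur_hom[OF rep_simple[OF kI] lam_iso[OF kI IinvD(3)[OF k]] this]
  show ?thesis unfolding loop_coeff_def by (rule someI_ex)
qed

lemma encircle_noninvariant:
  assumes i: "i \<in> Ideg C I 1" and k: "k \<in> Ideg C I 0 - Iinv C I 1 0"
  shows "encircle C 0 1 i k (idm C i) = 0"
proof (rule Schur_zero)
  have kI: "k \<in> I" using k by (simp add: Ideg_def)
  show "simple C k" "simple C (act C 1 k)" using rep_simple[OF kI] simple_act by blast+
  show "\<not> isomorphic C k (act C 1 k)" using k isomorphic_sym by (auto simp: Iinv_def)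
  show "encircle C 0 1 i k (idm C i) \<in> hom C k (act C 1 k)"
    using encircle_hom[of i 1 k 0 "idm C i"] i k by (simp add: Ideg_def idm_hom)
qed

lemma encircle_product:
  assumes i: "i \<in> Ideg C I 1" and j: "j \<in> Ideg C I 1" and k: "k \<in> Ideg C I 0"
  shows "encircle C 0 0 (i \<otimes> j) k (idm C (i \<otimes> j))
    = scl C (if k \<in> Iinv C I 1 0 then loop_coeff i k * loop_coeff j k else 0) (idm C k)"
proof -
  let ?e = "\<lambda>i. encircle C 0 1 i k (idm C i)"
  have "1 + 1 = (0 :: bit)" by simp
  then have "encircle C 0 0 (i \<otimes> j) k (idm C (i \<otimes> j)) = act_cmp C 1 1 k \<cdot> actm C 1 (?e i) \<cdot> ?e j"
    using encircle_tens[of i 1 j 1 k] i j k by (simp add: Ideg_def)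
  also have "\<dots> = scl C (if k \<in> Iinv C I 1 0 then loop_coeff i k * loop_coeff j k else 0) (idm C k)"
  proof (cases "k \<in> Iinv C I 1 0")
    case True
    note kI = IinvD(2)[OF True]
    have l: "lam 1 k \<in> hom C k (act C 1 k)" by (rule lam_hom[OF kI])
    note al = actm_hom[OF l, of 1]
    have c: "act_cmp C 1 1 k \<in> hom C (act C 1 (act C 1 k)) (act C (1 + 1) k)" using act_cmp_iso iso_hom by blast
    have "actm C 1 (?e i) \<cdot> ?e j = scl C (loop_coeff i k * loop_coeff j k) (actm C 1 (lam 1 k) \<cdot> lam 1 k)"
      unfolding encircle_invariant[OF i True] encircle_invariant[OF j True] actm_scl[OF l]
      using cmp_scl_left[OF al hom_scl[OF l]] cmp_scl_right[OF al l] by simp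
    then show ?thesis using True cmp_scl_right[OF c cmp_hom[OF al l]] lam_square[OF True] by simp
  next
    case False
    have "?e i \<in> hom C k (act C 1 k)" using encircle_hom[of i 1 k 0 "idm C i"] i k by (simp add: Ideg_def idm_hom)
    note a = actm_hom[OF this, of 1]
    have c: "act_cmp C 1 1 k \<in> hom C (act C 1 (act C 1 k)) (act C (1 + 1) k)" using act_cmp_iso iso_hom by blast
    have "?e j = 0" using encircle_noninvariant j k False by simp
    then show ?thesis using False cmp_zero_right[OF a] cmp_zero_right[OF c] by simp
  qed
  finally show ?thesis .
qed

lemma basis_el_zero: "i \<in> I \<Longrightarrow> basis_el lam (0, i) = sing 0 i (idm C i)"
  by (simp add: basis_el_def lam_zero)

lemma s_basis_apply:
  assumes i: "i \<in> Ideg C I 1"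
  shows "s_op C I D (basis_el lam (0, i)) m k
    = (if m = 1 \<and> k \<in> Iinv C I 1 0 then scl C (inverse D * dim_ob C k * loop_coeff i k) (lam 1 k) else 0)"
proof (cases "k \<in> Ideg C I 0")
  case True
  then show ?thesis
    using stilde_sing[OF i True, of m] encircle_invariant[OF i, of k] IdegD(1)[OF i]
    by (cases m) (simp_all add: s_op_def vscl_def basis_el_zero)
next
  case False
  have "sing 0 i (idm C i) g p = 0" if "g \<noteq> 0" for g :: bit and p using that by (simp add: sing_def)
  from stilde_outside[OF this False] show ?thesis
    using False IinvD(1)[of k 1 0] IdegD(1)[OF i] by (auto simp: s_op_def vscl_def basis_el_zero)
qed

lemma s_basis:
  assumes i: "i \<in> Ideg C I 1"
  shows "s_op C I D (basis_el lam (0, i))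
    = (\<Sum>k\<in>Iinv C I 1 0. vscl C (inverse D * dim_ob C k * loop_coeff i k) (basis_el lam (1, k)))"
proof (intro ext)
  fix m k
  have "(\<Sum>k\<in>Iinv C I 1 0. vscl C (inverse D * dim_ob C k * loop_coeff i k) (basis_el lam (1, k))) m k
    = (\<Sum>k'\<in>Iinv C I 1 0. if k' = k then if m = 1 then scl C (inverse D * dim_ob C k * loop_coeff i k) (lam 1 k) else 0 else 0)"
    unfolding sum_apply2 by (intro sum.cong refl) (auto simp: vscl_def basis_el_apply)
  then show "s_op C I D (basis_el lam (0, i)) m k
    = (\<Sum>k\<in>Iinv C I 1 0. vscl C (inverse D * dim_ob C k * loop_coeff i k) (basis_el lam (1, k))) m k"
    by (simp add: s_basis_apply[OF i])
qed

lemma s_product: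
  assumes i: "i \<in> Ideg C I 1" and j: "j \<in> Ideg C I 1"
  shows "s_op C I D (vtens C I (basis_el lam (0, i)) (basis_el lam (0, j)))
    = (\<Sum>k\<in>Ideg C I 0. vscl C (if k \<in> Iinv C I 1 0 then inverse D * dim_ob C k * loop_coeff i k * loop_coeff j k else 0)
        (basis_el lam (0, k)))"
proof (intro ext)
  fix m k
  have "1 + 1 = (0 :: bit)" by simp
  then have ij: "i \<otimes> j \<in> homog C 0" using homog_tens[of i 1 j 1] i j by (simp add: Ideg_def)
  have v: "vtens C I (basis_el lam (0, i)) (basis_el lam (0, j)) = cls C I 0 (i \<otimes> j) (idm C (i \<otimes> j))"
    using vtens_sing[OF IdegD(1)[OF i] IdegD(1)[OF j]] IdegD(1)[OF i] IdegD(1)[OF j] by (simp add: basis_el_zero)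
  let ?c = "if k \<in> Iinv C I 1 0 then inverse D * dim_ob C k * loop_coeff i k * loop_coeff j k else 0"
  have "s_op C I D (vtens C I (basis_el lam (0, i)) (basis_el lam (0, j))) m k
    = (if m = 0 \<and> k \<in> Ideg C I 0 then scl C ?c (idm C k) else 0)"
  proof (cases "k \<in> Ideg C I 0")
    case True
    have "k \<in> Iinv C I 0 0" using True isomorphic_refl by (simp add: Iinv_def)
    then show ?thesis using stilde_cls[OF ij True, of m] encircle_product[OF i j True] True
      by (auto simp: s_op_def vscl_def v mult.assoc)
  next
    case False
    have "cls C I 0 (i \<otimes> j) (idm C (i \<otimes> j)) g p = 0" if "g \<noteq> 0" for g p using that by (rule cls_off)
    from stilde_outside[OF this False] show ?thesis using False by (simp add: s_op_def vscl_def v)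
  qed
  also have "\<dots> = (\<Sum>k'\<in>Ideg C I 0. if k' = k then if m = 0 then scl C ?c (idm C k) else 0 else 0)" by simp
  also have "\<dots> = (\<Sum>k\<in>Ideg C I 0. vscl C (if k \<in> Iinv C I 1 0 then inverse D * dim_ob C k * loop_coeff i k * loop_coeff j k else 0)
        (basis_el lam (0, k))) m k"
    unfolding sum_apply2 by (intro sum.cong refl) (auto simp: vscl_def basis_el_apply lam_zero Ideg_def)
  finally show "s_op C I D (vtens C I (basis_el lam (0, i)) (basis_el lam (0, j))) m k = \<dots>" .
qed

lemma s_op_hom:
  assumes "i \<in> I"
  shows "s_op C I D (basis_el lam (0, i)) m k \<in> hom C k (act C m k)"
  unfolding s_op_def vscl_def
  by (intro hom_scl stilde_hom) (use assms lam_hom[of i 0] in \<open>simp add: basis_el_apply\<close>)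

text \<open>In a group of order two -1 = 1, so the condition on x in \<open>vform_sing\<close> is
  \<open>lam_square\<close> up to the scalar.\<close>

lemma vform_s_basis:
  assumes i: "i \<in> Ideg C I 1" and k: "k \<in> Iinv C I 1 0"
  shows "vform C I (s_op C I D (basis_el lam (0, i))) (basis_el lam (1, k)) = inverse D * dim_ob C k * loop_coeff i k"
proof -
  note kI = IinvD(2)[OF k]
  have l: "lam 1 k \<in> hom C k (act C 1 k)" by (rule lam_hom[OF kI])
  have c: "act_cmp C 1 1 k \<in> hom C (act C 1 (act C 1 k)) (act C (1 + 1) k)" using act_cmp_iso iso_hom by blast
  have "vform C I (s_op C I D (basis_el lam (0, i))) (sing 1 k (lam 1 k)) = inverse D * dim_ob C k * loop_coeff i k"
  proof (rule vform_sing[OF kI lam_iso[OF kI IinvD(3)[OF k]] s_op_hom[OF IdegD(1)[OF i]]])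
    show "act_cmp C (- 1) 1 k \<cdot> actm C (- 1) (lam 1 k) \<cdot> s_op C I D (basis_el lam (0, i)) (- 1) k =
      scl C (inverse D * dim_ob C k * loop_coeff i k) (idm C k)"
      using cmp_scl_right[OF actm_hom[OF l] l] cmp_scl_right[OF c cmp_hom[OF actm_hom[OF l] l]] lam_square[OF k] k
      by (simp add: s_basis_apply[OF i])
  qed
  then show ?thesis by (simp add: basis_el_def)
qed

text \<open>In degree 0 the action is the identity, and \<open>encircle_unit\<close> evaluates the
  loop coloured by the unit.\<close>

lemma vform_s_unit:
  assumes k: "k \<in> Ideg C I 0"
  shows "vform C I (s_op C I D (basis_el lam (0, \<one>))) (basis_el lam (0, k)) = inverse D * dim_ob C k"
proof -
  note kI = IdegD(1)[OF k]
  have u: "\<one> \<in> Ideg C I 0" using unt_rep unt_homog by (simp add: Ideg_def)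
  have k0: "k \<in> Iinv C I 0 0" using k isomorphic_refl by (simp add: Iinv_def)
  have s: "s_op C I D (basis_el lam (0, \<one>)) 0 k = scl C (inverse D * dim_ob C k) (idm C k)"
    using stilde_sing[OF u k, of 0] encircle_unit[OF surj k] k0
    by (simp add: s_op_def vscl_def basis_el_zero[OF unt_rep])
  have "vform C I (s_op C I D (basis_el lam (0, \<one>))) (sing 0 k (idm C k)) = inverse D * dim_ob C k"
  proof (rule vform_sing[OF kI _ s_op_hom[OF unt_rep]])
    show "iso C k (act C 0 k) (idm C k)" using iso_idm by simp
    show "act_cmp C (- 0) 0 k \<cdot> actm C (- 0) (idm C k) \<cdot> s_op C I D (basis_el lam (0, \<one>)) (- 0) k =
      scl C (inverse D * dim_ob C k) (idm C k)"
      using cmp_idm_left[OF hom_scl[OF idm_hom[of k]]] by (simp add: s actm_idm act_cmp_zero_left)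
  qed
  then show ?thesis by (simp add: basis_el_zero[OF kI])
qed

end

text \<open>Columns are indexed by the \<lambda>_j with j of degree a. \<open>D\<^sub>i\<close> is
  diagonal in the adapted basis, while \<open>M \<circ> s\<close> is expanded in the generic one
  with the same index set, so the matrix product is a multiplication of coordinates entry by
  entry.\<close>

theorem theorem8p3:
  fixes C :: "('o, 'm::ab_group_add, bit) eqcat"
    and I :: "'o set" and lam :: "bit \<Rightarrow> 'o \<Rightarrow> 'm" and D :: complex and i :: 'o
    and s M L\<^sub>i D\<^sub>i :: "('o, 'm, bit) verl \<Rightarrow> ('o, 'm, bit) verl"
  defines "s \<equiv> s_op C I D"
    and "L\<^sub>i \<equiv> vtens C I (basis_el lam (0, i))"
  assumes "modular_category C I"
    and "D\<^sup>2 = p_plus C I * p_minus C I"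
    and "generic_basis C I lam"
    and "\<And>k. k \<in> Iinv C I 1 0 \<Longrightarrow>
           conv C I (basis_el lam (1, k)) (basis_el lam (1, k))
             = vscl C (inverse (dim_ob C k)) (basis_el lam (0, k))"
    and "lin_op C (Verl_star C I 0) (Verl_star C I 0) M"
    and "\<And>k. k \<in> Iinv C I 1 0 \<Longrightarrow> M (basis_el lam (0, k)) = alpha C lam k"
    and "\<And>k. k \<in> Iinv C I 1 0 \<Longrightarrow> M (basis_el lam (1, k)) = beta C lam k"
    and "\<And>k. k \<in> Ideg C I 0 - Iinv C I 1 0 \<Longrightarrow> M (basis_el lam (0, k)) = basis_el lam (0, k)"
    and "i \<in> Ideg C I 1"
    and "lin_op C (Verl_star C I 0) (Verl_star C I 0) D\<^sub>i"
    and "\<And>k. k \<in> Iinv C I 1 0 \<Longrightarrow> D\<^sub>i (alpha C lam k)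
           = vscl C (- (vform C I (s (basis_el lam (0, i))) (basis_el lam (1, k))
                        / vform C I (s (basis_el lam (0, \<one>\<^bsub>C\<^esub>))) (basis_el lam (0, k))))
               (alpha C lam k)"
    and "\<And>k. k \<in> Iinv C I 1 0 \<Longrightarrow> D\<^sub>i (beta C lam k)
           = vscl C (vform C I (s (basis_el lam (0, i))) (basis_el lam (1, k))
                     / vform C I (s (basis_el lam (0, \<one>\<^bsub>C\<^esub>))) (basis_el lam (0, k)))
               (beta C lam k)"
    and "\<And>k. k \<in> Ideg C I 0 - Iinv C I 1 0 \<Longrightarrow> D\<^sub>i (basis_el lam (0, k))
           = vscl C (vform C I (s (basis_el lam (0, i))) (basis_el lam (1, k))
                     / vform C I (s (basis_el lam (0, \<one>\<^bsub>C\<^esub>))) (basis_el lam (0, k)))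
               (basis_el lam (0, k))"
  shows "\<forall>r \<in> idx C I. \<forall>j \<in> Ideg C I 1.
           matrix_of C (basis_el lam) (basis_el lam) (idx C I) (M \<circ> s \<circ> L\<^sub>i) r (0, j)
             = (\<Sum>q \<in> idx C I.
                  matrix_of C (adapted_el C lam I) (adapted_el C lam I) (idx C I) D\<^sub>i r q *
                  matrix_of C (basis_el lam) (basis_el lam) (idx C I) (M \<circ> s) q (0, j))"
proof (intro ballI)
  interpret equivariant_fusion_category C
    using assms(3) by (simp add: modular_category_def)
  interpret normalized_bit_representatives C I lam
    by unfold_locales (use assms(3,5,6) in \<open>auto simp: modular_category_def bij_betw_def\<close>)
  note M = assms(7) and i = assms(11)
  let ?J = "idx C I" and ?v = "Iinv C I 1 0"
  define c where "c k = vform C I (s (basis_el lam (0, i))) (basis_el lam (1, k))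
    / vform C I (s (basis_el lam (0, \<one>\<^bsub>C\<^esub>))) (basis_el lam (0, k))" for k
  \<comment> \<open>The diagonal of \<open>D\<^sub>i\<close>, with the minus sign at the positions
    of the \<alpha>_k.\<close>
  define e where "e q = (if fst q = 0 \<and> snd q \<in> ?v then - c (snd q) else c (snd q))" for q :: "bit \<times> 'o"
  have star: "basis_el lam q \<in> Verl_star C I 0" if "q \<in> ?J" for q
  proof -
    obtain g k where q: "q = (g, k)" by (cases q)
    then have "k \<in> Ideg C I 0" using that IinvD(1)[of k 1 0] by (auto simp: idx_iff split: if_splits)
    then show ?thesis using Verl_star_sing[of k 0 "lam g k" g] lam_hom[of k g] by (simp add: q basis_el_def Ideg_def)
  qed
  have De: "D\<^sub>i (adapted_el C lam I q) = vscl C (e q) (adapted_el C lam I q)" if "q \<in> ?J" for q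
  proof -
    obtain g k where q: "q = (g, k)" by (cases q)
    show ?thesis
    proof (cases "k \<in> ?v")
      case True
      then show ?thesis using assms(13,14)[OF True] unfolding q e_def c_def by (simp add: adapted_el_def)
    next
      case False
      with that q have "g = 0" "k \<in> Ideg C I 0 - ?v" by (auto simp: idx_iff split: if_splits)
      then show ?thesis using assms(15)[of k] unfolding q e_def c_def by (simp add: adapted_el_def)
    qed
  qed
  fix r j assume r: "r \<in> ?J" and j: "j \<in> Ideg C I 1"
  have Dmat: "matrix_of C (adapted_el C lam I) (adapted_el C lam I) ?J D\<^sub>i r q = (if r = q then e q else 0)"
    if q: "q \<in> ?J" for q
    unfolding matrix_of_def
  proof (rule coord_eq[OF adapted_inj _ r])
    have "(\<Sum>p\<in>?J. vscl C (if p = q then e q else 0) (adapted_el C lam I p))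
      = (\<Sum>p\<in>?J. if p = q then vscl C (e q) (adapted_el C lam I q) else 0)"
      by (intro sum.cong refl) auto
    then show "D\<^sub>i (adapted_el C lam I q) = (\<Sum>p\<in>?J. vscl C (if p = q then e q else 0) (adapted_el C lam I p))"
      using De[OF q] q finite_idx by simp
  qed
  \<comment> \<open>\<open>?t k\<close> is the coefficient of \<lambda>_k in s applied to the
    product of \<lambda>_i and \<lambda>_j, and \<open>?u k\<close> in the next line is the
    coefficient of the twisted basis element at k in s \<lambda>_j.\<close>
  let ?t = "\<lambda>k. inverse D * dim_ob C k * loop_coeff i k * loop_coeff j k"
  let ?u = "\<lambda>k. inverse D * dim_ob C k * loop_coeff j k"
  \<comment> \<open>s \<lambda>_j involves only twisted basis elements, which \<open>M\<close> takes
    to the \<beta>_k; hence equal coordinates in both positions of k.\<close>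
  have Ms: "matrix_of C (basis_el lam) (basis_el lam) ?J (M \<circ> s) r (0, j)
    = (if snd r \<in> ?v then ?u (snd r) / 2 else 0)"
    unfolding matrix_of_def
  proof (rule coord_eq[OF basis_inj _ r])
    have "(M \<circ> s) (basis_el lam (0, j)) = (\<Sum>k\<in>?v. vscl C (?u k) (M (basis_el lam (1, k))))"
      unfolding comp_apply s_def s_basis[OF j] by (rule lin_op_sum[OF M star]) (simp add: idx_iff)
    also have "\<dots> = (\<Sum>k\<in>?v. vscl C (?u k / 2) (basis_el lam (0, k)) + vscl C (?u k / 2) (basis_el lam (1, k)))"
      by (intro sum.cong refl) (simp add: assms(9) beta_def vscl_def fun_eq_iff scale_right_distrib add.commute)
    also have "\<dots> = (\<Sum>k\<in>?v. vscl C (?u k / 2) (basis_el lam (0, k))) + (\<Sum>k\<in>?v. vscl C (?u k / 2) (basis_el lam (1, k)))"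
      by (rule sum.distrib)
    also have "(\<Sum>k\<in>?v. vscl C (?u k / 2) (basis_el lam (0, k)))
      = (\<Sum>k\<in>Ideg C I 0. vscl C (if k \<in> ?v then ?u k / 2 else 0) (basis_el lam (0, k)))"
      using IinvD(1)[of _ 1 0] by (intro sum.mono_neutral_cong_left) auto
    finally show "(M \<circ> s) (basis_el lam (0, j)) = (\<Sum>q\<in>?J. vscl C (if snd q \<in> ?v then ?u (snd q) / 2 else 0) (basis_el lam q))"
      unfolding sum_idx by (rule trans) (intro arg_cong2[where f = "(+)"] sum.cong refl, simp_all)
  qed
  \<comment> \<open>Now \<lambda>_k occurs and \<open>M\<close> takes it to \<alpha>_k, whose
    coordinate at \<lambda>_k is negative: this is the sign that \<open>e\<close>
    reproduces.\<close>
  have MsL: "matrix_of C (basis_el lam) (basis_el lam) ?J (M \<circ> s \<circ> L\<^sub>i) r (0, j)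
    = (if snd r \<in> ?v then if fst r = 0 then - ?t (snd r) / 2 else ?t (snd r) / 2 else 0)"
    unfolding matrix_of_def
  proof (rule coord_eq[OF basis_inj _ r])
    have "(M \<circ> s \<circ> L\<^sub>i) (basis_el lam (0, j)) = (\<Sum>k\<in>Ideg C I 0. vscl C (if k \<in> ?v then ?t k else 0) (M (basis_el lam (0, k))))"
      unfolding comp_apply s_def L\<^sub>i_def s_product[OF i j] by (rule lin_op_sum[OF M star]) (simp add: idx_iff)
    also have "\<dots> = (\<Sum>k\<in>?v. vscl C (- ?t k / 2) (basis_el lam (0, k)) + vscl C (?t k / 2) (basis_el lam (1, k)))"
    proof (rule sum.mono_neutral_cong_right)
      show "\<forall>k\<in>Ideg C I 0 - ?v. vscl C (if k \<in> ?v then ?t k else 0) (M (basis_el lam (0, k))) = 0" by simp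
      fix k assume "k \<in> ?v"
      then show "vscl C (if k \<in> ?v then ?t k else 0) (M (basis_el lam (0, k)))
        = vscl C (- ?t k / 2) (basis_el lam (0, k)) + vscl C (?t k / 2) (basis_el lam (1, k))"
        by (simp add: assms(8) alpha_def vscl_def fun_eq_iff scale_right_diff_distrib scale_minus_left)
    qed (use IinvD(1)[of _ 1 0] in auto)
    also have "\<dots> = (\<Sum>k\<in>?v. vscl C (- ?t k / 2) (basis_el lam (0, k))) + (\<Sum>k\<in>?v. vscl C (?t k / 2) (basis_el lam (1, k)))"
      by (rule sum.distrib)
    also have "(\<Sum>k\<in>?v. vscl C (- ?t k / 2) (basis_el lam (0, k)))
      = (\<Sum>k\<in>Ideg C I 0. vscl C (if k \<in> ?v then - ?t k / 2 else 0) (basis_el lam (0, k)))"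
      using IinvD(1)[of _ 1 0] by (intro sum.mono_neutral_cong_left) auto
    finally show "(M \<circ> s \<circ> L\<^sub>i) (basis_el lam (0, j)) = (\<Sum>q\<in>?J. vscl C
       (if snd q \<in> ?v then if fst q = 0 then - ?t (snd q) / 2 else ?t (snd q) / 2 else 0) (basis_el lam q))"
      unfolding sum_idx by (rule trans) (intro arg_cong2[where f = "(+)"] sum.cong refl, simp_all)
  qed
  \<comment> \<open>for \<open>D = 0\<close> both sides are \<open>0\<close>, since \<open>inverse 0 = 0\<close>\<close>
  have "c k * ?u k = ?t k" if k: "k \<in> ?v" for k
    using surj_nonzero(1)[OF surj IinvD(1)[OF k]] vform_s_basis[OF i k, of D] vform_s_unit[OF IinvD(1)[OF k], of D]
    by (cases "D = 0") (simp_all add: c_def s_def field_simps)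
  then have "e r * (if snd r \<in> ?v then ?u (snd r) / 2 else 0)
    = (if snd r \<in> ?v then if fst r = 0 then - ?t (snd r) / 2 else ?t (snd r) / 2 else 0)"
    by (auto simp: e_def)
  moreover have "(\<Sum>q\<in>?J. matrix_of C (adapted_el C lam I) (adapted_el C lam I) ?J D\<^sub>i r q *
      matrix_of C (basis_el lam) (basis_el lam) ?J (M \<circ> s) q (0, j))
    = (\<Sum>q\<in>?J. if q = r then e r * matrix_of C (basis_el lam) (basis_el lam) ?J (M \<circ> s) r (0, j) else 0)"
    by (intro sum.cong refl) (auto simp: Dmat)
  ultimately show "matrix_of C (basis_el lam) (basis_el lam) ?J (M \<circ> s \<circ> L\<^sub>i) r (0, j)
    = (\<Sum>q\<in>?J. matrix_of C (adapted_el C lam I) (adapted_el C lam I) ?J D\<^sub>i r q *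
        matrix_of C (basis_el lam) (basis_el lam) ?J (M \<circ> s) q (0, j))"
    using r finite_idx Ms MsL by simp
qed

end
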